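(* Let $\Omega\subset\mathbb{R}^d$ be a bounded domain and let $V$, $\mathcal V=L^2([0,1],V)$, $Y$, $K$, $\mathcal D$, $\mathcal E_1$, $\mathcal E_2$ be as in the context, satisfying assumptions (A1)--(A6) listed there. Let $T\in L^2(\Omega)$, $g\in Y$, and assume that there exists $(\hat v,\hat z)\in\mathcal V\times L^2(\Omega)$ with $K(R_{\hat v,\hat z})=g$. Further, assume that $\gamma_i\colon\mathbb{R}_{>0}\to\mathbb{R}_{>0}$, $i=1,2$, satisfy, as $\delta\to0$, $\gamma_i(\delta)\to0$ for $i=1,2$, $\delta/\gamma_1(\delta)\to0$, and $\gamma_2(\delta)/\gamma_1(\delta)\to c$ for some $c>0$. Let $\{\delta_n\}_{n\in\mathbb{N}}\subset\mathbb{R}_{>0}$ be a sequence converging to zero and $\{g_n\}_{n\in\mathbb{N}}\subset Y$ a sequence with $\mathcal D(g,g_n)\le\delta_n$ for all $n$. For each $n\in\mathbb{N}$ let $(v_n,z_n)\in\mathcal V\times L^2(\Omega)$ be a minimizer over $\mathcal V\times L^2(\Omega)$ of $$J_n(v,z)=\mathcal D\bigl(K(R_{v,z}),g_n\bigr)+\gamma_1(\delta_n)\,\mathcal E_1(v)+\gamma_2(\delta_n)\,\mathcal E_2(z).$$ Then there exists a subsequence of $\{(v_n,z_n)\}_{n\in\mathbb{N}}$ that converges weakly to a point $(v^*,z^* )$ with $K(R_{v^*,z^*})=g$.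
   Context: **Setting.** $\Omega\subset\mathbb{R}^d$ is a bounded domain and $T\in L^2(\Omega)$ is a fixed template image. For $0<\alpha\le 1$, $C_0^{1,\alpha}(\Omega,\mathbb{R}^d)$ denotes the closure of $C_c^\infty(\Omega,\mathbb{R}^d)$ with respect to the Hölder norm $\|\cdot\|_{C^{1,\alpha}}$. $V$ is an admissible vector space, meaning that it embeds continuously into $C_0^{1,\alpha}(\Omega,\mathbb{R}^d)$ for some $0<\alpha\le1$, and $\mathcal V:=L^2([0,1],V)$ is the set of admissible velocity fields. $Y$ is a Banach space. **Flow and reconstruction.** For $v\in\mathcal V$, let $\varphi_v$ be the unique global solution (it exists and lies in $C([0,1],C^1(\overline\Omega,\mathbb{R}^d))$) of $\tfrac{\mathrm d}{\mathrm dt}\varphi_v(t,x)=v(t,\varphi_v(t,x))$ for $(t,x)\in[0,1]\times\Omega$, $\varphi_v(0,x)=x$ for $x\in\Omega$. Each $\varphi_v(t,\cdot)$ is a diffeomorphism; $\varphi_v^{-1}(1,\cdot)$ denotes the inverse of $\varphi_v(1,\cdot)$ with respect to the spatial variable. For $(v,z)\in\mathcal V\times L^2(\Omega)$ define $R_{v,z}:=T\circ\varphi_v^{-1}(1,\cdot)+z\in L^2(\Omega)$. **Data.** $K\colon L^2(\Omega)\to Y$ is a (not necessarily linear) operator, $\mathcal D\colon Y\times Y\to\mathbb{R}_{\ge0}$, $\mathcal E_1\colon\mathcal V\to\mathbb{R}_{\ge0}$, $\mathcal E_2\colon L^2(\Omega)\to\mathbb{R}_{\ge0}$. **Assumptions.**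 - (A1) $K$ is continuous and weak-weak-continuous: $x_n\rightharpoonup x$ in $L^2(\Omega)$ implies $K(x_n)\rightharpoonup K(x)$ in $Y$. - (A2) $\mathcal D(\cdot,g)$ is weakly lower semicontinuous for all $g\in Y$, and $\mathcal D(f,\cdot)$ is continuous for all $f\in Y$. - (A3) If $\mathcal D(f,g)=0$, then $f=g$. - (A4) There exists $C>0$ such that $|\mathcal D(f,h)-\mathcal D(f,g)|\le C\,\mathcal D(g,h)$ for all $f,g,h\in Y$. - (A5) For fixed $g\in Y$, any bounded sequence $\{f_n\}\subset L^2(\Omega)$ and any sequence $\{z_n\}\subset L^2(\Omega)$ with $\|z_n\|_2\to\infty$, one has $\mathcal D(K(f_n+z_n),g)+\mathcal E_2(z_n)\to\infty$. Further, for $\{v_n\}\subset\mathcal V$ with $\|v_n\|_{\mathcal V}\to\infty$, one has $\mathcal E_1(v_n)\to\infty$. - (A6) $\mathcal E_1$ and $\mathcal E_2$ are weakly lower semicontinuous.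
   Formalization: The formal theorem additionally assumes that V is a reflexive Banach space; for non-reflexive V the claim fails (e.g. K=0, E_1(v)=max(0,‖v‖−1), E_2=‖·‖_2, where every v in the unit ball with z=0 is a minimizer). *)

theory Defs
  imports "HOL-Analysis.Analysis"
begin

section \<open>Lebesgue--Bochner \<open>L\<^sup>2\<close> spaces and weak convergence\<close>

text \<open>
  Elements of an \<open>L\<^sup>2\<close> space are represented by functions; functions that agree almost everywhere
  represent the same element, and \<open>L2_norm\<close> is a seminorm on representatives. Strong
  measurability is stated without any separability condition on the codomain, so that the
  definition is the Bochner one for an arbitrary Banach space.
\<close>

definition strongly_measurable :: "'x measure \<Rightarrow> ('x \<Rightarrow> 'b::real_normed_vector) \<Rightarrow> bool" where
  "strongly_measurable M f \<longleftrightarrow>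
     (\<exists>s. (\<forall>i::nat. simple_function M (s i)) \<and> (AE x in M. (\<lambda>i. s i x) \<longlonglongrightarrow> f x))"

definition L2 :: "'x measure \<Rightarrow> ('x \<Rightarrow> 'b::real_normed_vector) set" where
  "L2 M = {f. strongly_measurable M f \<and> integrable M (\<lambda>x. (norm (f x))\<^sup>2)}"

definition L2_norm :: "'x measure \<Rightarrow> ('x \<Rightarrow> 'b::real_normed_vector) \<Rightarrow> real" where
  "L2_norm M f = sqrt (\<integral>x. (norm (f x))\<^sup>2 \<partial>M)"

text \<open>A function on representatives induces a function on \<open>L\<^sup>2\<close>:\<close>

definition L2_respects :: "'x measure \<Rightarrow> (('x \<Rightarrow> 'b::real_normed_vector) \<Rightarrow> 'c) \<Rightarrow> bool" where
  "L2_respects M F \<longleftrightarrow> (\<forall>f\<in>L2 M. \<forall>g\<in>L2 M. (AE x in M. f x = g x) \<longrightarrow> F f = F g)"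

text \<open>Continuous linear functionals (boundedness forces them to respect a.e. equality).\<close>

definition L2_functional :: "'x measure \<Rightarrow> (('x \<Rightarrow> 'b::real_normed_vector) \<Rightarrow> real) \<Rightarrow> bool" where
  "L2_functional M l \<longleftrightarrow>
     (\<forall>f\<in>L2 M. \<forall>g\<in>L2 M. l (\<lambda>x. f x + g x) = l f + l g) \<and>
     (\<forall>c. \<forall>f\<in>L2 M. l (\<lambda>x. c *\<^sub>R f x) = c * l f) \<and>
     (\<exists>B. \<forall>f\<in>L2 M. \<bar>l f\<bar> \<le> B * L2_norm M f)"

definition L2_weak_lim ::
    "'x measure \<Rightarrow> (nat \<Rightarrow> 'x \<Rightarrow> 'b::real_normed_vector) \<Rightarrow> ('x \<Rightarrow> 'b) \<Rightarrow> bool" where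
  "L2_weak_lim M fs f \<longleftrightarrow>
     (\<forall>n. fs n \<in> L2 M) \<and> f \<in> L2 M \<and>
     (\<forall>l. L2_functional M l \<longrightarrow> (\<lambda>n. l (fs n)) \<longlonglongrightarrow> l f)"

definition L2_weakly_lsc ::
    "'x measure \<Rightarrow> (('x \<Rightarrow> 'b::real_normed_vector) \<Rightarrow> real) \<Rightarrow> bool" where
  "L2_weakly_lsc M E \<longleftrightarrow>
     (\<forall>fs f. L2_weak_lim M fs f \<longrightarrow> ereal (E f) \<le> liminf (\<lambda>n. ereal (E (fs n))))"

definition weak_lim :: "(nat \<Rightarrow> 'y::real_normed_vector) \<Rightarrow> 'y \<Rightarrow> bool" where
  "weak_lim ys y \<longleftrightarrow>
     (\<forall>l :: 'y \<Rightarrow>\<^sub>L real. (\<lambda>n. blinfun_apply l (ys n)) \<longlonglongrightarrow> blinfun_apply l y)"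

definition weakly_lsc :: "('y::real_normed_vector \<Rightarrow> real) \<Rightarrow> bool" where
  "weakly_lsc E \<longleftrightarrow>
     (\<forall>ys y. weak_lim ys y \<longrightarrow> ereal (E y) \<le> liminf (\<lambda>n. ereal (E (ys n))))"

text \<open>Reflexivity: the canonical embedding into the bidual is onto.\<close>

definition reflexive :: "'v::real_normed_vector itself \<Rightarrow> bool" where
  "reflexive (_ :: 'v itself) \<longleftrightarrow>
     (\<forall>\<Phi> :: ('v \<Rightarrow>\<^sub>L real) \<Rightarrow>\<^sub>L real. \<exists>x :: 'v. \<forall>l. blinfun_apply \<Phi> l = blinfun_apply l x)"

section \<open>The spaces \<open>C\<^sub>c\<^sup>\<infinity>\<close> and \<open>C\<^sub>0\<^bsup>1,\<alpha>\<^esup>\<close>\<close>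

primrec Ck :: "nat \<Rightarrow> ('a::real_normed_vector \<Rightarrow> 'b::real_normed_vector) \<Rightarrow> bool" where
  "Ck 0 f \<longleftrightarrow> continuous_on UNIV f"
| "Ck (Suc k) f \<longleftrightarrow>
     (\<forall>x. f differentiable (at x)) \<and> (\<forall>h. Ck k (\<lambda>x. frechet_derivative f (at x) h))"

text \<open>Test functions are total functions, extended by zero outside \<open>\<Omega>\<close>.\<close>

definition Cc_inf :: "'a::euclidean_space set \<Rightarrow> ('a \<Rightarrow> 'b::euclidean_space) set" where
  "Cc_inf \<Omega> =
     {f. (\<forall>k. Ck k f) \<and> compact (closure {x. f x \<noteq> 0}) \<and> closure {x. f x \<noteq> 0} \<subseteq> \<Omega>}"

text \<open>
  The \<open>C\<^bsup>1,\<alpha>\<^esup>\<close> norm with values in \<open>[0,\<infinity>]\<close>; meaningful for functions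
  that are differentiable on the open set \<open>\<Omega>\<close>, and depending only on their values there.
\<close>

definition holder_norm ::
    "real \<Rightarrow> 'a::euclidean_space set \<Rightarrow> ('a \<Rightarrow> 'b::euclidean_space) \<Rightarrow> ennreal" where
  "holder_norm \<alpha> \<Omega> f =
     (SUP x\<in>\<Omega>. ennreal (norm (f x))) +
     (SUP x\<in>\<Omega>. ennreal (onorm (frechet_derivative f (at x)))) +
     (SUP (x, y)\<in>{(x, y). x \<in> \<Omega> \<and> y \<in> \<Omega> \<and> x \<noteq> y}.
        ennreal (onorm (\<lambda>h. frechet_derivative f (at x) h - frechet_derivative f (at y) h)
                 / norm (x - y) powr \<alpha>))"

definition C0_holder ::
    "real \<Rightarrow> 'a::euclidean_space set \<Rightarrow> ('a \<Rightarrow> 'b::euclidean_space) set" where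
  "C0_holder \<alpha> \<Omega> =
     {f. (\<forall>x\<in>\<Omega>. f differentiable (at x)) \<and> holder_norm \<alpha> \<Omega> f < \<infinity> \<and>
         (\<forall>\<epsilon>>0. \<exists>g\<in>Cc_inf \<Omega>. holder_norm \<alpha> \<Omega> (\<lambda>x. f x - g x) < ennreal \<epsilon>)}"

text \<open>
  The space \<open>V\<close> is a type with an explicit embedding \<open>\<iota>\<close> into vector fields; only the
  values of \<open>\<iota> u\<close> on \<open>\<Omega>\<close> matter.
\<close>

definition admissible ::
    "'a::euclidean_space set \<Rightarrow> ('v::real_normed_vector \<Rightarrow> 'a \<Rightarrow> 'a) \<Rightarrow> bool" where
  "admissible \<Omega> \<iota> \<longleftrightarrow>
     (\<exists>\<alpha>. 0 < \<alpha> \<and> \<alpha> \<le> 1 \<and>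
        (\<forall>u. \<iota> u \<in> C0_holder \<alpha> \<Omega>) \<and>
        (\<forall>x\<in>\<Omega>. linear (\<lambda>u. \<iota> u x)) \<and>
        (\<forall>u. (\<forall>x\<in>\<Omega>. \<iota> u x = 0) \<longrightarrow> u = 0) \<and>
        (\<exists>B. \<forall>u. holder_norm \<alpha> \<Omega> (\<iota> u) \<le> ennreal (B * norm u)))"

section \<open>Flow and reconstruction\<close>

text \<open>
  As \<open>v\<close> is only square integrable in time, the initial value problem
  \<open>c' t = v t (c t)\<close>, \<open>c 0 = x\<close> is understood in the Caratheodory sense, that is, as the
  integral equation.
\<close>

definition is_trajectory ::
    "'a::euclidean_space set \<Rightarrow> ('v \<Rightarrow> 'a \<Rightarrow> 'a) \<Rightarrow> (real \<Rightarrow> 'v) \<Rightarrow> 'a \<Rightarrow> (real \<Rightarrow> 'a) \<Rightarrow> bool" where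
  "is_trajectory \<Omega> \<iota> v x c \<longleftrightarrow>
     (\<forall>t\<in>{0..1}. c t \<in> \<Omega> \<and>
        integrable (lebesgue_on {0..t}) (\<lambda>s. \<iota> (v s) (c s)) \<and>
        c t = x + (\<integral>s. \<iota> (v s) (c s) \<partial>(lebesgue_on {0..t})))"

definition flow ::
    "'a::euclidean_space set \<Rightarrow> ('v \<Rightarrow> 'a \<Rightarrow> 'a) \<Rightarrow> (real \<Rightarrow> 'v) \<Rightarrow> real \<Rightarrow> 'a \<Rightarrow> 'a" where
  "flow \<Omega> \<iota> v t x = (THE y. \<exists>c. is_trajectory \<Omega> \<iota> v x c \<and> c t = y)"

definition reconstruction ::
    "'a::euclidean_space set \<Rightarrow> ('v \<Rightarrow> 'a \<Rightarrow> 'a) \<Rightarrow> ('a \<Rightarrow> real) \<Rightarrow> (real \<Rightarrow> 'v) \<Rightarrow> ('a \<Rightarrow> real)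
      \<Rightarrow> 'a \<Rightarrow> real" where
  "reconstruction \<Omega> \<iota> T v z = (\<lambda>x. T (inv_into \<Omega> (flow \<Omega> \<iota> v 1) x) + z x)"

abbreviation velocities :: "(real \<Rightarrow> 'v::real_normed_vector) set" where
  "velocities \<equiv> L2 (lebesgue_on {0..1})"

abbreviation images :: "'a::euclidean_space set \<Rightarrow> ('a \<Rightarrow> real) set" where
  "images \<Omega> \<equiv> L2 (lebesgue_on \<Omega>)"

end

theory Submission
  imports Defs "HOL-Library.Diagonal_Subsequence"
begin

text \<open>
  Comparing the minimizers with the exact pair bounds \<open>\<E>\<^sub>1(v\<^sub>n)\<close> and \<open>\<E>\<^sub>2(z\<^sub>n)\<close> and shows, by (A4), that
  \<open>D(K(R\<^sub>n), g) \<longlonglongrightarrow> 0\<close>. Coercivity (A5) then bounds \<open>v\<^sub>n\<close>, hence the deformed templates, hence \<open>z\<^sub>n\<close>,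
  and weakly convergent subsequences exist. Weak convergence of velocities gives pointwise
  convergence of the inverse flows, which are uniformly bi-Lipschitz, so the deformed templates
  converge strongly in \<open>L\<^sup>2\<close>; weak lower semicontinuity of \<open>D(\<cdot>, g)\<close> and (A3) identify the limit.

  Weak sequential compactness of \<open>L\<^sup>2([0,1], V)\<close> for reflexive \<open>V\<close> is obtained without the
  Radon--Nikodym property: the velocities take values in a separable subspace with separable dual,
  scalar weak limits of \<open>q \<circ> v\<^sub>n\<close> for countably many functionals \<open>q\<close> define, by Hahn--Banach and
  reflexivity, a limit at almost every time, and every functional on \<open>L\<^sup>2([0,1], V)\<close> is approximated
  by finite sums of such scalar ones. The inverse of a flow is the flow of the time-reversed velocity.
\<close>

section \<open>Hahn--Banach theorem and rational spans\<close>

text \<open>Two obstacles shape the work. \<open>V\<close> need be neither separable nor Hilbert, so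
  weak limits of velocities are not Riesz representatives. Hence everything is phrased with
  countably many scalar functions: countability lets all linear relations and bounds hold together
  at almost every time, and only at such a fixed time are Hahn-Banach and reflexivity invoked. The
  limit found there is a mere pointwise choice, whose measurability has to be recovered afterwards
  by writing norms as countable suprema. Velocities are only square integrable in time and \<Omega>
  need not be convex. Fields are therefore extended by zero to the whole space, where they are
  globally Lipschitz; existence, uniqueness and stability are proved there with exponential weights
  in time, and paths that start in \<Omega> are shown never to leave it. On the variational side,
  dividing the minimality inequality by \<open>\<gamma>1\<close> bounds \<open>E1\<close> because
  \<open>\<delta> / \<gamma>1\<close> tends to 0; dividing by \<open>\<gamma>2\<close> bounds
  \<open>E2\<close> because the limit \<open>c\<close> of \<open>\<gamma>2 / \<gamma>1\<close> is
  positive.\<close>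

lemma hahn_banach_step:
  fixes G :: "('v::real_normed_vector \<times> real) set"
  assumes G: "subspace G" and le: "\<And>x a. (x, a) \<in> G \<Longrightarrow> a \<le> B * norm x" and B: "0 \<le> B"
  shows "\<exists>\<alpha>. \<forall>x a c. (x, a) \<in> G \<longrightarrow> a + c * \<alpha> \<le> B * norm (x + c *\<^sub>R x0)"
proof -
  define A where "A = (\<lambda>(y, b). b - B * norm (y - x0)) ` G"
  \<comment> \<open>The value at \<open>x0\<close> must lie above every
    \<open>b - B * norm (y - x0)\<close> and below every \<open>B * norm (y + x0) - b\<close>; the
    triangle inequality makes the two families compatible.\<close>
  have key: "b' - B * norm (y' - x0) \<le> B * norm (y + x0) - b" if "(y, b) \<in> G" "(y', b') \<in> G" for y b y' b'
  proof -
    have "(y' + y, b' + b) \<in> G" using subspace_add[OF G that(2,1)] by simp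
    then have "b' + b \<le> B * norm (y' + y)" by (rule le)
    also have "\<dots> \<le> B * (norm (y' - x0) + norm (y + x0))"
      using norm_triangle_ineq[of "y' - x0" "y + x0"] B by (intro mult_left_mono) auto
    finally show ?thesis by (simp add: algebra_simps)
  qed
  have 0: "(0, 0) \<in> G" using subspace_0[OF G] by (simp add: zero_prod_def)
  have ne: "A \<noteq> {}" using 0 by (auto simp: A_def)
  have bdd: "bdd_above A" using key[OF 0] by (auto simp: A_def intro!: bdd_aboveI[of _ "B * norm x0"])
  define \<alpha> where "\<alpha> = Sup A"
  have lo: "b - B * norm (y - x0) \<le> \<alpha>" if "(y, b) \<in> G" for y b
    unfolding \<alpha>_def using that by (intro cSup_upper bdd) (force simp: A_def)
  have hi: "\<alpha> \<le> B * norm (y + x0) - b" if "(y, b) \<in> G" for y b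
    unfolding \<alpha>_def using key[OF that] by (intro cSup_least ne) (auto simp: A_def)
  have sc: "(k *\<^sub>R y, k * b) \<in> G" if "(y, b) \<in> G" for k y b
    using subspace_scale[OF G that, of k] by simp
  \<comment> \<open>Scaling reduces a nonzero \<open>c\<close> to 1 or -1, and these two cases are
    the upper and the lower family.\<close>
  have "a + c * \<alpha> \<le> B * norm (x + c *\<^sub>R x0)" if xa: "(x, a) \<in> G" for x a c
  proof (cases "c = 0")
    case True then show ?thesis using le[OF xa] by simp
  next
    case False
    then consider "c > 0" | "c < 0" by linarith
    then show ?thesis
    proof cases
      case 1
      have "\<alpha> \<le> B * norm (inverse c *\<^sub>R x + x0) - inverse c * a" by (rule hi[OF sc[OF xa]])
      then have "c * \<alpha> \<le> c * (B * norm (inverse c *\<^sub>R x + x0) - inverse c * a)"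
        using 1 by (intro mult_left_mono) auto
      also have "\<dots> = B * norm (c *\<^sub>R (inverse c *\<^sub>R x + x0)) - a"
        using 1 by (simp add: right_diff_distrib)
      also have "c *\<^sub>R (inverse c *\<^sub>R x + x0) = x + c *\<^sub>R x0" using 1 by (simp add: scaleR_add_right)
      finally show ?thesis by simp
    next
      case 2
      define d where "d = - c"
      have d: "d > 0" "c = - d" using 2 by (auto simp: d_def)
      have "inverse d * a - B * norm (inverse d *\<^sub>R x - x0) \<le> \<alpha>" by (rule lo[OF sc[OF xa]])
      then have "d * (inverse d * a - B * norm (inverse d *\<^sub>R x - x0)) \<le> d * \<alpha>"
        using d by (intro mult_left_mono) auto
      moreover have "d * (inverse d * a - B * norm (inverse d *\<^sub>R x - x0))
          = a - B * norm (d *\<^sub>R (inverse d *\<^sub>R x - x0))"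
        using d by (simp add: right_diff_distrib)
      moreover have "d *\<^sub>R (inverse d *\<^sub>R x - x0) = x + c *\<^sub>R x0" using d by (simp add: scaleR_diff_right)
      ultimately show ?thesis using d by simp
    qed
  qed
  then show ?thesis by blast
qed

text \<open>
  Linear functionals are represented by their graphs, so that the extension order is inclusion
  of subspaces of \<open>'v \<times> real\<close>.
\<close>

theorem hahn_banach:
  fixes G :: "('v::real_normed_vector \<times> real) set"
  assumes G: "subspace G" and le: "\<And>x a. (x, a) \<in> G \<Longrightarrow> a \<le> B * norm x" and B: "0 \<le> B"
  obtains F :: "'v \<Rightarrow>\<^sub>L real" where "norm F \<le> B" "\<And>x a. (x, a) \<in> G \<Longrightarrow> blinfun_apply F x = a"
proof -
  define A where "A = {H. subspace H \<and> (\<forall>x a. (x, a) \<in> H \<longrightarrow> a \<le> B * norm x) \<and> G \<subseteq> H}"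
  have "\<exists>M\<in>A. \<forall>X\<in>A. M \<subseteq> X \<longrightarrow> X = M"
  proof (rule subset_Zorn_nonempty)
    show "A \<noteq> {}" using G le by (auto simp: A_def)
  next
    fix C assume C: "C \<noteq> {}" "subset.chain A C"
    then have CA: "C \<subseteq> A" and ch: "\<And>X Y. X \<in> C \<Longrightarrow> Y \<in> C \<Longrightarrow> X \<subseteq> Y \<or> Y \<subseteq> X"
      by (auto simp: subset.chain_def)
    have "subspace (\<Union>C)"
    proof (rule subspaceI)
      obtain X where "X \<in> C" using C(1) by blast
      then show "0 \<in> \<Union>C" using CA subspace_0[of X] by (auto simp: A_def)
      show "x + y \<in> \<Union>C" if xy: "x \<in> \<Union>C" "y \<in> \<Union>C" for x y
      proof -
        from xy obtain X Y where XY: "X \<in> C" "x \<in> X" "Y \<in> C" "y \<in> Y" by blast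
        then obtain Z where Z: "Z \<in> C" "x \<in> Z" "y \<in> Z" using ch[of X Y] by blast
        then show ?thesis using CA by (auto simp: A_def intro: subspace_add)
      qed
      show "c *\<^sub>R x \<in> \<Union>C" if "x \<in> \<Union>C" for c x
        using that CA by (auto simp: A_def intro: subspace_scale)
    qed
    moreover obtain X where "X \<in> C" using C(1) by blast
    then have "G \<subseteq> X" "X \<subseteq> \<Union>C" using CA by (auto simp: A_def)
    then have "G \<subseteq> \<Union>C" by (rule subset_trans)
    ultimately show "\<Union>C \<in> A" using CA by (auto simp: A_def)
  qed
  then obtain M where M: "M \<in> A" and max: "\<And>X. X \<in> A \<Longrightarrow> M \<subseteq> X \<Longrightarrow> X = M" by blast
  have sM: "subspace M" and leM: "\<And>x a. (x, a) \<in> M \<Longrightarrow> a \<le> B * norm x" and GM: "G \<subseteq> M"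
    using M by (auto simp: A_def)
  have tot: "\<exists>a. (x0, a) \<in> M" for x0
  proof -
    obtain \<alpha> where \<alpha>: "\<And>x a c. (x, a) \<in> M \<Longrightarrow> a + c * \<alpha> \<le> B * norm (x + c *\<^sub>R x0)"
      using hahn_banach_step[OF sM leM B] by blast
    \<comment> \<open>Adjoining the line through \<open>(x0, \<alpha>)\<close> cannot enlarge a
      maximal graph, so \<open>x0\<close> already lies in its domain.\<close>
    define N where "N = {y + c *\<^sub>R (x0, \<alpha>) | y c. y \<in> M}"
    have "N = {x + y |x y. x \<in> M \<and> y \<in> span {(x0, \<alpha>)}}"
      unfolding N_def span_singleton by blast
    then have "subspace N" using subspace_sums[OF sM, of "span {(x0, \<alpha>)}"] by simp
    moreover have "a \<le> B * norm x" if "(x, a) \<in> N" for x a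
      using that \<alpha> by (auto simp: N_def)
    moreover have MN: "M \<subseteq> N"
    proof
      fix z assume "z \<in> M"
      moreover have "z = z + 0 *\<^sub>R (x0, \<alpha>)" by (cases z) simp
      ultimately show "z \<in> N" unfolding N_def by blast
    qed
    ultimately have "N \<in> A" using GM by (auto simp: A_def)
    then have "N = M" using max MN by blast
    moreover have "(x0, \<alpha>) = 0 + 1 *\<^sub>R (x0, \<alpha>)" by simp
    then have "(x0, \<alpha>) \<in> N" using subspace_0[OF sM] unfolding N_def by blast
    ultimately show ?thesis by auto
  qed
  \<comment> \<open>The bound at the zero vector rules out vertical directions, so the maximal
    subspace is the graph of a function.\<close>
  have uniq: "a = b" if "(x, a) \<in> M" "(x, b) \<in> M" for x a b
  proof -
    have "(0, a - b) \<in> M" "(0, b - a) \<in> M"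
      using subspace_diff[OF sM that] subspace_diff[OF sM that(2,1)] by simp_all
    from this[THEN leM] show ?thesis by simp
  qed
  define F where "F x = (SOME a. (x, a) \<in> M)" for x
  have F: "(x, F x) \<in> M" for x unfolding F_def using someI_ex[OF tot] .
  have F_eq: "F x = a" if "(x, a) \<in> M" for x a using uniq[OF F that] .
  have Fb: "\<bar>F x\<bar> \<le> B * norm x" for x
    using leM[OF F, of x] leM[of "- x" "- F x"] subspace_neg[OF sM F, of x] by simp
  have bl: "bounded_linear F"
  proof (rule bounded_linear_intro)
    show "F (x + y) = F x + F y" for x y
      using subspace_add[OF sM F F, of x y] by (intro F_eq) simp
    show "F (r *\<^sub>R x) = r *\<^sub>R F x" for r x
      using subspace_scale[OF sM F, of r x] by (intro F_eq) simp
    show "norm (F x) \<le> norm x * B" for x using Fb[of x] by (simp add: mult.commute)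
  qed
  show ?thesis
  proof
    show "norm (Blinfun F) \<le> B"
      using Fb by (intro norm_blinfun_bound B) (simp add: bounded_linear_Blinfun_apply[OF bl])
    show "blinfun_apply (Blinfun F) x = a" if "(x, a) \<in> G" for x a
      using F_eq that GM by (auto simp: bounded_linear_Blinfun_apply[OF bl])
  qed
qed

lemma norming_functional:
  fixes u :: "'v::real_normed_vector"
  obtains F :: "'v \<Rightarrow>\<^sub>L real" where "norm F \<le> 1" "blinfun_apply F u = norm u"
proof -
  have "a \<le> 1 * norm x" if "(x, a) \<in> span {(u, norm u)}" for x a
    using that by (auto simp: span_singleton intro!: mult_right_mono)
  then obtain F :: "'v \<Rightarrow>\<^sub>L real" where "norm F \<le> 1"
    "\<And>x a. (x, a) \<in> span {(u, norm u)} \<Longrightarrow> blinfun_apply F x = a"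
    using hahn_banach[OF subspace_span, of "{(u, norm u)}" 1] by auto
  then show ?thesis using that by (meson insertI1 span_base)
qed

text \<open>On \<open>N\<close> plus the line through \<open>x\<close>, send y + c x to c d, where d
  is the distance from \<open>x\<close> to \<open>N\<close>. Since |c| d is at most the norm of y +
  c x, Hahn-Banach applies with bound 1.\<close>

lemma separating_functional:
  fixes x :: "'v::real_normed_vector"
  assumes N: "subspace N" "closed N" and x: "x \<notin> N"
  obtains F :: "'v \<Rightarrow>\<^sub>L real" where "\<And>y. y \<in> N \<Longrightarrow> blinfun_apply F y = 0" "blinfun_apply F x \<noteq> 0"
proof -
  have ne: "N \<noteq> {}" using subspace_0[OF N(1)] by auto
  define d where "d = infdist x N"
  have d: "d > 0"
    using x infdist_pos_not_in_closed[OF N(2) ne x] by (simp add: d_def)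
  define G where "G = {y + z | y z. y \<in> N \<times> {0::real} \<and> z \<in> span {(x, d)}}"
  have G: "subspace G" unfolding G_def
    by (intro subspace_sums subspace_span subspace_Times N) simp
  have le: "a \<le> 1 * norm w" if "(w, a) \<in> G" for w a
  proof -
    obtain y c where y: "y \<in> N" "w = y + c *\<^sub>R x" "a = c * d"
      using \<open>(w, a) \<in> G\<close> by (auto simp: G_def span_singleton)
    show ?thesis
    proof (cases "c = 0")
      case True then show ?thesis using y by simp
    next
      case False
      have "- inverse c *\<^sub>R y \<in> N" using subspace_scale[OF N(1) y(1)] .
      then have "d \<le> dist x (- inverse c *\<^sub>R y)" unfolding d_def by (rule infdist_le)
      then have "\<bar>c\<bar> * d \<le> \<bar>c\<bar> * norm (x - (- inverse c *\<^sub>R y))"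
        by (intro mult_left_mono) (auto simp: dist_norm)
      also have "\<dots> = norm (c *\<^sub>R (x - (- inverse c *\<^sub>R y)))" by simp
      also have "c *\<^sub>R (x - (- inverse c *\<^sub>R y)) = w" using False y by (simp add: algebra_simps)
      finally have "\<bar>c\<bar> * d \<le> norm w" .
      moreover have "c * d \<le> \<bar>c\<bar> * d" using d by (intro mult_right_mono) auto
      ultimately show ?thesis using y by simp
    qed
  qed
  obtain F :: "'v \<Rightarrow>\<^sub>L real" where F: "\<And>x a. (x, a) \<in> G \<Longrightarrow> blinfun_apply F x = a"
    using hahn_banach[OF G le] by (metis zero_le_one)
  show ?thesis
  proof
    show "blinfun_apply F y = 0" if "y \<in> N" for y
    proof (rule F)
      have "(y, 0::real) = (y, 0) + 0 \<and> (y, 0::real) \<in> N \<times> {0} \<and> 0 \<in> span {(x, d)}" using that span_zero[of "{(x, d)}"] by (simp add: zero_prod_def)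
      then show "(y, 0) \<in> G" unfolding G_def by blast
    qed
    have "(x, d) = 0 + (x, d) \<and> 0 \<in> N \<times> {0::real} \<and> (x, d) \<in> span {(x, d)}"
      using subspace_0[OF N(1)] by (auto simp: zero_prod_def span_base)
    then have "(x, d) \<in> G" unfolding G_def
      by (intro CollectI exI[of _ "0 :: 'v \<times> real"] exI[of _ "(x, d)"])
    then show "blinfun_apply F x \<noteq> 0" using F d by force
  qed
qed

text \<open>Rational scalars keep such sets countable when needed, so that relations known almost
  everywhere one at a time hold simultaneously almost everywhere; taking the closure restores real
  scalars.\<close>

definition rational_subspace :: "'v::real_vector set \<Rightarrow> bool" where
  "rational_subspace Q \<longleftrightarrow> 0 \<in> Q \<and> (\<forall>x\<in>Q. \<forall>y\<in>Q. x + y \<in> Q) \<and> (\<forall>r\<in>\<rat>. \<forall>x\<in>Q. r *\<^sub>R x \<in> Q)"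

lemma rational_subspaceD:
  assumes "rational_subspace Q"
  shows "0 \<in> Q" "x \<in> Q \<Longrightarrow> y \<in> Q \<Longrightarrow> x + y \<in> Q" "r \<in> \<rat> \<Longrightarrow> x \<in> Q \<Longrightarrow> r *\<^sub>R x \<in> Q"
    "x \<in> Q \<Longrightarrow> y \<in> Q \<Longrightarrow> x - y \<in> Q"
proof -
  show 1: "0 \<in> Q" "x \<in> Q \<Longrightarrow> y \<in> Q \<Longrightarrow> x + y \<in> Q" "r \<in> \<rat> \<Longrightarrow> x \<in> Q \<Longrightarrow> r *\<^sub>R x \<in> Q" for x y r
    using assms by (auto simp: rational_subspace_def)
  show "x \<in> Q \<Longrightarrow> y \<in> Q \<Longrightarrow> x - y \<in> Q" using 1(2)[of x "(-1) *\<^sub>R y"] 1(3)[of "-1" y] by simp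
qed

lemma subspace_closure_rational_subspace:
  fixes Q :: "'v::real_normed_vector set"
  assumes "rational_subspace Q"
  shows "subspace (closure Q)"
proof (rule subspaceI)
  note Q = rational_subspaceD[OF assms]
  show "0 \<in> closure Q" using Q(1) closure_subset by blast
  show "x + y \<in> closure Q" if "x \<in> closure Q" "y \<in> closure Q" for x y
  proof -
    obtain f g where fg: "\<forall>n::nat. f n \<in> Q" "f \<longlonglongrightarrow> x" "\<forall>n::nat. g n \<in> Q" "g \<longlonglongrightarrow> y"
      using \<open>x \<in> closure Q\<close> \<open>y \<in> closure Q\<close> by (auto simp: closure_sequential)
    then have "(\<forall>n. f n + g n \<in> Q) \<and> (\<lambda>n. f n + g n) \<longlonglongrightarrow> x + y" using Q(2) by (auto intro: tendsto_add)
    then show ?thesis unfolding closure_sequential by (rule exI[of _ "\<lambda>n. f n + g n"])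
  qed
  show "c *\<^sub>R x \<in> closure Q" if "x \<in> closure Q" for c x
  proof -
    obtain f where f: "\<forall>n::nat. f n \<in> Q" "f \<longlonglongrightarrow> x"
      using \<open>x \<in> closure Q\<close> by (auto simp: closure_sequential)
    have "\<exists>r\<in>\<rat>. c < r \<and> r < c + inverse (real (Suc n))" for n
      by (intro Rats_dense_in_real) simp
    then obtain r where r: "\<And>n. r n \<in> \<rat>" "\<And>n. c < r n \<and> r n < c + inverse (real (Suc n))" by metis
    have "r \<longlonglongrightarrow> c"
    proof (rule real_tendsto_sandwich)
      show "(\<lambda>n. c) \<longlonglongrightarrow> c" by simp
      show "(\<lambda>n. c + inverse (real (Suc n))) \<longlonglongrightarrow> c" using tendsto_add[OF tendsto_const LIMSEQ_inverse_real_of_nat, of c] by simp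
    qed (use r(2) in \<open>auto intro!: always_eventually less_imp_le\<close>)
    then have "(\<forall>n. r n *\<^sub>R f n \<in> Q) \<and> (\<lambda>n. r n *\<^sub>R f n) \<longlonglongrightarrow> c *\<^sub>R x" using Q(3) f r by (auto intro: tendsto_scaleR)
    then show ?thesis unfolding closure_sequential by (rule exI[of _ "\<lambda>n. r n *\<^sub>R f n"])
  qed
qed

lemma rational_subspace_plus:
  assumes F: "rational_subspace F" and N: "rational_subspace N"
  shows "rational_subspace ((\<lambda>(q, f). q + f) ` (F \<times> N))" (is "rational_subspace ?G")
  unfolding rational_subspace_def
proof (intro conjI ballI)
  have GI: "q + f \<in> ?G" if "q \<in> F" "f \<in> N" for q f using that by auto
  show "0 \<in> ?G" using GI[OF rational_subspaceD(1)[OF F] rational_subspaceD(1)[OF N]] by simp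
  show "x + y \<in> ?G" if xy: "x \<in> ?G" "y \<in> ?G" for x y
  proof -
    obtain q f q' f' where x: "x = q + f" "q \<in> F" "f \<in> N" and y: "y = q' + f'" "q' \<in> F" "f' \<in> N"
      using xy by auto
    show ?thesis using GI[OF rational_subspaceD(2)[OF F x(2) y(2)] rational_subspaceD(2)[OF N x(3) y(3)]] x y
      by (simp add: algebra_simps)
  qed
  show "r *\<^sub>R x \<in> ?G" if r: "r \<in> \<rat>" "x \<in> ?G" for r x
  proof -
    obtain q f where x: "x = q + f" "q \<in> F" "f \<in> N" using r(2) by auto
    show ?thesis using GI[OF rational_subspaceD(3)[OF F r(1) x(2)] rational_subspaceD(3)[OF N r(1) x(3)]] x
      by (simp add: scaleR_add_right)
  qed
qed

lemma rational_subspace_graph: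
  assumes F: "rational_subspace F"
    and add: "\<And>f g. f \<in> F \<Longrightarrow> g \<in> F \<Longrightarrow> h (f + g) = h f + h g"
    and scale: "\<And>f r. f \<in> F \<Longrightarrow> r \<in> \<rat> \<Longrightarrow> h (r *\<^sub>R f) = r *\<^sub>R h f"
  shows "rational_subspace ((\<lambda>f. (f, h f)) ` F)"
  unfolding rational_subspace_def
proof (intro conjI ballI)
  have "h 0 = 0" using scale[OF rational_subspaceD(1)[OF F], of 0] by simp
  then show "0 \<in> (\<lambda>f. (f, h f)) ` F" using rational_subspaceD(1)[OF F] by (force simp: zero_prod_def)
  show "x + y \<in> (\<lambda>f. (f, h f)) ` F" if "x \<in> (\<lambda>f. (f, h f)) ` F" "y \<in> (\<lambda>f. (f, h f)) ` F" for x y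
    using that rational_subspaceD(2)[OF F] by (auto simp: add[symmetric])
  show "r *\<^sub>R x \<in> (\<lambda>f. (f, h f)) ` F" if "r \<in> \<rat>" "x \<in> (\<lambda>f. (f, h f)) ` F" for r x
    using that rational_subspaceD(3)[OF F] by (auto simp: scale[symmetric])
qed

text \<open>Domination by \<open>B * norm x\<close> is a closed condition on graphs, so it survives
  the passage to \<open>closure G\<close>, which is a real subspace.\<close>

lemma hahn_banach_rational:
  fixes G :: "('v::real_normed_vector \<times> real) set"
  assumes G: "rational_subspace G" and le: "\<And>x a. (x, a) \<in> G \<Longrightarrow> a \<le> B * norm x" and B: "0 \<le> B"
  shows "\<exists>F :: 'v \<Rightarrow>\<^sub>L real. norm F \<le> B \<and> (\<forall>x a. (x, a) \<in> G \<longrightarrow> blinfun_apply F x = a)"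
proof -
  have "closed {z :: 'v \<times> real. snd z \<le> B * norm (fst z)}"
    by (intro closed_Collect_le continuous_intros)
  then have "closure G \<subseteq> {z. snd z \<le> B * norm (fst z)}" using le by (intro closure_minimal) auto
  then have "a \<le> B * norm x" if "(x, a) \<in> closure G" for x a using that by auto
  from hahn_banach[OF subspace_closure_rational_subspace[OF G] this B]
  obtain F :: "'v \<Rightarrow>\<^sub>L real" where "norm F \<le> B" "\<And>x a. (x, a) \<in> closure G \<Longrightarrow> blinfun_apply F x = a" by metis
  then show ?thesis using closure_subset[of G] by (intro exI[of _ F]) auto
qed

lemma countable_rational_span:
  fixes U :: "'v::real_vector set"
  assumes "countable U"
  obtains Q where "countable Q" "U \<subseteq> Q" "rational_subspace Q"
proof
  define g :: "(real \<times> 'v) list \<Rightarrow> 'v" where "g l = sum_list (map (\<lambda>(q, u). q *\<^sub>R u) l)" for l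
  define Q where "Q = g ` lists (\<rat> \<times> U)"
  show "countable Q" unfolding Q_def using assms countable_rat by (intro countable_image countable_lists countable_SIGMA) auto
  show "U \<subseteq> Q"
  proof
    fix u assume "u \<in> U"
    then have "[(1, u)] \<in> lists (\<rat> \<times> U)" by simp
    moreover have "u = g [(1, u)]" by (simp add: g_def)
    ultimately show "u \<in> Q" unfolding Q_def by blast
  qed
  show "rational_subspace Q" unfolding rational_subspace_def
  proof (intro conjI ballI)
    show "0 \<in> Q" unfolding Q_def by (rule image_eqI[of _ _ "[]"]) (auto simp: g_def)
    show "x + y \<in> Q" if xy: "x \<in> Q" "y \<in> Q" for x y
    proof -
      obtain k l where kl: "x = g k" "k \<in> lists (\<rat> \<times> U)" "y = g l" "l \<in> lists (\<rat> \<times> U)"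
        using xy by (auto simp: Q_def)
      then have "x + y = g (k @ l)" by (simp add: g_def)
      then show ?thesis using kl unfolding Q_def by auto
    qed
    show "r *\<^sub>R x \<in> Q" if rx: "r \<in> \<rat>" "x \<in> Q" for r x
    proof -
      obtain k where k: "x = g k" "k \<in> lists (\<rat> \<times> U)" using rx by (auto simp: Q_def)
      have "r *\<^sub>R g k = g (map (\<lambda>(q, u). (r * q, u)) k)"
        by (induction k) (auto simp: g_def scaleR_add_right)
      moreover have "map (\<lambda>(q, u). (r * q, u)) k \<in> lists (\<rat> \<times> U)"
        using k(2) rx(1) by (induction k) auto
      ultimately show ?thesis using k unfolding Q_def by auto
    qed
  qed
qed

section \<open>Bochner square-integrable functions\<close>

text \<open>Completeness makes functions measurable that are specified only almost everywhere, such
  as limits and pointwise choices; finiteness puts constants into L2 and L2 into L1.\<close>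

locale complete_finite_measure = complete_measure M + finite_measure M for M :: "'x measure"

lemma complete_finite_measure_lebesgue_on:
  assumes "S \<in> lmeasurable"
  shows "complete_finite_measure (lebesgue_on S)"
proof -
  have S: "S \<in> sets lebesgue" using assms by (simp add: fmeasurableD)
  interpret finite_measure "lebesgue_on S" by (rule finite_measure_lebesgue_on[OF assms])
  have "complete_measure (lebesgue_on S)"
  proof
    fix A B :: "'a set" assume AB: "B \<subseteq> A" "A \<in> null_sets (lebesgue_on S)"
    then have "A \<in> null_sets lebesgue" "A \<subseteq> S" using S by (auto simp: null_sets_restrict_space)
    then have "B \<in> sets lebesgue" using AB(1) completion.complete by blast
    then show "B \<in> sets (lebesgue_on S)" using AB \<open>A \<subseteq> S\<close> S by (auto simp: sets_restrict_space_iff)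
  qed
  then show ?thesis by (intro complete_finite_measure.intro finite_measure_axioms)
qed

lemma (in complete_measure) measurable_AE_cong:
  assumes f: "f \<in> measurable M N" and g: "g \<in> space M \<rightarrow> space N" and ae: "AE x in M. f x = g x"
  shows "g \<in> measurable M N"
proof (rule measurableI)
  fix A assume A: "A \<in> sets N"
  have "AE x in M. x \<in> f -` A \<inter> space M \<longleftrightarrow> x \<in> g -` A \<inter> space M"
    using ae by eventually_elim auto
  then show "g -` A \<inter> space M \<in> sets M"
    using measurable_sets[OF f A] by (rule in_sets_AE) auto
qed (use g in auto)

lemma (in complete_measure) borel_measurable_AE_LIMSEQ:
  fixes f :: "'a \<Rightarrow> 'b::{banach, second_countable_topology}"
  assumes s: "\<And>i. s i \<in> borel_measurable M" and ae: "AE x in M. (\<lambda>i. s i x) \<longlonglongrightarrow> f x"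
  shows "f \<in> borel_measurable M"
proof (rule measurable_AE_cong)
  show "(\<lambda>x. lim (\<lambda>i. s i x)) \<in> borel_measurable M" using s by measurable
  show "AE x in M. lim (\<lambda>i. s i x) = f x" using ae by eventually_elim (rule limI)
qed auto

text \<open>Approximating simple functions can be combined pointwise. Unary operations are covered
  by passing the same function twice.\<close>

lemma strongly_measurable_compose:
  assumes f: "strongly_measurable M f" and g: "strongly_measurable M g"
    and h: "\<And>a b x y. a \<longlonglongrightarrow> x \<Longrightarrow> b \<longlonglongrightarrow> y \<Longrightarrow> (\<lambda>i. h (a i) (b i)) \<longlonglongrightarrow> h x y"
  shows "strongly_measurable M (\<lambda>x. h (f x) (g x))"
proof -
  obtain s t where s: "\<And>i::nat. simple_function M (s i)" "AE x in M. (\<lambda>i. s i x) \<longlonglongrightarrow> f x"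
    and t: "\<And>i::nat. simple_function M (t i)" "AE x in M. (\<lambda>i. t i x) \<longlonglongrightarrow> g x"
    using f g by (auto simp: strongly_measurable_def)
  have "AE x in M. (\<lambda>i. h (s i x) (t i x)) \<longlonglongrightarrow> h (f x) (g x)"
    using eventually_conj[OF s(2) t(2)] by (rule eventually_mono) (use h in blast)
  moreover have "simple_function M (\<lambda>x. h (s i x) (t i x))" for i by (rule simple_function_compose2[OF s(1) t(1)])
  ultimately show ?thesis unfolding strongly_measurable_def
    by (intro exI[of _ "\<lambda>i x. h (s i x) (t i x)"] conjI allI)
qed

lemma strongly_measurable_simple: "simple_function M f \<Longrightarrow> strongly_measurable M f"
  unfolding strongly_measurable_def by (intro exI[of _ "\<lambda>i. f"]) auto

lemma strongly_measurable_AE_cong: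
  assumes "strongly_measurable M f" "AE x in M. f x = g x"
  shows "strongly_measurable M g"
proof -
  obtain s where s: "\<And>i::nat. simple_function M (s i)" "AE x in M. (\<lambda>i. s i x) \<longlonglongrightarrow> f x"
    using assms by (auto simp: strongly_measurable_def)
  have "AE x in M. (\<lambda>i. s i x) \<longlonglongrightarrow> g x" using s(2) assms(2) by eventually_elim simp
  then show ?thesis using s(1) by (auto simp: strongly_measurable_def)
qed

lemma strongly_measurable_borel:
  fixes f :: "'x \<Rightarrow> 'b::{real_normed_vector, second_countable_topology}"
  assumes "f \<in> borel_measurable M"
  shows "strongly_measurable M f"
  using borel_measurable_implies_sequence_metric[OF assms, of 0]
  by (auto simp: strongly_measurable_def intro!: AE_I2)

lemma (in complete_measure) strongly_measurable_iff_borel: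
  fixes f :: "'a \<Rightarrow> 'b::{banach, second_countable_topology}"
  shows "strongly_measurable M f \<longleftrightarrow> f \<in> borel_measurable M"
proof
  assume "strongly_measurable M f"
  then show "f \<in> borel_measurable M"
    unfolding strongly_measurable_def
    by (auto intro: borel_measurable_AE_LIMSEQ borel_measurable_simple_function)
qed (rule strongly_measurable_borel)

lemma (in complete_measure) borel_measurable_norm_strongly:
  assumes "strongly_measurable M f"
  shows "(\<lambda>x. norm (f x)) \<in> borel_measurable M"
  using strongly_measurable_compose[OF assms assms, of "\<lambda>a b. norm a"]
  by (simp add: strongly_measurable_iff_borel tendsto_norm)

context complete_finite_measure
begin

lemma L2_real_iff:
  fixes f :: "'x \<Rightarrow> real"
  shows "f \<in> L2 M \<longleftrightarrow> f \<in> borel_measurable M \<and> integrable M (\<lambda>x. (f x)\<^sup>2)"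
  by (simp add: L2_def strongly_measurable_iff_borel)

lemma L2D:
  assumes "f \<in> L2 M"
  shows "strongly_measurable M f" "integrable M (\<lambda>x. (norm (f x))\<^sup>2)"
    "(\<lambda>x. norm (f x)) \<in> borel_measurable M" "(\<lambda>x. norm (f x)) \<in> L2 M"
  using assms borel_measurable_norm_strongly by (auto simp: L2_def strongly_measurable_iff_borel)

lemma L2_norm_nonneg [simp]: "0 \<le> L2_norm M f"
  by (simp add: L2_norm_def integral_nonneg_AE)

lemma L2_norm_sq: "(L2_norm M f)\<^sup>2 = (\<integral>x. (norm (f x))\<^sup>2 \<partial>M)"
  by (simp add: L2_norm_def integral_nonneg_AE)

lemma L2_norm_norm [simp]: "L2_norm M (\<lambda>x. norm (f x)) = L2_norm M f"
  by (simp add: L2_norm_def)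

lemma L2_dominated:
  assumes f: "strongly_measurable M f" and g: "g \<in> L2 M" and le: "AE x in M. norm (f x) \<le> norm (g x)"
  shows "f \<in> L2 M" "L2_norm M f \<le> L2_norm M g"
proof -
  have ae: "AE x in M. (norm (f x))\<^sup>2 \<le> (norm (g x))\<^sup>2" using le by eventually_elim (simp add: power_mono)
  have [measurable]: "(\<lambda>x. norm (f x)) \<in> borel_measurable M" by (rule borel_measurable_norm_strongly[OF f])
  have int: "integrable M (\<lambda>x. (norm (f x))\<^sup>2)"
    by (rule Bochner_Integration.integrable_bound[OF L2D(2)[OF g]]) (use ae in auto)
  then show "f \<in> L2 M" using f by (simp add: L2_def)
  show "L2_norm M f \<le> L2_norm M g" unfolding L2_norm_def
    by (intro real_sqrt_le_mono integral_mono_AE int L2D(2)[OF g] ae)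
qed

lemma L2_AE_cong:
  assumes "f \<in> L2 M" "AE x in M. f x = g x"
  shows "g \<in> L2 M" "L2_norm M f = L2_norm M g"
proof -
  have g: "strongly_measurable M g" using strongly_measurable_AE_cong[OF L2D(1)] assms by blast
  have "AE x in M. norm (g x) \<le> norm (f x)" using assms(2) by eventually_elim simp
  from L2_dominated[OF g assms(1) this] have 1: "g \<in> L2 M" "L2_norm M g \<le> L2_norm M f" by auto
  have "AE x in M. norm (f x) \<le> norm (g x)" using assms(2) by eventually_elim simp
  from L2_dominated[OF L2D(1)[OF assms(1)] 1(1) this] show "L2_norm M f = L2_norm M g" using 1 by simp
  show "g \<in> L2 M" by (rule 1)
qed

lemma L2_mult_integrable:
  fixes f g :: "'x \<Rightarrow> real"
  assumes f: "f \<in> L2 M" and g: "g \<in> L2 M"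
  shows "integrable M (\<lambda>x. f x * g x)"
proof (rule Bochner_Integration.integrable_bound)
  show "integrable M (\<lambda>x. (f x)\<^sup>2 + (g x)\<^sup>2)" using f g by (auto simp: L2_real_iff)
  show "(\<lambda>x. f x * g x) \<in> borel_measurable M" using f g by (auto simp: L2_real_iff)
  have "\<bar>a * b\<bar> \<le> a\<^sup>2 + b\<^sup>2" for a b :: real
  proof -
    have "2 * (\<bar>a\<bar> * \<bar>b\<bar>) \<le> a\<^sup>2 + b\<^sup>2" using sum_squares_bound[of "\<bar>a\<bar>" "\<bar>b\<bar>"] by (simp add: mult.assoc)
    moreover have "0 \<le> \<bar>a\<bar> * \<bar>b\<bar>" by simp
    ultimately show ?thesis unfolding abs_mult by linarith
  qed
  then show "AE x in M. norm (f x * g x) \<le> norm ((f x)\<^sup>2 + (g x)\<^sup>2)" by (auto intro!: AE_I2)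
qed

lemma Cauchy_Schwarz_L2:
  fixes f g :: "'x \<Rightarrow> real"
  assumes f: "f \<in> L2 M" and g: "g \<in> L2 M"
  shows "\<bar>\<integral>x. f x * g x \<partial>M\<bar> \<le> L2_norm M f * L2_norm M g"
proof -
  define a b c where "a = (\<integral>x. (f x)\<^sup>2 \<partial>M)" "b = (\<integral>x. f x * g x \<partial>M)" "c = (\<integral>x. (g x)\<^sup>2 \<partial>M)"
  \<comment> \<open>The squared norm of f + t g as a quadratic in t: for positive \<open>c\<close>
    its value at \<open>- b / c\<close> gives the inequality, and for \<open>c = 0\<close> it is
    affine, which forces \<open>b = 0\<close>.\<close>
  have q: "0 \<le> a + 2 * t * b + t\<^sup>2 * c" for t
  proof -
    have "0 \<le> (\<integral>x. (f x + t * g x)\<^sup>2 \<partial>M)" by (intro integral_nonneg_AE) auto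
    also have "\<dots> = (\<integral>x. (f x)\<^sup>2 + (2 * t) * (f x * g x) + t\<^sup>2 * (g x)\<^sup>2 \<partial>M)"
      by (intro Bochner_Integration.integral_cong) (auto simp: power2_eq_square algebra_simps)
    also have "\<dots> = a + 2 * t * b + t\<^sup>2 * c"
      using f g L2_mult_integrable[OF f g] by (simp add: a_b_c_def L2_real_iff)
    finally show ?thesis .
  qed
  have ac: "a \<ge> 0" "c \<ge> 0" by (auto simp: a_b_c_def intro!: integral_nonneg_AE)
  have "b\<^sup>2 \<le> a * c"
  proof (cases "c = 0")
    case True
    have "b = 0"
    proof (rule ccontr)
      assume "b \<noteq> 0"
      \<comment> \<open>At this t the affine function takes the value -1.\<close>
      then show False using q[of "- (a + 1) / (2 * b)"] True ac by (simp add: field_simps)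
    qed
    then show ?thesis using ac by simp
  next
    case False
    then have "c > 0" using ac by simp
    have "0 \<le> c * (a + 2 * (- b / c) * b + (- b / c)\<^sup>2 * c)" using q[of "- b / c"] ac by (intro mult_nonneg_nonneg)
    also have "\<dots> = a * c - b\<^sup>2" using \<open>c > 0\<close> by (simp add: field_simps power2_eq_square)
    finally show ?thesis by simp
  qed
  then have "\<bar>b\<bar> \<le> sqrt (a * c)" using real_sqrt_le_mono[of "b\<^sup>2" "a * c"] by simp
  then show ?thesis by (simp add: real_sqrt_mult L2_norm_def a_b_c_def)
qed

lemma L2_add_bound:
  assumes f: "f \<in> L2 M" and g: "g \<in> L2 M" and h: "strongly_measurable M h"
    and le: "AE x in M. norm (h x) \<le> norm (f x) + norm (g x)"
  shows "h \<in> L2 M" "L2_norm M h \<le> L2_norm M f + L2_norm M g"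
proof -
  let ?F = "\<lambda>x. norm (f x)" and ?G = "\<lambda>x. norm (g x)"
  have F: "?F \<in> L2 M" and G: "?G \<in> L2 M" using f g L2D by auto
  note fg = L2D(2)[OF f] L2D(2)[OF g] L2_mult_integrable[OF F G]
  have eq: "(?F x + ?G x)\<^sup>2 = (?F x)\<^sup>2 + 2 * (?F x * ?G x) + (?G x)\<^sup>2" for x
    by (simp add: power2_sum)
  have int: "integrable M (\<lambda>x. (?F x + ?G x)\<^sup>2)" unfolding eq using fg by simp
  have FG: "(\<lambda>x. ?F x + ?G x) \<in> L2 M" using int F G by (auto simp: L2_real_iff)
  have le': "AE x in M. norm (h x) \<le> norm (?F x + ?G x)" using le by eventually_elim simp
  show "h \<in> L2 M" by (rule L2_dominated[OF h FG le'])
  have "(L2_norm M (\<lambda>x. ?F x + ?G x))\<^sup>2 = (\<integral>x. (?F x)\<^sup>2 + 2 * (?F x * ?G x) + (?G x)\<^sup>2 \<partial>M)"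
    by (simp add: L2_norm_sq eq)
  also have "\<dots> = (L2_norm M f)\<^sup>2 + 2 * (\<integral>x. ?F x * ?G x \<partial>M) + (L2_norm M g)\<^sup>2"
    using fg by (simp add: L2_norm_sq)
  also have "\<dots> \<le> (L2_norm M f)\<^sup>2 + 2 * (L2_norm M f * L2_norm M g) + (L2_norm M g)\<^sup>2"
    using Cauchy_Schwarz_L2[OF F G] by simp
  also have "\<dots> = (L2_norm M f + L2_norm M g)\<^sup>2" by (simp add: power2_sum)
  finally have "L2_norm M (\<lambda>x. ?F x + ?G x) \<le> L2_norm M f + L2_norm M g"
    by (rule power2_le_imp_le) simp
  then show "L2_norm M h \<le> L2_norm M f + L2_norm M g" using L2_dominated(2)[OF h FG le'] by simp
qed

lemma L2_add:
  assumes "f \<in> L2 M" "g \<in> L2 M"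
  shows "(\<lambda>x. f x + g x) \<in> L2 M" "L2_norm M (\<lambda>x. f x + g x) \<le> L2_norm M f + L2_norm M g"
proof -
  have "strongly_measurable M (\<lambda>x. f x + g x)"
    by (rule strongly_measurable_compose[OF L2D(1)[OF assms(1)] L2D(1)[OF assms(2)]]) (rule tendsto_add)
  from L2_add_bound[OF assms this] show "(\<lambda>x. f x + g x) \<in> L2 M"
    "L2_norm M (\<lambda>x. f x + g x) \<le> L2_norm M f + L2_norm M g" by (auto simp: norm_triangle_ineq)
qed

lemma L2_diff:
  assumes "f \<in> L2 M" "g \<in> L2 M"
  shows "(\<lambda>x. f x - g x) \<in> L2 M" "L2_norm M (\<lambda>x. f x - g x) \<le> L2_norm M f + L2_norm M g"
proof -
  have "strongly_measurable M (\<lambda>x. f x - g x)"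
    by (rule strongly_measurable_compose[OF L2D(1)[OF assms(1)] L2D(1)[OF assms(2)]]) (rule tendsto_diff)
  from L2_add_bound[OF assms this] show "(\<lambda>x. f x - g x) \<in> L2 M"
    "L2_norm M (\<lambda>x. f x - g x) \<le> L2_norm M f + L2_norm M g" by (auto simp: norm_triangle_ineq4)
qed

lemma L2_norm_scale: "L2_norm M (\<lambda>x. c *\<^sub>R f x) = \<bar>c\<bar> * L2_norm M f"
  by (simp add: L2_norm_def power_mult_distrib real_sqrt_mult)

lemma L2_scale:
  assumes "f \<in> L2 M"
  shows "(\<lambda>x. c *\<^sub>R f x) \<in> L2 M"
proof -
  have "strongly_measurable M (\<lambda>x. c *\<^sub>R f x)"
    using strongly_measurable_compose[OF L2D(1) L2D(1), OF assms assms, of "\<lambda>a b. c *\<^sub>R a"] by (simp add: tendsto_scaleR)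
  then show ?thesis using L2D(2)[OF assms] by (simp add: L2_def power_mult_distrib)
qed

lemma L2_scaleR_const:
  fixes \<phi> :: "'x \<Rightarrow> real"
  assumes "\<phi> \<in> L2 M"
  shows "(\<lambda>x. \<phi> x *\<^sub>R u) \<in> L2 M" "L2_norm M (\<lambda>x. \<phi> x *\<^sub>R u) = L2_norm M \<phi> * norm u"
proof -
  have "strongly_measurable M (\<lambda>x. \<phi> x *\<^sub>R u)"
    using strongly_measurable_compose[OF L2D(1) L2D(1), OF assms assms, of "\<lambda>a b. a *\<^sub>R u"] by (simp add: tendsto_scaleR)
  then show "(\<lambda>x. \<phi> x *\<^sub>R u) \<in> L2 M" using L2D(2)[OF assms] by (simp add: L2_def power_mult_distrib)
  show "L2_norm M (\<lambda>x. \<phi> x *\<^sub>R u) = L2_norm M \<phi> * norm u"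
    by (simp add: L2_norm_def power_mult_distrib real_sqrt_mult)
qed

lemma L2_norm_minus_commute: "L2_norm M (\<lambda>x. f x - g x) = L2_norm M (\<lambda>x. g x - f x)"
  by (simp add: L2_norm_def norm_minus_commute)

lemma L2_norm_triangle4:
  assumes "f \<in> L2 M" "g \<in> L2 M" "h \<in> L2 M"
  shows "L2_norm M (\<lambda>x. f x - h x) \<le> L2_norm M (\<lambda>x. f x - g x) + L2_norm M (\<lambda>x. g x - h x)"
  using L2_add(2)[OF L2_diff(1)[OF assms(1,2)] L2_diff(1)[OF assms(2,3)]] by simp

lemma L2_norm_triangle3:
  assumes "f \<in> L2 M" "g \<in> L2 M"
  shows "L2_norm M f \<le> L2_norm M (\<lambda>x. f x - g x) + L2_norm M g"
  using L2_add(2)[OF L2_diff(1)[OF assms(1,2)] assms(2)] by simp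

lemma L2_const [simp]: "(\<lambda>x. c) \<in> L2 M"
  by (simp add: L2_def strongly_measurable_simple)

lemma L2_bounded:
  assumes "strongly_measurable M f" "AE x in M. norm (f x) \<le> c"
  shows "f \<in> L2 M"
proof (rule L2_dominated(1)[OF assms(1)])
  show "(\<lambda>x. c) \<in> L2 M" by (rule L2_const)
  show "AE x in M. norm (f x) \<le> norm c" using assms(2) by eventually_elim simp
qed

lemma L2_simple: "simple_function M f \<Longrightarrow> f \<in> L2 M"
proof -
  assume f: "simple_function M f"
  then have "finite (f ` space M)" by (rule simple_functionD)
  then have "finite (norm ` f ` space M)" by simp
  then obtain c where "\<forall>x\<in>norm ` f ` space M. x \<le> c"
    using bdd_above_finite bdd_above_def by metis
  then have "AE x in M. norm (f x) \<le> c" by (auto intro!: AE_I2)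
  then show "f \<in> L2 M" using strongly_measurable_simple[OF f] by (intro L2_bounded)
qed

lemma L2_integrable:
  fixes f :: "'x \<Rightarrow> real"
  assumes "f \<in> L2 M"
  shows "integrable M f"
  using L2_mult_integrable[OF assms L2_const[of 1]] by simp

lemma L2_sum:
  assumes "finite I" "\<And>i. i \<in> I \<Longrightarrow> f i \<in> L2 M"
  shows "(\<lambda>x. \<Sum>i\<in>I. f i x) \<in> L2 M"
  using assms by (induction I rule: finite_induct) (auto intro: L2_add)

lemma L2_functionalD:
  assumes "L2_functional M l"
  shows "f \<in> L2 M \<Longrightarrow> g \<in> L2 M \<Longrightarrow> l (\<lambda>x. f x + g x) = l f + l g"
    "f \<in> L2 M \<Longrightarrow> l (\<lambda>x. c *\<^sub>R f x) = c * l f"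
    "f \<in> L2 M \<Longrightarrow> g \<in> L2 M \<Longrightarrow> l (\<lambda>x. f x - g x) = l f - l g"
    "\<exists>B\<ge>0. \<forall>f\<in>L2 M. \<bar>l f\<bar> \<le> B * L2_norm M f"
proof -
  show 1: "l (\<lambda>x. f x + g x) = l f + l g" if "f \<in> L2 M" "g \<in> L2 M" for f g
    using that assms by (auto simp: L2_functional_def)
  show 2: "l (\<lambda>x. c *\<^sub>R f x) = c * l f" if "f \<in> L2 M" for f c
    using that assms by (auto simp: L2_functional_def)
  show "l (\<lambda>x. f x - g x) = l f - l g" if "f \<in> L2 M" "g \<in> L2 M"
    using 1[OF that(1) L2_scale[OF that(2), of "-1"]] 2[OF that(2), of "-1"] by simp
  obtain B where B: "\<forall>f\<in>L2 M. \<bar>l f\<bar> \<le> B * L2_norm M f" using assms by (auto simp: L2_functional_def)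
  have "\<bar>l f\<bar> \<le> \<bar>B\<bar> * L2_norm M f" if "f \<in> L2 M" for f
    using bspec[OF B that] mult_right_mono[OF abs_ge_self[of B] L2_norm_nonneg[of f]] by linarith
  then show "\<exists>B\<ge>0. \<forall>f\<in>L2 M. \<bar>l f\<bar> \<le> B * L2_norm M f" by (intro exI[of _ "\<bar>B\<bar>"]) auto
qed

lemma L2_functional_sum:
  assumes l: "L2_functional M l" and "finite I" "\<And>i. i \<in> I \<Longrightarrow> f i \<in> L2 M"
  shows "l (\<lambda>x. \<Sum>i\<in>I. f i x) = (\<Sum>i\<in>I. l (f i))"
  using assms(2,3)
proof (induction I rule: finite_induct)
  case empty
  then show ?case using L2_functionalD(2)[OF l L2_const[of 0], of 0] by simp
next
  case (insert i I)
  then show ?case using L2_functionalD(1)[OF l, of "f i" "\<lambda>x. \<Sum>i\<in>I. f i x"] L2_sum[of I f] by simp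
qed

lemma L2_functional_AE_cong:
  assumes l: "L2_functional M l" and f: "f \<in> L2 M" and ae: "AE x in M. f x = g x"
  shows "l f = l g"
proof -
  have g: "g \<in> L2 M" by (rule L2_AE_cong[OF f ae])
  obtain B where B: "\<forall>f\<in>L2 M. \<bar>l f\<bar> \<le> B * L2_norm M f" using L2_functionalD(4)[OF l] by blast
  have "AE x in M. f x - g x = 0" using ae by eventually_elim simp
  from L2_AE_cong(2)[OF L2_diff(1)[OF f g] this] have "L2_norm M (\<lambda>x. f x - g x) = 0" by (simp add: L2_norm_def)
  then have "\<bar>l (\<lambda>x. f x - g x)\<bar> \<le> 0" using bspec[OF B L2_diff(1)[OF f g]] by simp
  then show ?thesis using L2_functionalD(3)[OF l f g] by simp
qed

lemma L2_functional_LIMSEQ: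
  assumes l: "L2_functional M l" and f: "f \<in> L2 M" "\<And>n. s n \<in> L2 M"
    and lim: "(\<lambda>n. L2_norm M (\<lambda>x. s n x - f x)) \<longlonglongrightarrow> 0"
  shows "(\<lambda>n. l (s n)) \<longlonglongrightarrow> l f"
proof -
  obtain B where B: "\<forall>f\<in>L2 M. \<bar>l f\<bar> \<le> B * L2_norm M f" using L2_functionalD(4)[OF l] by blast
  have "(\<lambda>n. l (s n) - l f) \<longlonglongrightarrow> 0"
  proof (rule Lim_null_comparison)
    show "\<forall>\<^sub>F n in sequentially. norm (l (s n) - l f) \<le> B * L2_norm M (\<lambda>x. s n x - f x)"
    proof (intro always_eventually allI)
      fix n
      show "norm (l (s n) - l f) \<le> B * L2_norm M (\<lambda>x. s n x - f x)"
        using bspec[OF B L2_diff(1)[OF f(2) f(1)], of n] L2_functionalD(3)[OF l f(2) f(1), of n] by simp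
    qed
    show "(\<lambda>n. B * L2_norm M (\<lambda>x. s n x - f x)) \<longlonglongrightarrow> 0" using tendsto_mult_right_zero[OF lim] .
  qed
  then show ?thesis by (rule LIM_zero_cancel)
qed

lemma L2_dominated_LIMSEQ:
  assumes f: "f \<in> L2 M" and s: "\<And>n. s n \<in> L2 M" and g: "g \<in> L2 M"
    and lim: "AE x in M. (\<lambda>n. s n x) \<longlonglongrightarrow> f x"
    and le: "\<And>n. AE x in M. norm (s n x - f x) \<le> norm (g x)"
  shows "(\<lambda>n. L2_norm M (\<lambda>x. s n x - f x)) \<longlonglongrightarrow> 0"
proof -
  have "(\<lambda>n. \<integral>x. (norm (s n x - f x))\<^sup>2 \<partial>M) \<longlonglongrightarrow> (\<integral>x. 0 \<partial>M)"
  proof (rule integral_dominated_convergence)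
    show "(\<lambda>x. (norm (s n x - f x))\<^sup>2) \<in> borel_measurable M" for n
      using L2D(3)[OF L2_diff(1)[OF s f]] by measurable
    show "integrable M (\<lambda>x. (norm (g x))\<^sup>2)" by (rule L2D(2)[OF g])
    show "AE x in M. (\<lambda>n. (norm (s n x - f x))\<^sup>2) \<longlonglongrightarrow> 0"
      using lim
    proof eventually_elim
      case (elim x)
      then have "(\<lambda>n. s n x - f x) \<longlonglongrightarrow> 0" by (rule LIM_zero)
      then show ?case using tendsto_power[OF tendsto_norm_zero, of "\<lambda>n. s n x - f x" _ 2] by simp
    qed
    show "AE x in M. norm ((norm (s n x - f x))\<^sup>2) \<le> (norm (g x))\<^sup>2" for n
      using le[of n] by eventually_elim (simp add: power_mono)
  qed simp
  then have "(\<lambda>n. sqrt (\<integral>x. (norm (s n x - f x))\<^sup>2 \<partial>M)) \<longlonglongrightarrow> sqrt 0" by (intro tendsto_real_sqrt) simp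
  then show ?thesis unfolding L2_norm_def by simp
qed

end

section \<open>Riesz representation and weak compactness for scalar functions\<close>

lemma bounded_diagonal_subsequence:
  fixes a :: "nat \<Rightarrow> nat \<Rightarrow> real"
  assumes bdd: "\<And>k. bounded (range (a k))"
  obtains r where "strict_mono r" "\<And>k. convergent (\<lambda>n. a k (r n))"
proof -
  interpret subseqs "\<lambda>k s. convergent (\<lambda>n. a k (s n))"
  proof
    fix k and s :: "nat \<Rightarrow> nat" assume "strict_mono s"
    have "bounded (range (\<lambda>n. a k (s n)))" by (rule bounded_subset[OF bdd]) auto
    then obtain l r where "strict_mono r" "((\<lambda>n. a k (s n)) \<circ> r) \<longlonglongrightarrow> l"
      using bounded_imp_convergent_subsequence by blast
    then show "\<exists>r'. strict_mono r' \<and> convergent (\<lambda>n. a k ((s \<circ> r') n))"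
      by (auto simp: o_def convergent_def)
  qed
  have "convergent (\<lambda>n. a k (diagseq n))" for k
  proof -
    \<comment> \<open>The diagonal sequence is a subsequence of the one selected for row
      \<open>k\<close> only from index \<open>Suc k\<close> on; the shift is removed
      afterwards.\<close>
    have "convergent (\<lambda>n. a k ((diagseq \<circ> (+) (Suc k)) n))"
    proof (rule diagseq_holds)
      show "convergent (\<lambda>m. a n ((s \<circ> r) m))" if "strict_mono r" "convergent (\<lambda>m. a n (s m))" for r s n
        using convergent_subseq_convergent[OF that(2,1)] by (simp add: o_def)
    qed
    then show ?thesis using convergent_ignore_initial_segment[of "\<lambda>n. a k (diagseq n)" "Suc k"]
      by (simp add: o_def add.commute)
  qed
  then show ?thesis using that subseq_diagseq by blast
qed

context complete_finite_measure
begin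

text \<open>On a finite measure space an L2 Cauchy sequence is Cauchy in L1, so a subsequence
  converges almost everywhere; Fatou's lemma then bounds the L2 distance of the whole sequence to
  that limit.\<close>

lemma L2_real_complete:
  fixes s :: "nat \<Rightarrow> 'x \<Rightarrow> real"
  assumes s: "\<And>n. s n \<in> L2 M"
    and C: "\<And>e. 0 < e \<Longrightarrow> \<exists>N. \<forall>m\<ge>N. \<forall>n\<ge>N. L2_norm M (\<lambda>x. s m x - s n x) < e"
  obtains f where "f \<in> L2 M" "(\<lambda>n. L2_norm M (\<lambda>x. s n x - f x)) \<longlonglongrightarrow> 0"
proof -
  define c where "c = L2_norm M (\<lambda>x. 1 :: real)"
  have c: "c \<ge> 0" by (simp add: c_def)
  have L1: "(\<integral>x. norm (s i x - s j x) \<partial>M) \<le> c * L2_norm M (\<lambda>x. s i x - s j x)" for i j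
    using Cauchy_Schwarz_L2[OF L2D(4)[OF L2_diff(1)[OF s s]] L2_const[of 1], of i j]
    unfolding L2_norm_norm by (simp add: c_def mult.commute)
  obtain r where r: "strict_mono r" "AE x in M. Cauchy (\<lambda>i. s (r i) x)"
  proof (rule cauchy_L1_AE_cauchy_subseq)
    show "integrable M (s n)" for n using s by (rule L2_integrable)
    show "\<exists>N. \<forall>i\<ge>N. \<forall>j\<ge>N. (\<integral>x. norm (s i x - s j x) \<partial>M) < e" if "0 < e" for e
    proof -
      \<comment> \<open>\<open>c\<close> is 0 on a null space, hence the divisor
        \<open>c + 1\<close>.\<close>
      have "0 < e / (c + 1)" using that c by simp
      then obtain N where N: "\<forall>m\<ge>N. \<forall>n\<ge>N. L2_norm M (\<lambda>x. s m x - s n x) < e / (c + 1)" using C by blast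
      have "(\<integral>x. norm (s i x - s j x) \<partial>M) < e" if "i \<ge> N" "j \<ge> N" for i j
      proof -
        have "(\<integral>x. norm (s i x - s j x) \<partial>M) \<le> (c + 1) * L2_norm M (\<lambda>x. s i x - s j x)"
          using add_increasing2[OF L2_norm_nonneg L1, of i j "\<lambda>x. s i x - s j x"] by (simp add: distrib_right)
        also have "\<dots> < (c + 1) * (e / (c + 1))" using N that c by (intro mult_strict_left_mono) auto
        finally show ?thesis using c by simp
      qed
      then show ?thesis by blast
    qed
  qed auto
  define f where "f x = lim (\<lambda>i. s (r i) x)" for x
  have lim: "AE x in M. (\<lambda>i. s (r i) x) \<longlonglongrightarrow> f x"
    using r(2) by eventually_elim (simp add: f_def Cauchy_convergent_iff convergent_LIMSEQ_iff)
  have sm: "s n \<in> borel_measurable M" for n using s L2_real_iff by blast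
  have fm: "f \<in> borel_measurable M" by (rule borel_measurable_AE_LIMSEQ[OF sm lim])
  have diff_meas: "(\<lambda>x. s n x - f x) \<in> borel_measurable M" for n using sm fm by measurable
  have key: "(\<lambda>x. s n x - f x) \<in> L2 M \<and> L2_norm M (\<lambda>x. s n x - f x) \<le> e"
    if N: "\<forall>m\<ge>N. \<forall>n\<ge>N. L2_norm M (\<lambda>x. s m x - s n x) < e" and n: "n \<ge> N" and e: "e > 0" for N n e
  proof -
    have "(\<integral>\<^sup>+x. ennreal ((s n x - f x)\<^sup>2) \<partial>M) \<le> (\<integral>\<^sup>+x. liminf (\<lambda>i. ennreal ((s n x - s (r i) x)\<^sup>2)) \<partial>M)"
    proof (rule nn_integral_mono_AE)
      show "AE x in M. ennreal ((s n x - f x)\<^sup>2) \<le> liminf (\<lambda>i. ennreal ((s n x - s (r i) x)\<^sup>2))"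
        using lim
      proof eventually_elim
        case (elim x)
        have "(\<lambda>i. ennreal ((s n x - s (r i) x)\<^sup>2)) \<longlonglongrightarrow> ennreal ((s n x - f x)\<^sup>2)"
          using elim by (intro tendsto_ennrealI tendsto_intros)
        from lim_imp_Liminf[OF trivial_limit_sequentially this] show ?case by simp
      qed
    qed
    also have "\<dots> \<le> liminf (\<lambda>i. \<integral>\<^sup>+x. ennreal ((s n x - s (r i) x)\<^sup>2) \<partial>M)"
      using sm by (intro nn_integral_liminf) measurable
    also have "\<dots> \<le> ennreal (e\<^sup>2)"
    proof (rule Liminf_le)
      have "eventually (\<lambda>i. i \<ge> N) sequentially" by simp
      then show "\<forall>\<^sub>F i in sequentially. (\<integral>\<^sup>+x. ennreal ((s n x - s (r i) x)\<^sup>2) \<partial>M) \<le> ennreal (e\<^sup>2)"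
      proof eventually_elim
        case (elim i)
        then have "r i \<ge> N" using seq_suble[OF r(1), of i] by simp
        then have "L2_norm M (\<lambda>x. s n x - s (r i) x) < e" using N n by auto
        then have "(L2_norm M (\<lambda>x. s n x - s (r i) x))\<^sup>2 \<le> e\<^sup>2" by (intro power_mono) auto
        then show ?case using L2D(2)[OF L2_diff(1)[OF s s], of n "r i"]
          by (simp add: L2_norm_sq nn_integral_eq_integral)
      qed
    qed auto
    finally have le: "(\<integral>\<^sup>+x. ennreal ((s n x - f x)\<^sup>2) \<partial>M) \<le> ennreal (e\<^sup>2)" .
    have int: "integrable M (\<lambda>x. (s n x - f x)\<^sup>2)"
      using diff_meas le by (intro integrableI_nonneg) (auto simp: less_top[symmetric] top_unique)
    then have mem: "(\<lambda>x. s n x - f x) \<in> L2 M" using diff_meas by (simp add: L2_real_iff)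
    have "ennreal (\<integral>x. (s n x - f x)\<^sup>2 \<partial>M) \<le> ennreal (e\<^sup>2)" using le int by (simp add: nn_integral_eq_integral)
    then have "(L2_norm M (\<lambda>x. s n x - f x))\<^sup>2 \<le> e\<^sup>2" by (simp add: L2_norm_sq)
    then show ?thesis using mem power2_le_imp_le e by (meson less_imp_le)
  qed
  show ?thesis
  proof
    obtain N where "\<forall>m\<ge>N. \<forall>n\<ge>N. L2_norm M (\<lambda>x. s m x - s n x) < 1" using C[of 1] by auto
    from key[OF this order_refl] have "(\<lambda>x. s N x - f x) \<in> L2 M" by simp
    from L2_diff(1)[OF s this, of N] show "f \<in> L2 M" by simp
    show "(\<lambda>n. L2_norm M (\<lambda>x. s n x - f x)) \<longlonglongrightarrow> 0"
    proof (rule LIMSEQ_I)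
      fix e :: real assume e: "0 < e"
      then obtain N where "\<forall>m\<ge>N. \<forall>n\<ge>N. L2_norm M (\<lambda>x. s m x - s n x) < e / 2" using C[of "e/2"] by auto
      from key[OF this] e show "\<exists>no. \<forall>n\<ge>no. norm (L2_norm M (\<lambda>x. s n x - f x) - 0) < e"
        by (intro exI[of _ N]) force
    qed
  qed
qed

text \<open>Closedness is sequential in the seminorm, since representatives carry no topology of
  their own. Constant sequences show that such a set is also stable under equality almost
  everywhere.\<close>

definition L2_closed_subspace :: "('x \<Rightarrow> real) set \<Rightarrow> bool" where
  "L2_closed_subspace P \<longleftrightarrow> P \<subseteq> L2 M \<and> (\<lambda>x. 0) \<in> P \<and>
     (\<forall>f\<in>P. \<forall>g\<in>P. (\<lambda>x. f x + g x) \<in> P) \<and> (\<forall>c. \<forall>f\<in>P. (\<lambda>x. c * f x) \<in> P) \<and>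
     (\<forall>s f. (\<forall>n. s n \<in> P) \<and> f \<in> L2 M \<and> (\<lambda>n. L2_norm M (\<lambda>x. s n x - f x)) \<longlonglongrightarrow> 0 \<longrightarrow> f \<in> P)"

lemma L2_closed_subspace_UNIV: "L2_closed_subspace (L2 M)"
  using L2_scale[of "_ :: 'x \<Rightarrow> real"] by (auto simp: L2_closed_subspace_def L2_add)

text \<open>
  The representing function minimises \<open>\<phi> \<mapsto> \<parallel>\<phi>\<parallel>\<^sup>2 - 2 l \<phi>\<close>; a minimising sequence is Cauchy
  by the parallelogram identity.
\<close>

lemma L2_Riesz:
  assumes P: "L2_closed_subspace P"
    and add: "\<And>f g. f \<in> P \<Longrightarrow> g \<in> P \<Longrightarrow> l (\<lambda>x. f x + g x) = l f + l g"
    and scale: "\<And>c f. f \<in> P \<Longrightarrow> l (\<lambda>x. c * f x) = c * l f"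
    and bound: "\<And>f. f \<in> P \<Longrightarrow> \<bar>l f\<bar> \<le> C * L2_norm M f"
  obtains h where "h \<in> P" "\<And>\<phi>. \<phi> \<in> P \<Longrightarrow> l \<phi> = (\<integral>x. h x * \<phi> x \<partial>M)"
proof -
  have PL: "f \<in> L2 M" if "f \<in> P" for f using P that by (auto simp: L2_closed_subspace_def)
  have P0: "(\<lambda>x. 0) \<in> P" and Padd: "\<And>f g. f \<in> P \<Longrightarrow> g \<in> P \<Longrightarrow> (\<lambda>x. f x + g x) \<in> P"
    and Psc: "\<And>c f. f \<in> P \<Longrightarrow> (\<lambda>x. c * f x) \<in> P"
    and Pcl: "\<And>s f. (\<And>n. s n \<in> P) \<Longrightarrow> f \<in> L2 M \<Longrightarrow> (\<lambda>n. L2_norm M (\<lambda>x. s n x - f x)) \<longlonglongrightarrow> 0 \<Longrightarrow> f \<in> P"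
    using P unfolding L2_closed_subspace_def by blast+
  define ip where "ip f g = (\<integral>x. f x * g x \<partial>M)" for f g :: "'x \<Rightarrow> real"
  have int: "integrable M (\<lambda>x. f x * g x)" if "f \<in> P" "g \<in> P" for f g
    using that PL L2_mult_integrable by blast
  have sq: "(L2_norm M f)\<^sup>2 = ip f f" for f
    by (simp add: L2_norm_sq ip_def power2_eq_square[symmetric])
  define q where "q f = ip f f - 2 * l f" for f
  have ip_lin: "ip (\<lambda>x. a * f x + b * g x) (\<lambda>x. a * f x + b * g x)
      = a\<^sup>2 * ip f f + 2 * a * b * ip f g + b\<^sup>2 * ip g g" if fg: "f \<in> P" "g \<in> P" for a b f g
  proof -
    have "ip (\<lambda>x. a * f x + b * g x) (\<lambda>x. a * f x + b * g x)
        = (\<integral>x. a\<^sup>2 * (f x * f x) + 2 * a * b * (f x * g x) + b\<^sup>2 * (g x * g x) \<partial>M)"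
      unfolding ip_def by (intro Bochner_Integration.integral_cong) (auto simp: power2_eq_square algebra_simps)
    then show ?thesis using int[OF fg(1,1)] int[OF fg] int[OF fg(2,2)] by (simp add: ip_def)
  qed
  have l_lin: "l (\<lambda>x. a * f x + b * g x) = a * l f + b * l g" if "f \<in> P" "g \<in> P" for a b f g
    using add[OF Psc Psc, OF that] scale that by simp
  have Plin: "(\<lambda>x. a * f x + b * g x) \<in> P" if "f \<in> P" "g \<in> P" for a b f g
    using Padd[OF Psc Psc, OF that] .
  \<comment> \<open>Completing the square: with r the norm of \<open>f\<close>, the value
    \<open>q f\<close> is at least r^2 - 2 C r.\<close>
  have q_lo: "- C\<^sup>2 \<le> q f" if "f \<in> P" for f
  proof -
    have "0 \<le> (L2_norm M f - C)\<^sup>2" by simp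
    then have "2 * (C * L2_norm M f) \<le> ip f f + C\<^sup>2" by (simp add: power2_diff sq mult_ac)
    then show ?thesis using abs_le_D1[OF bound[OF that]] by (simp add: q_def)
  qed
  define m where "m = (INF f\<in>P. q f)"
  have bdd: "bdd_below (q ` P)" using q_lo by (auto intro!: bdd_belowI2)
  have m_le: "m \<le> q f" if "f \<in> P" for f unfolding m_def by (rule cINF_lower[OF bdd that])
  have "\<exists>f\<in>P. q f < m + inverse (real (Suc n))" for n
    using cINF_less_iff[OF _ bdd, of "m + inverse (real (Suc n))"] P0 unfolding m_def[symmetric] by auto
  then obtain s where s: "\<And>n. s n \<in> P" "\<And>n. q (s n) < m + inverse (real (Suc n))" by metis
  have par: "ip (\<lambda>x. f x - g x) (\<lambda>x. f x - g x) \<le> 2 * q f + 2 * q g - 4 * m" if "f \<in> P" "g \<in> P" for f g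
  proof -
    have "m \<le> q (\<lambda>x. (1/2) * f x + (1/2) * g x)" by (intro m_le Plin that)
    also have "\<dots> = 1/4 * ip f f + 1/2 * ip f g + 1/4 * ip g g - l f - l g"
      unfolding q_def using ip_lin[OF that, of "1/2" "1/2"] l_lin[OF that, of "1/2" "1/2"]
      by (simp add: power2_eq_square)
    finally show ?thesis using ip_lin[OF that, of 1 "-1"] by (simp add: q_def)
  qed
  obtain h where h: "h \<in> L2 M" "(\<lambda>n. L2_norm M (\<lambda>x. s n x - h x)) \<longlonglongrightarrow> 0"
  proof (rule L2_real_complete)
    show "s n \<in> L2 M" for n by (rule PL[OF s(1)])
    fix e :: real assume "0 < e"
    then have "0 < e\<^sup>2 / 4" by simp
    then obtain N where N: "inverse (real (Suc N)) < e\<^sup>2 / 4" using reals_Archimedean by blast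
    have "L2_norm M (\<lambda>x. s i x - s j x) < e" if ij: "i \<ge> N" "j \<ge> N" for i j
    proof -
      have "inverse (real (Suc i)) \<le> inverse (real (Suc N))" "inverse (real (Suc j)) \<le> inverse (real (Suc N))"
        using ij by auto
      then have "2 * q (s i) + 2 * q (s j) - 4 * m < e\<^sup>2" using s(2)[of i] s(2)[of j] N by linarith
      then have "(L2_norm M (\<lambda>x. s i x - s j x))\<^sup>2 < e\<^sup>2" using par[OF s(1) s(1), of i j] sq by simp
      then show ?thesis using \<open>0 < e\<close> by (intro power2_less_imp_less[of _ e]) auto
    qed
    then show "\<exists>N. \<forall>m\<ge>N. \<forall>n\<ge>N. L2_norm M (\<lambda>x. s m x - s n x) < e" by blast
  qed auto
  have hP: "h \<in> P" using Pcl[OF s(1) h] .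
  have diffP: "(\<lambda>x. f x - g x) \<in> P" if "f \<in> P" "g \<in> P" for f g using Plin[OF that, of 1 "-1"] by simp
  \<comment> \<open>\<open>q\<close> varies along the sequence by at most a multiple of the L2
    distance to \<open>h\<close>, so the strong limit attains the infimum.\<close>
  have qh: "q h \<le> m"
  proof -
    have q_h: "q h \<le> q (s n) + (2 * L2_norm M h + 2 * \<bar>C\<bar>) * L2_norm M (\<lambda>x. s n x - h x)" for n
    proof -
      let ?d = "\<lambda>x. s n x - h x"
      have d: "?d \<in> P" by (rule diffP[OF s(1) hP])
      have "q (s n) = q (\<lambda>x. 1 * h x + 1 * ?d x)" by simp
      also have "\<dots> = q h + 2 * ip h ?d + ip ?d ?d - 2 * l ?d"
        unfolding q_def using ip_lin[OF hP d, of 1 1] l_lin[OF hP d, of 1 1] by simp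
      finally have "q h = q (s n) - 2 * ip h ?d - ip ?d ?d + 2 * l ?d" by simp
      moreover have "\<bar>ip h ?d\<bar> \<le> L2_norm M h * L2_norm M ?d"
        unfolding ip_def by (rule Cauchy_Schwarz_L2[OF h(1) PL[OF d]])
      moreover have "\<bar>l ?d\<bar> \<le> \<bar>C\<bar> * L2_norm M ?d"
        using bound[OF d] mult_right_mono[OF abs_ge_self[of C] L2_norm_nonneg[of ?d]] by linarith
      moreover have "0 \<le> ip ?d ?d" unfolding sq[symmetric] by simp
      ultimately show ?thesis by (simp add: distrib_right)
    qed
    have "(\<lambda>n. (m + inverse (real (Suc n))) + (2 * L2_norm M h + 2 * \<bar>C\<bar>) * L2_norm M (\<lambda>x. s n x - h x)) \<longlonglongrightarrow> (m + 0) + (2 * L2_norm M h + 2 * \<bar>C\<bar>) * 0"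
      by (intro tendsto_intros LIMSEQ_inverse_real_of_nat h)
    moreover have "q h \<le> (m + inverse (real (Suc n))) + (2 * L2_norm M h + 2 * \<bar>C\<bar>) * L2_norm M (\<lambda>x. s n x - h x)" for n
      using q_h[of n] s(2)[of n] by linarith
    ultimately show ?thesis using LIMSEQ_le_const by fastforce
  qed
  have "l \<phi> = ip h \<phi>" if \<phi>: "\<phi> \<in> P" for \<phi>
  proof -
    define b where "b = ip h \<phi> - l \<phi>"
    have var: "0 \<le> 2 * t * b + t\<^sup>2 * ip \<phi> \<phi>" for t
    proof -
      have "q h \<le> q (\<lambda>x. 1 * h x + t * \<phi> x)" using qh m_le[OF Plin[OF hP \<phi>]] by (rule order_trans)
      also have "\<dots> = q h + 2 * t * b + t\<^sup>2 * ip \<phi> \<phi>"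
        unfolding q_def b_def using ip_lin[OF hP \<phi>, of 1 t] l_lin[OF hP \<phi>, of 1 t] by (simp add: algebra_simps)
      finally show ?thesis by simp
    qed
    \<comment> \<open>The first variation is tested at \<open>- b / c\<close>; adding 1 keeps this
      defined when \<open>\<phi>\<close> is null.\<close>
    define c where "c = ip \<phi> \<phi> + 1"
    have "0 \<le> ip \<phi> \<phi>" unfolding sq[symmetric] by simp
    then have c: "c > 0" "ip \<phi> \<phi> < c" by (auto simp: c_def)
    have "0 \<le> 2 * (- b / c) * b + (- b / c)\<^sup>2 * ip \<phi> \<phi>" by (rule var)
    also have "\<dots> \<le> 2 * (- b / c) * b + (- b / c)\<^sup>2 * c" using c by (intro add_left_mono mult_left_mono) auto
    also have "\<dots> = - b\<^sup>2 / c" using c by (simp add: field_simps power2_eq_square)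
    finally have "b\<^sup>2 \<le> 0" using c by (simp add: field_simps)
    then show ?thesis by (simp add: b_def)
  qed
  then show ?thesis using that hP by (auto simp: ip_def)
qed

lemma L2_real_functional_Riesz:
  fixes l :: "('x \<Rightarrow> real) \<Rightarrow> real"
  assumes l: "L2_functional M l"
  obtains h where "h \<in> L2 M" "\<And>\<phi>. \<phi> \<in> L2 M \<Longrightarrow> l \<phi> = (\<integral>x. h x * \<phi> x \<partial>M)"
proof -
  obtain B where "\<forall>f\<in>L2 M. \<bar>l f\<bar> \<le> B * L2_norm M f" using L2_functionalD(4)[OF l] by blast
  then show ?thesis
    using L2_Riesz[OF L2_closed_subspace_UNIV, of l B] L2_functionalD(1,2)[OF l] that by auto
qed

text \<open>By Riesz representation this is \<open>L2_weak_lim\<close> for scalar functions;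
  explicit test functions allow choosing them, for instance as a negative part.\<close>

definition weak_L2_real :: "(nat \<Rightarrow> 'x \<Rightarrow> real) \<Rightarrow> ('x \<Rightarrow> real) \<Rightarrow> bool" where
  "weak_L2_real f h \<longleftrightarrow> (\<forall>n. f n \<in> L2 M) \<and> h \<in> L2 M \<and>
     (\<forall>\<phi>\<in>L2 M. (\<lambda>n. \<integral>x. f n x * \<phi> x \<partial>M) \<longlonglongrightarrow> (\<integral>x. h x * \<phi> x \<partial>M))"

text \<open>
  The test functions \<open>\<phi>\<close> for which \<open>\<integral> f\<^sub>n \<phi>\<close> converges form a closed subspace containing every
  \<open>f\<^sub>m\<close>. Functions orthogonal to it are trivially good test functions.
\<close>

lemma weak_L2_real_exists:
  assumes f: "\<And>n. f n \<in> L2 M" and bdd: "\<And>n. L2_norm M (f n) \<le> B"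
    and conv: "\<And>m. convergent (\<lambda>n. \<integral>x. f n x * f m x \<partial>M)"
  shows "\<exists>h. weak_L2_real f h"
proof -
  define ip where "ip f g = (\<integral>x. f x * g x \<partial>M)" for f g :: "'x \<Rightarrow> real"
  have B: "B \<ge> 0" using bdd[of 0] L2_norm_nonneg[of "f 0"] by linarith
  have ip_le: "\<bar>ip (f n) g\<bar> \<le> B * L2_norm M g" if "g \<in> L2 M" for g n
    using Cauchy_Schwarz_L2[OF f that, of n] mult_right_mono[OF bdd[of n] L2_norm_nonneg[of g]] by (simp add: ip_def)
  have ip_add: "ip h (\<lambda>x. g x + k x) = ip h g + ip h k" if "h \<in> L2 M" "g \<in> L2 M" "k \<in> L2 M" for h g k
    using L2_mult_integrable[OF that(1,2)] L2_mult_integrable[OF that(1,3)] by (simp add: ip_def distrib_left)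
  have ip_diff: "ip h (\<lambda>x. g x - k x) = ip h g - ip h k" if "h \<in> L2 M" "g \<in> L2 M" "k \<in> L2 M" for h g k
    using L2_mult_integrable[OF that(1,2)] L2_mult_integrable[OF that(1,3)] by (simp add: ip_def right_diff_distrib)
  have ip_sc: "ip h (\<lambda>x. c * g x) = c * ip h g" for h g c
    by (simp add: ip_def mult.left_commute)
  have ip_comm: "ip g h = ip h g" for g h by (simp add: ip_def mult.commute)
  have sc: "(\<lambda>x. c * g x) \<in> L2 M" if "g \<in> L2 M" for c and g :: "'x \<Rightarrow> real" using L2_scale[OF that, of c] by simp
  define P where "P = {g \<in> L2 M. convergent (\<lambda>n. ip (f n) g)}"
  have P: "L2_closed_subspace P" unfolding L2_closed_subspace_def
  proof (intro conjI ballI allI impI)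
    show "P \<subseteq> L2 M" by (auto simp: P_def)
    show "(\<lambda>x. 0) \<in> P" by (simp add: P_def ip_def convergent_const)
    show "(\<lambda>x. g x + h x) \<in> P" if "g \<in> P" "h \<in> P" for g h
      using that convergent_add by (auto simp: P_def ip_add[OF f] L2_add)
    show "(\<lambda>x. c * g x) \<in> P" if "g \<in> P" for c g
      using that convergent_mult[OF convergent_const[of c]] by (auto simp: P_def ip_sc sc)
    fix s g assume sg: "(\<forall>n. s n \<in> P) \<and> g \<in> L2 M \<and> (\<lambda>n. L2_norm M (\<lambda>x. s n x - g x)) \<longlonglongrightarrow> 0"
    then have sP: "\<And>n. s n \<in> P" and g: "g \<in> L2 M" and lim: "(\<lambda>n. L2_norm M (\<lambda>x. s n x - g x)) \<longlonglongrightarrow> 0" by auto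
    have sL: "s n \<in> L2 M" for n using sP by (auto simp: P_def)
    have "Cauchy (\<lambda>n. ip (f n) g)"
    proof (rule CauchyI)
      fix e :: real assume e: "0 < e"
      then have "0 < e / (4 * (B + 1))" using B by simp
      from LIMSEQ_D[OF lim this] obtain k where k: "L2_norm M (\<lambda>x. s k x - g x) < e / (4 * (B + 1))" by auto
      have "Cauchy (\<lambda>n. ip (f n) (s k))" using sP[of k] by (auto simp: P_def convergent_Cauchy)
      from CauchyD[OF this, of "e/2"] e obtain N where
        N: "\<And>m n. m \<ge> N \<Longrightarrow> n \<ge> N \<Longrightarrow> \<bar>ip (f m) (s k) - ip (f n) (s k)\<bar> < e / 2" by auto
      have close: "\<bar>ip (f n) (s k) - ip (f n) g\<bar> < e / 4" for n
      proof -
        have "\<bar>ip (f n) (s k) - ip (f n) g\<bar> \<le> B * L2_norm M (\<lambda>x. s k x - g x)"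
          using ip_le[OF L2_diff(1)[OF sL g], of n k] ip_diff[OF f sL g, of n k] by simp
        also have "\<dots> \<le> (B + 1) * L2_norm M (\<lambda>x. s k x - g x)" by (simp add: mult_right_mono)
        also have "\<dots> < (B + 1) * (e / (4 * (B + 1)))" using k B by (intro mult_strict_left_mono) auto
        also have "\<dots> = e / 4" using B by (simp add: field_simps)
        finally show ?thesis .
      qed
      have "\<bar>ip (f m) g - ip (f n) g\<bar> < e" if "m \<ge> N" "n \<ge> N" for m n
        using N[OF that] close[of m] close[of n] by linarith
      then show "\<exists>M. \<forall>m\<ge>M. \<forall>n\<ge>M. norm (ip (f m) g - ip (f n) g) < e" by auto
    qed
    then show "g \<in> P" using g by (simp add: P_def Cauchy_convergent_iff)
  qed
  define l where "l g = lim (\<lambda>n. ip (f n) g)" for g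
  have l: "(\<lambda>n. ip (f n) g) \<longlonglongrightarrow> l g" if "g \<in> P" for g
    using that by (simp add: P_def l_def convergent_LIMSEQ_iff)
  have PL: "g \<in> L2 M" if "g \<in> P" for g using that by (simp add: P_def)
  obtain h where h: "h \<in> P" "\<And>g. g \<in> P \<Longrightarrow> l g = ip h g"
  proof (rule L2_Riesz[OF P, of l B])
    show "l (\<lambda>x. g x + k x) = l g + l k" if "g \<in> P" "k \<in> P" for g k
      unfolding l_def using tendsto_add[OF l[OF that(1)] l[OF that(2)]] PL that
      by (intro limI) (simp add: ip_add[OF f] l_def)
    show "l (\<lambda>x. c * g x) = c * l g" if "g \<in> P" for g c
      unfolding l_def using tendsto_mult[OF tendsto_const[of c] l[OF that]]
      by (intro limI) (simp add: ip_sc l_def)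
    show "\<bar>l g\<bar> \<le> B * L2_norm M g" if "g \<in> P" for g
      using tendsto_rabs[OF l[OF that]] ip_le[OF PL[OF that]] by (intro LIMSEQ_le_const2) auto
  qed (auto simp: ip_def)
  have "(\<lambda>n. ip (f n) \<phi>) \<longlonglongrightarrow> ip h \<phi>" if \<phi>: "\<phi> \<in> L2 M" for \<phi>
  proof -
    \<comment> \<open>\<open>\<psi>\<close> is the orthogonal projection of \<open>\<phi>\<close>
      onto \<open>P\<close>, obtained by representing \<open>ip \<phi>\<close> restricted to
      \<open>P\<close>; every \<open>f n\<close> and \<open>h\<close> pair alike with both.\<close>
    obtain \<psi> where \<psi>: "\<psi> \<in> P" "\<And>g. g \<in> P \<Longrightarrow> ip \<phi> g = ip \<psi> g"
    proof (rule L2_Riesz[OF P, of "ip \<phi>" "L2_norm M \<phi>"])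
      show "\<bar>ip \<phi> g\<bar> \<le> L2_norm M \<phi> * L2_norm M g" if "g \<in> P" for g
        unfolding ip_def by (rule Cauchy_Schwarz_L2[OF \<phi> PL[OF that]])
    qed (use ip_add[OF \<phi>] PL ip_sc in \<open>auto simp: ip_def\<close>)
    have fP: "f m \<in> P" for m using conv[of m] f[of m] by (simp add: P_def ip_def)
    have "ip (f n) \<phi> = ip (f n) \<psi>" for n using \<psi>(2)[OF fP[of n]] ip_comm by metis
    moreover have "ip h \<phi> = ip h \<psi>" using \<psi>(2)[OF h(1)] ip_comm by metis
    ultimately show ?thesis using l[OF \<psi>(1)] h(2)[OF \<psi>(1)] by simp
  qed
  then have "weak_L2_real f h" using f PL[OF h(1)] by (simp add: weak_L2_real_def ip_def)
  then show ?thesis by blast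
qed

text \<open>Weak convergence of row \<open>k\<close> follows once all inner products with the row's
  own members converge. These are countably many bounded real sequences, with (k, m) coded as one
  number, so a single diagonal choice serves every row.\<close>

lemma weak_L2_real_subsequences:
  fixes f :: "nat \<Rightarrow> nat \<Rightarrow> 'x \<Rightarrow> real"
  assumes f: "\<And>k n. f k n \<in> L2 M" and bdd: "\<And>k n. L2_norm M (f k n) \<le> B k"
  obtains r h where "strict_mono r" "\<And>k. weak_L2_real (\<lambda>n. f k (r n)) (h k)"
proof -
  define a where "a j n = (case prod_decode j of (k, m) \<Rightarrow> \<integral>x. f k n x * f k m x \<partial>M)" for j n
  have "bounded (range (a j))" for j
  proof -
    obtain k m where km: "prod_decode j = (k, m)" by (cases "prod_decode j")
    have "\<bar>a j n\<bar> \<le> B k * L2_norm M (f k m)" for n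
      using Cauchy_Schwarz_L2[OF f f, of k n k m] mult_right_mono[OF bdd[of k n] L2_norm_nonneg[of "f k m"]] km
      by (simp add: a_def)
    then show ?thesis by (intro boundedI) auto
  qed
  then obtain r where r: "strict_mono r" "\<And>j. convergent (\<lambda>n. a j (r n))"
    using bounded_diagonal_subsequence by blast
  have "\<exists>h. weak_L2_real (\<lambda>n. f k (r n)) h" for k
  proof (rule weak_L2_real_exists[OF f bdd])
    show "convergent (\<lambda>n. \<integral>x. f k (r n) x * f k (r m) x \<partial>M)" for m
      using r(2)[of "prod_encode (k, r m)"] by (simp add: a_def)
  qed
  then show ?thesis using r(1) that by metis
qed

lemma weak_L2_real_combine:
  assumes "weak_L2_real f h" "weak_L2_real g k"
  shows "weak_L2_real (\<lambda>n x. a * f n x + b * g n x) (\<lambda>x. a * h x + b * k x)"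
  unfolding weak_L2_real_def
proof (intro conjI allI ballI)
  have f: "f n \<in> L2 M" "h \<in> L2 M" "g n \<in> L2 M" "k \<in> L2 M" for n using assms by (auto simp: weak_L2_real_def)
  have comb: "(\<lambda>x. a * u x + b * v x) \<in> L2 M" if "u \<in> L2 M" "v \<in> L2 M" for u v :: "'x \<Rightarrow> real"
    using L2_add(1)[OF L2_scale[OF that(1), of a] L2_scale[OF that(2), of b]] by simp
  show "(\<lambda>x. a * f n x + b * g n x) \<in> L2 M" "(\<lambda>x. a * h x + b * k x) \<in> L2 M" for n
    using comb f by auto
  fix \<phi> :: "'x \<Rightarrow> real" assume \<phi>: "\<phi> \<in> L2 M"
  have eq: "(\<integral>x. (a * u x + b * v x) * \<phi> x \<partial>M) = a * (\<integral>x. u x * \<phi> x \<partial>M) + b * (\<integral>x. v x * \<phi> x \<partial>M)"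
    if "u \<in> L2 M" "v \<in> L2 M" for u v
    using L2_mult_integrable[OF that(1) \<phi>] L2_mult_integrable[OF that(2) \<phi>] by (simp add: distrib_right mult.assoc)
  show "(\<lambda>n. \<integral>x. (a * f n x + b * g n x) * \<phi> x \<partial>M) \<longlonglongrightarrow> (\<integral>x. (a * h x + b * k x) * \<phi> x \<partial>M)"
    unfolding eq[OF f(1,3)] eq[OF f(2,4)]
    using assms \<phi> by (intro tendsto_intros) (auto simp: weak_L2_real_def)
qed

text \<open>Testing against the negative part of \<open>h\<close> yields minus its squared norm in
  the limit, while the integrals along the sequence are eventually nonnegative.\<close>

lemma weak_L2_real_nonneg:
  assumes w: "weak_L2_real f h" and nn: "\<forall>\<^sub>F n in sequentially. AE x in M. 0 \<le> f n x"
  shows "AE x in M. 0 \<le> h x"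
proof -
  have h: "h \<in> L2 M" using w by (simp add: weak_L2_real_def)
  then have hm [measurable]: "h \<in> borel_measurable M" by (simp add: L2_real_iff)
  define \<phi> where "\<phi> x = max 0 (- h x)" for x
  have \<phi>: "\<phi> \<in> L2 M"
    by (rule L2_dominated(1)[OF _ h]) (auto simp: strongly_measurable_iff_borel \<phi>_def[abs_def])
  have "(\<lambda>n. \<integral>x. f n x * \<phi> x \<partial>M) \<longlonglongrightarrow> (\<integral>x. h x * \<phi> x \<partial>M)" using w \<phi> by (simp add: weak_L2_real_def)
  moreover have "\<forall>\<^sub>F n in sequentially. 0 \<le> (\<integral>x. f n x * \<phi> x \<partial>M)"
    using nn
  proof eventually_elim
    case (elim n)
    then have "AE x in M. 0 \<le> f n x * \<phi> x" by eventually_elim (simp add: \<phi>_def)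
    then show ?case by (rule integral_nonneg_AE)
  qed
  ultimately have "0 \<le> (\<integral>x. h x * \<phi> x \<partial>M)" by (intro tendsto_lowerbound[where F = sequentially]) auto
  also have "(\<integral>x. h x * \<phi> x \<partial>M) = - (\<integral>x. (\<phi> x)\<^sup>2 \<partial>M)"
    unfolding integral_minus[symmetric] \<phi>_def
    by (intro Bochner_Integration.integral_cong) (auto simp: max_def power2_eq_square)
  finally have "(\<integral>x. (\<phi> x)\<^sup>2 \<partial>M) = 0" using integral_nonneg_AE[of "\<lambda>x. (\<phi> x)\<^sup>2" M] by (simp add: order_antisym)
  moreover have "integrable M (\<lambda>x. (\<phi> x)\<^sup>2)" using \<phi> by (simp add: L2_real_iff)
  ultimately have "AE x in M. (\<phi> x)\<^sup>2 = 0" by (subst (asm) integral_nonneg_eq_0_iff_AE) auto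
  then show ?thesis by eventually_elim (simp add: \<phi>_def max_def split: if_splits)
qed

text \<open>The zero sequence f - f converges weakly to both h - k and k - h, so positivity applies
  in both directions.\<close>

lemma weak_L2_real_unique:
  assumes "weak_L2_real f h" "weak_L2_real f k"
  shows "AE x in M. h x = k x"
proof -
  have "AE x in M. 0 \<le> 1 * h x + (-1) * k x"
    by (rule weak_L2_real_nonneg[OF weak_L2_real_combine[OF assms]]) auto
  moreover have "AE x in M. 0 \<le> 1 * k x + (-1) * h x"
    by (rule weak_L2_real_nonneg[OF weak_L2_real_combine[OF assms(2,1)]]) auto
  ultimately show ?thesis by eventually_elim simp
qed

lemma weak_L2_real_AE_cong:
  assumes "weak_L2_real f h" "AE x in M. h x = k x"
  shows "weak_L2_real f k"
  unfolding weak_L2_real_def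
proof (intro conjI allI ballI)
  show k: "k \<in> L2 M" using L2_AE_cong assms by (auto simp: weak_L2_real_def)
  show "f n \<in> L2 M" for n using assms by (auto simp: weak_L2_real_def)
  fix \<phi> :: "'x \<Rightarrow> real" assume \<phi>: "\<phi> \<in> L2 M"
  have h: "h \<in> L2 M" using assms by (auto simp: weak_L2_real_def)
  have "(\<integral>x. h x * \<phi> x \<partial>M) = (\<integral>x. k x * \<phi> x \<partial>M)"
    using assms(2) L2_mult_integrable[OF h \<phi>] L2_mult_integrable[OF k \<phi>] by (intro integral_cong_AE) auto
  moreover have "(\<lambda>n. \<integral>x. f n x * \<phi> x \<partial>M) \<longlonglongrightarrow> (\<integral>x. h x * \<phi> x \<partial>M)"
    using assms(1) \<phi> by (auto simp: weak_L2_real_def)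
  ultimately show "(\<lambda>n. \<integral>x. f n x * \<phi> x \<partial>M) \<longlonglongrightarrow> (\<integral>x. k x * \<phi> x \<partial>M)" by simp
qed

lemma L2_orthogonal_AE_zero:
  fixes f :: "'x \<Rightarrow> real"
  assumes f: "f \<in> L2 M" and "(\<integral>x. f x * f x \<partial>M) = 0"
  shows "AE x in M. f x = 0"
proof -
  have "AE x in M. f x * f x = 0"
    using L2_mult_integrable[OF f f] assms(2) by (subst (asm) integral_nonneg_eq_0_iff_AE) auto
  then show ?thesis by eventually_elim simp
qed

end

section \<open>Reflexive spaces\<close>

lemma reflexiveD:
  fixes \<Phi> :: "('v::real_normed_vector \<Rightarrow>\<^sub>L real) \<Rightarrow>\<^sub>L real"
  assumes "reflexive TYPE('v)"
  obtains x :: 'v where "\<And>l. blinfun_apply \<Phi> l = blinfun_apply l x"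
  using assms unfolding reflexive_def by blast

lemma functional_bound_closure:
  fixes q :: "'v::real_normed_vector \<Rightarrow>\<^sub>L real"
  assumes "\<And>u. u \<in> Q \<Longrightarrow> \<bar>blinfun_apply q u\<bar> \<le> b * norm u" "u \<in> closure Q"
  shows "\<bar>blinfun_apply q u\<bar> \<le> b * norm u"
proof -
  have "closed {u. \<bar>blinfun_apply q u\<bar> \<le> b * norm u}"
    by (intro closed_Collect_le continuous_intros)
  then have "closure Q \<subseteq> {u. \<bar>blinfun_apply q u\<bar> \<le> b * norm u}" using assms(1) by (intro closure_minimal) auto
  then show ?thesis using assms(2) by auto
qed

lemma closure_annihilator:
  fixes x :: "'v::real_normed_vector"
  assumes Q: "rational_subspace Q"
    and ann: "\<And>f :: 'v \<Rightarrow>\<^sub>L real. (\<forall>u\<in>Q. blinfun_apply f u = 0) \<Longrightarrow> blinfun_apply f x = 0"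
  shows "x \<in> closure Q"
proof (rule ccontr)
  assume "x \<notin> closure Q"
  obtain F :: "'v \<Rightarrow>\<^sub>L real"
    where F: "\<And>y. y \<in> closure Q \<Longrightarrow> blinfun_apply F y = 0" "blinfun_apply F x \<noteq> 0"
    using separating_functional[OF subspace_closure_rational_subspace[OF Q] closed_closure \<open>x \<notin> closure Q\<close>] by metis
  have "\<forall>u\<in>Q. blinfun_apply F u = 0" using F(1) closure_subset by auto
  then show False using ann F(2) by blast
qed

text \<open>At \<open>u = 0\<close> the quotient is \<open>0 / 0 = 0\<close>.\<close>

definition restricted_norm :: "'v::real_normed_vector set \<Rightarrow> ('v \<Rightarrow>\<^sub>L real) \<Rightarrow> real" where
  "restricted_norm Q q = (SUP u\<in>Q. \<bar>blinfun_apply q u\<bar> / norm u)"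

lemma restricted_norm_le:
  assumes "Q \<noteq> {}" "0 \<le> b" "\<And>u. u \<in> Q \<Longrightarrow> \<bar>blinfun_apply q u\<bar> \<le> b * norm u"
  shows "restricted_norm Q q \<le> b"
  unfolding restricted_norm_def
proof (rule cSUP_least[OF assms(1)])
  show "\<bar>blinfun_apply q u\<bar> / norm u \<le> b" if "u \<in> Q" for u
    using assms(2) assms(3)[OF that] by (cases "u = 0") (auto simp: pos_divide_le_eq)
qed

lemma restricted_norm_bound:
  assumes "u \<in> closure Q"
  shows "\<bar>blinfun_apply q u\<bar> \<le> restricted_norm Q q * norm u"
proof (rule functional_bound_closure[OF _ assms])
  fix u assume u: "u \<in> Q"
  have "\<bar>blinfun_apply q u\<bar> / norm u \<le> norm q" for u
    using norm_blinfun[of q u] by (cases "u = 0") (auto simp: pos_divide_le_eq)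
  then have "\<bar>blinfun_apply q u\<bar> / norm u \<le> restricted_norm Q q"
    unfolding restricted_norm_def by (intro cSUP_upper[OF u] bdd_aboveI2)
  then show "\<bar>blinfun_apply q u\<bar> \<le> restricted_norm Q q * norm u"
    by (cases "u = 0") (auto simp: pos_divide_le_eq)
qed

text \<open>Helly's theorem in a closed subspace. Let \<open>N\<close> be the annihilator of
  \<open>Q\<close>. Setting the functional to \<open>h\<close> on \<open>F\<close> and to 0 on
  \<open>N\<close> is dominated by \<open>c * norm\<close>, because adding an element of
  \<open>N\<close> does not change the restriction to \<open>Q\<close>. Hahn-Banach on the dual
  gives an element of the bidual, reflexivity a point; vanishing on \<open>N\<close> puts that point
  into \<open>closure Q\<close>.\<close>

lemma reflexive_interpolation:
  fixes h :: "('v::real_normed_vector \<Rightarrow>\<^sub>L real) \<Rightarrow> real"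
  assumes refl: "reflexive TYPE('v)" and Q: "rational_subspace Q" and F: "rational_subspace F"
    and add: "\<And>f g. f \<in> F \<Longrightarrow> g \<in> F \<Longrightarrow> h (f + g) = h f + h g"
    and scale: "\<And>f r. f \<in> F \<Longrightarrow> r \<in> \<rat> \<Longrightarrow> h (r *\<^sub>R f) = r * h f"
    and bound: "\<And>f. f \<in> F \<Longrightarrow> h f \<le> c * restricted_norm Q f" and c: "0 \<le> c"
  shows "\<exists>x\<in>closure Q. norm x \<le> c \<and> (\<forall>f\<in>F. blinfun_apply f x = h f)"
proof -
  have Q0: "Q \<noteq> {}" using rational_subspaceD(1)[OF Q] by auto
  define N where "N = {f :: 'v \<Rightarrow>\<^sub>L real. \<forall>u\<in>Q. blinfun_apply f u = 0}"
  have N: "rational_subspace N" by (auto simp: N_def rational_subspace_def blinfun.add_left blinfun.scaleR_left)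
  have h0: "h 0 = 0" using scale[OF rational_subspaceD(1)[OF F], of 0] by simp
  have N0: "0 \<in> N" by (simp add: N_def)
  define G where "G = (\<lambda>(x, y). x + y) ` ((\<lambda>q. (q, h q)) ` F \<times> (N \<times> {0}))"
  have GI: "(q + f, h q) \<in> G" if "q \<in> F" "f \<in> N" for q f
    unfolding G_def by (rule image_eqI[of _ _ "((q, h q), (f, 0))"]) (use that in auto)
  have "rational_subspace (N \<times> {0 :: real})"
    using N by (auto simp: rational_subspace_def zero_prod_def)
  then have G: "rational_subspace G" unfolding G_def
    by (intro rational_subspace_plus rational_subspace_graph F) (auto simp: add scale)
  have "h q \<le> c * norm (q + f)" if "q \<in> F" "f \<in> N" for q f
  proof -
    have "\<bar>blinfun_apply q u\<bar> \<le> norm (q + f) * norm u" if "u \<in> Q" for u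
      using norm_blinfun[of "q + f" u] that \<open>f \<in> N\<close> by (simp add: N_def blinfun.add_left)
    then have "restricted_norm Q q \<le> norm (q + f)" by (intro restricted_norm_le Q0) auto
    then show ?thesis using bound[OF \<open>q \<in> F\<close>] c by (meson mult_left_mono order_trans)
  qed
  then have "a \<le> c * norm f" if "(f, a) \<in> G" for f a using that by (auto simp: G_def)
  from hahn_banach_rational[OF G this c] obtain \<Phi> where \<Phi>: "norm \<Phi> \<le> c" "\<And>f a. (f, a) \<in> G \<Longrightarrow> blinfun_apply \<Phi> f = a"
    by blast
  obtain x where x: "\<And>f. blinfun_apply \<Phi> f = blinfun_apply f x" using reflexiveD[OF refl] by blast
  have \<Phi>G: "blinfun_apply (q + f) x = h q" if "q \<in> F" "f \<in> N" for q f
    using \<Phi>(2)[OF GI[OF that]] x by simp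
  show ?thesis
  proof (intro bexI conjI ballI)
    show "x \<in> closure Q"
      by (rule closure_annihilator[OF Q]) (use \<Phi>G[OF rational_subspaceD(1)[OF F]] h0 in \<open>auto simp: N_def\<close>)
    show "blinfun_apply f x = h f" if "f \<in> F" for f using \<Phi>G[OF that N0] by simp
    obtain f where f: "norm f \<le> 1" "blinfun_apply f x = norm x" by (rule norming_functional)
    have "norm x \<le> norm \<Phi> * norm f" using norm_blinfun[of \<Phi> f] x f by simp
    also have "\<dots> \<le> c * 1" using \<Phi>(1) f(1) c by (intro mult_mono) auto
    finally show "norm x \<le> c" by simp
  qed
qed

text \<open>\<open>F\<close> is the rational span of norming functionals for the points of
  \<open>Q\<close>. If \<open>F\<close> plus the annihilator of \<open>Q\<close> were not dense in
  the dual, some nonzero element of the bidual would vanish on it. By reflexivity it is evaluation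
  at a point: the annihilator puts this point into \<open>closure Q\<close>, and the norming
  functionals make it zero.\<close>

lemma reflexive_separable_dual:
  fixes Q :: "'v::real_normed_vector set"
  assumes refl: "reflexive TYPE('v)" and Q: "rational_subspace Q" "countable Q"
  obtains F :: "('v \<Rightarrow>\<^sub>L real) set" where "countable F" "rational_subspace F"
    "\<And>f e. 0 < e \<Longrightarrow> \<exists>q\<in>F. \<forall>u\<in>closure Q. \<bar>blinfun_apply f u - blinfun_apply q u\<bar> \<le> e * norm u"
    "\<And>y e. y \<in> closure Q \<Longrightarrow> 0 < e \<Longrightarrow> \<exists>q\<in>F. norm q \<le> 1 \<and> norm y - e \<le> blinfun_apply q y"
proof -
  have "\<exists>f :: 'v \<Rightarrow>\<^sub>L real. norm f \<le> 1 \<and> blinfun_apply f u = norm u" for u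
    using norming_functional by metis
  then obtain \<nu> :: "'v \<Rightarrow> 'v \<Rightarrow>\<^sub>L real" where \<nu>: "\<And>u. norm (\<nu> u) \<le> 1" "\<And>u. blinfun_apply (\<nu> u) u = norm u" by metis
  obtain F where F: "countable F" "\<nu> ` Q \<subseteq> F" "rational_subspace F"
    using countable_rational_span[OF countable_image[OF Q(2)]] by blast
  have norming: "\<exists>u\<in>Q. norm y - e \<le> blinfun_apply (\<nu> u) y" if y: "y \<in> closure Q" and e: "0 < e" for y e
  proof -
    have "0 < e / 2" using e by simp
    then obtain u where u: "u \<in> Q" "norm (y - u) < e / 2"
      using y unfolding closure_approachable by (metis dist_norm norm_minus_commute)
    have "\<bar>blinfun_apply (\<nu> u) (y - u)\<bar> \<le> 1 * norm (y - u)"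
      using norm_blinfun[of "\<nu> u" "y - u"] mult_right_mono[OF \<nu>(1)[of u] norm_ge_zero[of "y - u"]] by simp
    moreover have "norm y \<le> norm u + norm (y - u)" using norm_triangle_sub[of y u] .
    ultimately have "norm y - e \<le> blinfun_apply (\<nu> u) y" using u \<nu>(2)[of u] by (simp add: blinfun.diff_right)
    then show ?thesis using u by blast
  qed
  define N where "N = {f :: 'v \<Rightarrow>\<^sub>L real. \<forall>u\<in>Q. blinfun_apply f u = 0}"
  define G where "G = (\<lambda>(q, f). q + f) ` (F \<times> N)"
  have N0: "0 \<in> N" by (simp add: N_def)
  have GI: "q + f \<in> G" if "q \<in> F" "f \<in> N" for q f using that by (auto simp: G_def)
  have N: "rational_subspace N" by (auto simp: N_def rational_subspace_def blinfun.add_left blinfun.scaleR_left)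
  have "rational_subspace G" unfolding G_def by (rule rational_subspace_plus[OF F(3) N])
  then have sub: "subspace (closure G)" by (rule subspace_closure_rational_subspace)
  have dense: "f \<in> closure G" for f
  proof (rule ccontr)
    assume "f \<notin> closure G"
    then obtain \<Phi> :: "('v \<Rightarrow>\<^sub>L real) \<Rightarrow>\<^sub>L real" where
      \<Phi>: "\<And>g. g \<in> closure G \<Longrightarrow> blinfun_apply \<Phi> g = 0" "blinfun_apply \<Phi> f \<noteq> 0"
      using separating_functional[OF sub closed_closure] by metis
    obtain x where x: "\<And>l. blinfun_apply \<Phi> l = blinfun_apply l x" using reflexiveD[OF refl] by blast
    have Gx: "blinfun_apply g x = 0" if "g \<in> G" for g using \<Phi>(1)[of g] that closure_subset x by fastforce
    have "x \<in> closure Q"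
      by (rule closure_annihilator[OF Q(1)]) (use Gx[OF GI[OF rational_subspaceD(1)[OF F(3)]]] in \<open>auto simp: N_def\<close>)
    have "norm x \<le> 0 + e" if e: "0 < e" for e
    proof -
      obtain u where "u \<in> Q" "norm x - e \<le> blinfun_apply (\<nu> u) x" using norming[OF \<open>x \<in> closure Q\<close> e] by blast
      then show ?thesis using Gx[of "\<nu> u"] GI[of "\<nu> u" 0] F(2) N0 by auto
    qed
    then have "norm x \<le> 0" by (rule field_le_epsilon)
    then show False using \<Phi>(2) x by simp
  qed
  show ?thesis
  proof
    show "countable F" "rational_subspace F" by (rule F)+
    show "\<exists>q\<in>F. \<forall>u\<in>closure Q. \<bar>blinfun_apply f u - blinfun_apply q u\<bar> \<le> e * norm u" if e: "0 < e" for f e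
    proof -
      obtain g where g: "g \<in> G" "norm (f - g) < e"
        using dense[of f] e unfolding closure_approachable by (metis dist_norm norm_minus_commute)
      then obtain q k where qk: "q \<in> F" "k \<in> N" "g = q + k" by (auto simp: G_def)
      have "\<bar>blinfun_apply (f - q) u\<bar> \<le> e * norm u" if "u \<in> closure Q" for u
      proof (rule functional_bound_closure[OF _ that])
        fix u assume "u \<in> Q"
        then have "blinfun_apply (f - q) u = blinfun_apply (f - g) u" using qk by (simp add: N_def blinfun.diff_left blinfun.add_left)
        then show "\<bar>blinfun_apply (f - q) u\<bar> \<le> e * norm u"
          using norm_blinfun[of "f - g" u] mult_right_mono[OF less_imp_le[OF g(2)] norm_ge_zero[of u]] by simp
      qed
      then show ?thesis using qk(1) by (auto simp: blinfun.diff_left)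
    qed
    show "\<exists>q\<in>F. norm q \<le> 1 \<and> norm y - e \<le> blinfun_apply q y" if "y \<in> closure Q" "0 < e" for y e
      using norming[OF that] \<nu>(1) F(2) by blast
  qed
qed

section \<open>Weak sequential compactness of Bochner spaces\<close>

text \<open>A running minimiser: \<open>J k\<close> changes to \<open>Suc k\<close> only on the
  measurable set where the new value is strictly smaller, so it takes finitely many values.\<close>

lemma measurable_argmin:
  fixes d :: "nat \<Rightarrow> 'x \<Rightarrow> real"
  assumes d: "\<And>j. d j \<in> borel_measurable M"
  shows "\<exists>J :: nat \<Rightarrow> 'x \<Rightarrow> nat. (\<forall>k. simple_function M (J k)) \<and>
    (\<forall>k x. \<forall>j\<le>k. d (J k x) x \<le> d j x)"
proof -
  define J where "J = rec_nat (\<lambda>x. 0) (\<lambda>k j x. if d (Suc k) x < d (j x) x then Suc k else j x)"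
  have J0: "J 0 = (\<lambda>x. 0)" by (simp add: J_def)
  have JS: "J (Suc k) = (\<lambda>x. if d (Suc k) x < d (J k x) x then Suc k else J k x)" for k
    unfolding J_def by simp
  have sf: "simple_function M (J k)" for k
  proof (induction k)
    case 0 then show ?case by (simp add: J0)
  next
    case (Suc k)
    have [measurable]: "J k \<in> measurable M (count_space UNIV)"
      using Suc by (rule measurable_simple_function)
    note d [measurable]
    have "(\<lambda>x. d (J k x) x) \<in> borel_measurable M" by (rule measurable_compose_countable) measurable
    then have "{x \<in> space M. d (Suc k) x < d (J k x) x} \<in> sets M" by measurable
    then show ?case unfolding JS by (intro simple_function_If simple_function_const Suc)
  qed
  have le: "d (J k x) x \<le> d j x" if "j \<le> k" for j k x
    using that
  proof (induction k)
    case 0 then show ?case by (simp add: J0)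
  next
    case (Suc k)
    show ?case
    proof (cases "j = Suc k")
      case True then show ?thesis by (simp add: JS)
    next
      case False
      then have "d (J k x) x \<le> d j x" using Suc by simp
      then show ?thesis by (auto simp: JS)
    qed
  qed
  show ?thesis using sf le by (intro exI[of _ J] conjI) simp_all
qed

text \<open>An elementary measurable selection. Candidate 0 always takes part in the minimum, which
  supplies the majorant \<open>d 0 x\<close> for dominated convergence.\<close>

lemma measurable_nearest_index:
  fixes d :: "nat \<Rightarrow> 'x \<Rightarrow> real"
  assumes d: "\<And>j. d j \<in> borel_measurable M" and nonneg: "AE x in M. \<forall>j. 0 \<le> d j x"
    and dense: "AE x in M. \<forall>e>0. \<exists>j. d j x < e"
  shows "\<exists>J :: nat \<Rightarrow> 'x \<Rightarrow> nat. (\<forall>k. simple_function M (J k)) \<and>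
    (\<forall>k x. d (J k x) x \<le> d 0 x) \<and> (AE x in M. (\<lambda>k. d (J k x) x) \<longlonglongrightarrow> 0)"
proof -
  obtain J :: "nat \<Rightarrow> 'x \<Rightarrow> nat" where J: "\<forall>k. simple_function M (J k)" "\<forall>k x. \<forall>j\<le>k. d (J k x) x \<le> d j x"
    using measurable_argmin[where d = d, OF d] by (elim exE conjE)
  have "AE x in M. (\<lambda>k. d (J k x) x) \<longlonglongrightarrow> 0"
    using nonneg dense
  proof eventually_elim
    case (elim x)
    show ?case
    proof (rule LIMSEQ_I)
      fix e :: real assume "0 < e"
      then obtain j where "d j x < e" using elim by blast
      then have "norm (d (J k x) x - 0) < e" if "k \<ge> j" for k
        using J(2) that elim(1) order.strict_trans1[OF _ \<open>d j x < e\<close>] by (simp add: abs_of_nonneg)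
      then show "\<exists>no. \<forall>k\<ge>no. norm (d (J k x) x - 0) < e" by blast
    qed
  qed
  then show ?thesis using J by (intro exI[of _ J] conjI) simp_all
qed

text \<open>Take the point nearest to \<open>w x\<close> among the first candidates; since
  \<open>u 0 = 0\<close> is one of them, the error never exceeds \<open>norm (w x)\<close>.\<close>

lemma simple_approximation:
  fixes w :: "'x \<Rightarrow> 'b::real_normed_vector" and u :: "nat \<Rightarrow> 'b"
  assumes meas: "\<And>j. (\<lambda>x. norm (w x - u j)) \<in> borel_measurable M"
    and w: "AE x in M. w x \<in> closure (range u)" and u0: "u 0 = 0"
  shows "\<exists>J :: nat \<Rightarrow> 'x \<Rightarrow> nat. (\<forall>k. simple_function M (J k)) \<and>
    (\<forall>k x. norm (w x - u (J k x)) \<le> norm (w x)) \<and> (AE x in M. (\<lambda>k. u (J k x)) \<longlonglongrightarrow> w x)"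
proof -
  have dense: "AE x in M. \<forall>e>0. \<exists>j. norm (w x - u j) < e"
    using w by eventually_elim (auto simp: closure_approachable dist_norm norm_minus_commute)
  have nn: "AE x in M. \<forall>j. 0 \<le> norm (w x - u j)" by simp
  obtain J where J: "\<forall>k. simple_function M (J k)" "\<forall>k x. norm (w x - u (J k x)) \<le> norm (w x - u 0)"
     "AE x in M. (\<lambda>k. norm (w x - u (J k x))) \<longlonglongrightarrow> 0"
    using measurable_nearest_index[OF meas nn dense] by (elim exE conjE)
  have "AE x in M. (\<lambda>k. u (J k x)) \<longlonglongrightarrow> w x"
    using J(3)
  proof (rule eventually_mono)
    fix x assume "(\<lambda>k. norm (w x - u (J k x))) \<longlonglongrightarrow> 0"
    then have "(\<lambda>k. w x - u (J k x)) \<longlonglongrightarrow> 0" by (rule tendsto_norm_zero_cancel)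
    from tendsto_diff[OF tendsto_const[of "w x"] this] show "(\<lambda>k. u (J k x)) \<longlonglongrightarrow> w x" by simp
  qed
  then show ?thesis using J u0 by (intro exI[of _ J] conjI) simp_all
qed

context complete_finite_measure
begin

lemma L2_simple_approximation:
  fixes w :: "'x \<Rightarrow> 'b::real_normed_vector" and u :: "nat \<Rightarrow> 'b"
  assumes w: "w \<in> L2 M" "AE x in M. w x \<in> closure (range u)" and u0: "u 0 = 0"
  shows "\<exists>J :: nat \<Rightarrow> 'x \<Rightarrow> nat. (\<forall>k. simple_function M (J k)) \<and>
    (\<lambda>k. L2_norm M (\<lambda>x. u (J k x) - w x)) \<longlonglongrightarrow> 0"
proof -
  have meas: "(\<lambda>x. norm (w x - u j)) \<in> borel_measurable M" for j
    by (rule L2D(3)[OF L2_diff(1)[OF w(1) L2_const]])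
  obtain J where J: "\<forall>k. simple_function M (J k)"
    "\<forall>k x. norm (w x - u (J k x)) \<le> norm (w x)" "AE x in M. (\<lambda>k. u (J k x)) \<longlonglongrightarrow> w x"
    using simple_approximation[OF meas w(2) u0] by (elim exE conjE)
  have "(\<lambda>k. L2_norm M (\<lambda>x. u (J k x) - w x)) \<longlonglongrightarrow> 0"
  proof (rule L2_dominated_LIMSEQ[OF w(1) _ w(1) J(3)])
    show "(\<lambda>x. u (J k x)) \<in> L2 M" for k by (intro L2_simple simple_function_compose1[OF J(1)[rule_format]])
    show "AE x in M. norm (u (J k x) - w x) \<le> norm (w x)" for k using J(2) by (simp add: norm_minus_commute)
  qed
  then show ?thesis using J by (intro exI[of _ J] conjI) simp_all
qed

lemma L2_blinfun:
  fixes q :: "'b::real_normed_vector \<Rightarrow>\<^sub>L real"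
  assumes w: "w \<in> L2 M"
  shows "(\<lambda>x. blinfun_apply q (w x)) \<in> L2 M" "L2_norm M (\<lambda>x. blinfun_apply q (w x)) \<le> norm q * L2_norm M w"
proof -
  have "strongly_measurable M (\<lambda>x. blinfun_apply q (w x))"
    using strongly_measurable_compose[OF L2D(1)[OF w] L2D(1)[OF w], of "\<lambda>a b. blinfun_apply q a"]
    by (simp add: blinfun.tendsto)
  moreover have "norm (blinfun_apply q (w x)) \<le> norm (norm q *\<^sub>R w x)" for x
    using norm_blinfun[of q "w x"] by simp
  ultimately show "(\<lambda>x. blinfun_apply q (w x)) \<in> L2 M" "L2_norm M (\<lambda>x. blinfun_apply q (w x)) \<le> norm q * L2_norm M w"
    using L2_dominated[of "\<lambda>x. blinfun_apply q (w x)" "\<lambda>x. norm q *\<^sub>R w x"] L2_scale[OF w] L2_norm_scale[of "norm q" w] by auto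
qed

lemma L2_functional_test:
  fixes q :: "'b::real_normed_vector \<Rightarrow>\<^sub>L real"
  assumes \<phi>: "\<phi> \<in> L2 M"
  shows "L2_functional M (\<lambda>w. \<integral>x. blinfun_apply q (w x) * \<phi> x \<partial>M)"
  unfolding L2_functional_def
proof (intro conjI ballI allI exI[of _ "norm q * L2_norm M \<phi>"])
  fix f g :: "'x \<Rightarrow> 'b" assume f: "f \<in> L2 M"
  note int = L2_mult_integrable[OF L2_blinfun(1) \<phi>, of _ q]
  show "(\<integral>x. blinfun_apply q (f x + g x) * \<phi> x \<partial>M) = (\<integral>x. blinfun_apply q (f x) * \<phi> x \<partial>M) + (\<integral>x. blinfun_apply q (g x) * \<phi> x \<partial>M)"
    if "g \<in> L2 M" using int[OF f] int[OF that] by (simp add: blinfun.add_right distrib_right)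
  show "(\<integral>x. blinfun_apply q (c *\<^sub>R f x) * \<phi> x \<partial>M) = c * (\<integral>x. blinfun_apply q (f x) * \<phi> x \<partial>M)" for c
    using int[OF f] by (simp add: blinfun.scaleR_right mult.assoc)
  have "\<bar>\<integral>x. blinfun_apply q (f x) * \<phi> x \<partial>M\<bar> \<le> L2_norm M (\<lambda>x. blinfun_apply q (f x)) * L2_norm M \<phi>"
    by (rule Cauchy_Schwarz_L2[OF L2_blinfun(1)[OF f] \<phi>])
  also have "\<dots> \<le> (norm q * L2_norm M f) * L2_norm M \<phi>"
    by (intro mult_right_mono L2_blinfun(2) f) simp
  finally show "\<bar>\<integral>x. blinfun_apply q (f x) * \<phi> x \<partial>M\<bar> \<le> norm q * L2_norm M \<phi> * L2_norm M f" by (simp add: mult_ac)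
qed

lemma L2_functional_finite_sum:
  assumes "finite K" "\<And>k. k \<in> K \<Longrightarrow> L2_functional M (l k :: ('x \<Rightarrow> 'b::real_normed_vector) \<Rightarrow> real)"
  shows "L2_functional M (\<lambda>w. \<Sum>k\<in>K. l k w)"
  unfolding L2_functional_def
proof (intro conjI ballI allI)
  show "(\<Sum>k\<in>K. l k (\<lambda>x. f x + g x)) = (\<Sum>k\<in>K. l k f) + (\<Sum>k\<in>K. l k g)" if "f \<in> L2 M" "g \<in> L2 M" for f g
    using that L2_functionalD(1)[OF assms(2)] by (simp add: sum.distrib)
  show "(\<Sum>k\<in>K. l k (\<lambda>x. c *\<^sub>R f x)) = c * (\<Sum>k\<in>K. l k f)" if "f \<in> L2 M" for c f
    using that L2_functionalD(2)[OF assms(2)] by (simp add: sum_distrib_left)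
  have "\<forall>k\<in>K. \<exists>B\<ge>0. \<forall>f\<in>L2 M. \<bar>l k f\<bar> \<le> B * L2_norm M f" using L2_functionalD(4)[OF assms(2)] by blast
  then obtain B where B: "\<And>k f. k \<in> K \<Longrightarrow> f \<in> L2 M \<Longrightarrow> \<bar>l k f\<bar> \<le> B k * L2_norm M f" by metis
  have "\<bar>\<Sum>k\<in>K. l k f\<bar> \<le> (\<Sum>k\<in>K. B k) * L2_norm M f" if "f \<in> L2 M" for f
    using order_trans[OF sum_abs sum_mono[OF B[OF _ that]]] by (simp add: sum_distrib_right)
  then show "\<exists>B. \<forall>f\<in>L2 M. \<bar>\<Sum>k\<in>K. l k f\<bar> \<le> B * L2_norm M f" by blast
qed

text \<open>This is the integral of \<open>q (J x)\<close> applied to \<open>w x\<close>, the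
  pairing with a simple dual-valued function. The sum over level sets exhibits it as finitely many
  scalar tests, so weak limits can be taken term by term.\<close>

definition simple_functional :: "(nat \<Rightarrow> 'b::real_normed_vector \<Rightarrow>\<^sub>L real) \<Rightarrow> ('x \<Rightarrow> nat) \<Rightarrow> ('x \<Rightarrow> 'b) \<Rightarrow> real" where
  "simple_functional q J w = (\<Sum>k\<in>J ` space M. \<integral>x. blinfun_apply (q k) (w x) * indicator (J -` {k} \<inter> space M) x \<partial>M)"

lemma simple_function_level_indicator:
  assumes "simple_function M J"
  shows "(indicator (J -` {k} \<inter> space M) :: 'x \<Rightarrow> real) \<in> L2 M"
proof -
  have "J -` {k} \<inter> space M \<in> sets M" using assms by (rule simple_functionD)
  then show ?thesis by (intro L2_simple simple_function_indicator)
qed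

lemma simple_functional_L2:
  assumes "simple_function M J"
  shows "L2_functional M (simple_functional q J)"
  unfolding simple_functional_def[abs_def] using simple_functionD(1)[OF assms]
  by (intro L2_functional_finite_sum L2_functional_test simple_function_level_indicator assms)

lemma simple_level_sum:
  fixes g :: "nat \<Rightarrow> 'c::real_vector"
  assumes "simple_function M J" "x \<in> space M"
  shows "(\<Sum>k\<in>J ` space M. indicator (J -` {k} \<inter> space M) x *\<^sub>R g k) = g (J x)"
proof -
  have "(\<Sum>k\<in>J ` space M. indicator (J -` {k} \<inter> space M) x *\<^sub>R g k) = (\<Sum>k\<in>J ` space M. if k = J x then g k else 0)"
    using assms by (intro sum.cong) (auto simp: indicator_def)
  then show ?thesis using assms simple_functionD(1)[OF assms(1)] by (simp add: sum.delta)
qed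

lemma simple_functional_integral:
  assumes J: "simple_function M J" and w: "w \<in> L2 M"
  shows "simple_functional q J w = (\<integral>x. blinfun_apply (q (J x)) (w x) \<partial>M)"
    "integrable M (\<lambda>x. blinfun_apply (q (J x)) (w x))"
proof -
  have int: "integrable M (\<lambda>x. blinfun_apply (q k) (w x) * indicator (J -` {k} \<inter> space M) x)" for k
    by (rule L2_mult_integrable[OF L2_blinfun(1)[OF w] simple_function_level_indicator[OF J]])
  have eq: "(\<Sum>k\<in>J ` space M. blinfun_apply (q k) (w x) * indicator (J -` {k} \<inter> space M) x) = blinfun_apply (q (J x)) (w x)"
    if "x \<in> space M" for x
    using simple_level_sum[OF J that, of "\<lambda>k. blinfun_apply (q k) (w x)"] by (simp add: mult.commute)
  have "simple_functional q J w = (\<integral>x. (\<Sum>k\<in>J ` space M. blinfun_apply (q k) (w x) * indicator (J -` {k} \<inter> space M) x) \<partial>M)"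
    unfolding simple_functional_def by (intro Bochner_Integration.integral_sum[symmetric] int)
  also have "\<dots> = (\<integral>x. blinfun_apply (q (J x)) (w x) \<partial>M)" by (intro Bochner_Integration.integral_cong eq) simp_all
  finally show "simple_functional q J w = (\<integral>x. blinfun_apply (q (J x)) (w x) \<partial>M)" .
  have "integrable M (\<lambda>x. (\<Sum>k\<in>J ` space M. blinfun_apply (q k) (w x) * indicator (J -` {k} \<inter> space M) x))"
    by (intro Bochner_Integration.integrable_sum int)
  then show "integrable M (\<lambda>x. blinfun_apply (q (J x)) (w x))" by (subst Bochner_Integration.integrable_cong[OF refl eq[symmetric]]) auto
qed

lemma simple_functional_tendsto:
  assumes J: "simple_function M J" and v: "\<And>n. v n \<in> L2 M" "w \<in> L2 M"
    and weak: "\<And>k. weak_L2_real (\<lambda>n x. blinfun_apply (q k) (v n x)) (\<lambda>x. blinfun_apply (q k) (w x))"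
  shows "(\<lambda>n. simple_functional q J (v n)) \<longlonglongrightarrow> simple_functional q J w"
  unfolding simple_functional_def
  by (intro tendsto_sum) (use weak simple_function_level_indicator[OF J] in \<open>auto simp: weak_L2_real_def\<close>)

end

section \<open>Approximation of functionals on Bochner spaces by simple dual-valued
  functions\<close>

lemma integral_norm_bound_AE:
  fixes f :: "'z \<Rightarrow> 'c::{banach, second_countable_topology}"
  assumes f: "integrable N f" and g: "integrable N g" and le: "AE x in N. norm (f x) \<le> g x"
  shows "norm (\<integral>x. f x \<partial>N) \<le> (\<integral>x. g x \<partial>N)"
  using order_trans[OF integral_norm_bound integral_mono_AE[OF integrable_norm[OF f] g le]] .

text \<open>The upper bound excludes infinity, and any one of the lower bounds excludes minus
  infinity.\<close>

lemma real_of_ereal_between: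
  assumes "s \<le> ereal c" "\<And>j. ereal (f j) \<le> s"
  shows "real_of_ereal s \<le> c \<and> (\<forall>j. f j \<le> real_of_ereal s)"
  using assms(1) assms(2)[of undefined] assms(2) by (cases s) auto

context complete_finite_measure
begin

text \<open>
  Functionals on \<open>L\<^sup>2\<close> of a reflexive space come from square-integrable functions with values in
  the dual, here approximated by simple functions.
\<close>

lemma L2_functional_components:
  fixes u :: "nat \<Rightarrow> 'b::real_normed_vector"
  assumes l: "L2_functional M l"
  shows "\<exists>\<mu> :: nat \<Rightarrow> 'x \<Rightarrow> real. (\<forall>j. \<mu> j \<in> L2 M) \<and>
    (\<forall>j. \<forall>\<phi>\<in>L2 M. l (\<lambda>x. \<phi> x *\<^sub>R u j) = (\<integral>x. \<mu> j x * \<phi> x \<partial>M)) \<and>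
    (\<forall>i j k a b. u k = a *\<^sub>R u i + b *\<^sub>R u j \<longrightarrow> (AE x in M. \<mu> k x = a * \<mu> i x + b * \<mu> j x))"
proof -
  obtain B where B: "B \<ge> 0" "\<And>f. f \<in> L2 M \<Longrightarrow> \<bar>l f\<bar> \<le> B * L2_norm M f" using L2_functionalD(4)[OF l] by blast
  have "\<exists>\<mu>. \<mu> \<in> L2 M \<and> (\<forall>\<phi>\<in>L2 M. l (\<lambda>x. \<phi> x *\<^sub>R u j) = (\<integral>x. \<mu> x * \<phi> x \<partial>M))" for j
  proof -
    have "L2_functional M (\<lambda>\<phi>. l (\<lambda>x. \<phi> x *\<^sub>R u j))" unfolding L2_functional_def
    proof (intro conjI ballI allI exI[of _ "B * norm (u j)"])
      fix f g :: "'x \<Rightarrow> real" assume f: "f \<in> L2 M"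
      show "l (\<lambda>x. (f x + g x) *\<^sub>R u j) = l (\<lambda>x. f x *\<^sub>R u j) + l (\<lambda>x. g x *\<^sub>R u j)" if "g \<in> L2 M"
        using L2_functionalD(1)[OF l L2_scaleR_const(1)[OF f] L2_scaleR_const(1)[OF that]] by (simp add: scaleR_add_left)
      show "l (\<lambda>x. (c *\<^sub>R f x) *\<^sub>R u j) = c * l (\<lambda>x. f x *\<^sub>R u j)" for c
        using L2_functionalD(2)[OF l L2_scaleR_const(1)[OF f], of c] by simp
      show "\<bar>l (\<lambda>x. f x *\<^sub>R u j)\<bar> \<le> B * norm (u j) * L2_norm M f"
        using B(2)[OF L2_scaleR_const(1)[OF f], of "u j"] L2_scaleR_const(2)[OF f, of "u j"] by (simp add: mult_ac)
    qed
    from L2_real_functional_Riesz[OF this] show ?thesis by metis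
  qed
  then obtain \<mu> :: "nat \<Rightarrow> 'x \<Rightarrow> real" where \<mu>: "\<And>j. \<mu> j \<in> L2 M"
    "\<And>j \<phi>. \<phi> \<in> L2 M \<Longrightarrow> l (\<lambda>x. \<phi> x *\<^sub>R u j) = (\<integral>x. \<mu> j x * \<phi> x \<partial>M)" by metis
  have "AE x in M. \<mu> k x = a * \<mu> i x + b * \<mu> j x" if u: "u k = a *\<^sub>R u i + b *\<^sub>R u j" for i j k a b
  proof -
    \<comment> \<open>The defect of the linear relation serves as its own test function: linearity
      of \<open>l\<close> then says that its square integrates to 0.\<close>
    define \<phi> where "\<phi> x = \<mu> k x - (a * \<mu> i x + b * \<mu> j x)" for x
    have ab: "(\<lambda>x. a * \<mu> i x + b * \<mu> j x) \<in> L2 M"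
      using L2_add(1)[OF L2_scale[OF \<mu>(1), of a] L2_scale[OF \<mu>(1), of b]] by simp
    have \<phi>: "\<phi> \<in> L2 M" unfolding \<phi>_def[abs_def] by (rule L2_diff(1)[OF \<mu>(1) ab])
    note int = L2_mult_integrable[OF \<mu>(1) \<phi>]
    have "l (\<lambda>x. \<phi> x *\<^sub>R u k) = l (\<lambda>x. a *\<^sub>R (\<phi> x *\<^sub>R u i) + b *\<^sub>R (\<phi> x *\<^sub>R u j))"
      by (simp add: u scaleR_add_right mult.commute)
    also have "\<dots> = a * l (\<lambda>x. \<phi> x *\<^sub>R u i) + b * l (\<lambda>x. \<phi> x *\<^sub>R u j)"
      using L2_functionalD(1)[OF l L2_scale L2_scale, OF L2_scaleR_const(1) L2_scaleR_const(1), OF \<phi> \<phi>]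
        L2_functionalD(2)[OF l L2_scaleR_const(1)[OF \<phi>]] by simp
    finally have eq: "(\<integral>x. \<mu> k x * \<phi> x \<partial>M) = a * (\<integral>x. \<mu> i x * \<phi> x \<partial>M) + b * (\<integral>x. \<mu> j x * \<phi> x \<partial>M)"
      using \<mu>(2)[OF \<phi>] by simp
    have "(\<integral>x. \<phi> x * \<phi> x \<partial>M) = (\<integral>x. \<mu> k x * \<phi> x - (a * (\<mu> i x * \<phi> x) + b * (\<mu> j x * \<phi> x)) \<partial>M)"
      by (intro Bochner_Integration.integral_cong) (auto simp: \<phi>_def algebra_simps)
    also have "\<dots> = 0" using int[of k] int[of i] int[of j] eq by simp
    finally have "AE x in M. \<phi> x = 0" by (rule L2_orthogonal_AE_zero[OF \<phi>])
    then show ?thesis by eventually_elim (simp add: \<phi>_def)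
  qed
  with \<mu> show ?thesis by (intro exI[of _ \<mu>] conjI allI ballI impI)
qed

text \<open>Cutting along the level sets of \<open>J\<close> turns the argument into a finite sum of
  scalar functions times fixed vectors, to which the representation by \<open>\<mu>\<close> applies
  termwise.\<close>

lemma L2_functional_apply_simple:
  fixes u :: "nat \<Rightarrow> 'b::real_normed_vector"
  assumes l: "L2_functional M l" and J: "simple_function M J"
    and \<mu>: "\<And>j. \<mu> j \<in> L2 M" "\<forall>j. \<forall>\<phi>\<in>L2 M. l (\<lambda>x. \<phi> x *\<^sub>R u j) = (\<integral>x. \<mu> j x * \<phi> x \<partial>M)"
    and \<phi>: "\<And>j. (\<lambda>x. indicator (J -` {j} \<inter> space M) x * \<phi> j x) \<in> L2 M"
  shows "l (\<lambda>x. \<phi> (J x) x *\<^sub>R u (J x)) = (\<integral>x. \<mu> (J x) x * \<phi> (J x) x \<partial>M)"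
    "integrable M (\<lambda>x. \<mu> (J x) x * \<phi> (J x) x)" "(\<lambda>x. \<phi> (J x) x *\<^sub>R u (J x)) \<in> L2 M"
proof -
  let ?K = "J ` space M" and ?\<phi> = "\<lambda>j x. indicator (J -` {j} \<inter> space M) x * \<phi> j x"
  have K: "finite ?K" by (rule simple_functionD[OF J])
  have L: "(\<lambda>x. ?\<phi> j x *\<^sub>R u j) \<in> L2 M" for j by (rule L2_scaleR_const(1)[OF \<phi>])
  have sum1: "(\<Sum>j\<in>?K. ?\<phi> j x *\<^sub>R u j) = \<phi> (J x) x *\<^sub>R u (J x)" if "x \<in> space M" for x
    using simple_level_sum[OF J that, of "\<lambda>j. \<phi> j x *\<^sub>R u j"] by simp
  have sum2: "(\<Sum>j\<in>?K. \<mu> j x * ?\<phi> j x) = \<mu> (J x) x * \<phi> (J x) x" if "x \<in> space M" for x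
    using simple_level_sum[OF J that, of "\<lambda>j. \<mu> j x * \<phi> j x"] by (simp add: mult_ac)
  have int: "integrable M (\<lambda>x. \<mu> j x * ?\<phi> j x)" for j by (rule L2_mult_integrable[OF \<mu>(1) \<phi>])
  have S: "(\<lambda>x. \<Sum>j\<in>?K. ?\<phi> j x *\<^sub>R u j) \<in> L2 M" by (rule L2_sum[OF K L])
  have ae: "AE x in M. (\<Sum>j\<in>?K. ?\<phi> j x *\<^sub>R u j) = \<phi> (J x) x *\<^sub>R u (J x)" by (rule AE_I2) (rule sum1)
  show "(\<lambda>x. \<phi> (J x) x *\<^sub>R u (J x)) \<in> L2 M" by (rule L2_AE_cong[OF S ae])
  have "l (\<lambda>x. \<phi> (J x) x *\<^sub>R u (J x)) = l (\<lambda>x. \<Sum>j\<in>?K. ?\<phi> j x *\<^sub>R u j)"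
    by (rule L2_functional_AE_cong[OF l S ae, symmetric])
  also have "\<dots> = (\<Sum>j\<in>?K. l (\<lambda>x. ?\<phi> j x *\<^sub>R u j))" by (rule L2_functional_sum[OF l K L])
  also have "\<dots> = (\<Sum>j\<in>?K. \<integral>x. \<mu> j x * ?\<phi> j x \<partial>M)" by (intro sum.cong refl \<mu>(2)[rule_format] \<phi>)
  also have "\<dots> = (\<integral>x. (\<Sum>j\<in>?K. \<mu> j x * ?\<phi> j x) \<partial>M)" by (intro Bochner_Integration.integral_sum[symmetric] int)
  also have "\<dots> = (\<integral>x. \<mu> (J x) x * \<phi> (J x) x \<partial>M)" by (intro Bochner_Integration.integral_cong sum2 refl)
  finally show "l (\<lambda>x. \<phi> (J x) x *\<^sub>R u (J x)) = (\<integral>x. \<mu> (J x) x * \<phi> (J x) x \<partial>M)" .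
  have "integrable M (\<lambda>x. \<Sum>j\<in>?K. \<mu> j x * ?\<phi> j x)" by (intro Bochner_Integration.integrable_sum int)
  then show "integrable M (\<lambda>x. \<mu> (J x) x * \<phi> (J x) x)"
    by (subst Bochner_Integration.integrable_cong[OF refl sum2[symmetric]])
qed

text \<open>
  Testing \<open>l\<close> on \<open>\<mu>\<^sub>J u\<^sub>J / \<parallel>u\<^sub>J\<parallel>\<^sup>2\<close>, where \<open>J\<close> maximises \<open>\<bar>\<mu>\<^sub>j\<bar> / \<parallel>u\<^sub>j\<parallel>\<close> over \<open>j \<le> N\<close>, bounds the
  \<open>L\<^sup>2\<close> norm of the maximum uniformly in \<open>N\<close>; the dominating function is a weak limit of the maxima.
\<close>

lemma L2_functional_dominated:
  fixes u :: "nat \<Rightarrow> 'b::real_normed_vector"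
  assumes l: "L2_functional M l"
    and \<mu>: "\<And>j. \<mu> j \<in> L2 M" "\<forall>j. \<forall>\<phi>\<in>L2 M. l (\<lambda>x. \<phi> x *\<^sub>R u j) = (\<integral>x. \<mu> j x * \<phi> x \<partial>M)"
  shows "\<exists>\<Lambda>. \<Lambda> \<in> L2 M \<and> (AE x in M. \<forall>j. \<bar>\<mu> j x\<bar> / norm (u j) \<le> \<Lambda> x)"
proof -
  obtain B where B: "B \<ge> 0" "\<And>f. f \<in> L2 M \<Longrightarrow> \<bar>l f\<bar> \<le> B * L2_norm M f" using L2_functionalD(4)[OF l] by blast
  define a where "a j x = \<bar>\<mu> j x\<bar> / norm (u j)" for j x
  have [measurable]: "\<mu> j \<in> borel_measurable M" for j using \<mu>(1) L2_real_iff by blast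
  have a_meas: "(\<lambda>x. - a j x) \<in> borel_measurable M" for j unfolding a_def by measurable
  have aL: "a j \<in> L2 M" for j
    using L2_scale[OF L2D(4)[OF \<mu>(1)], of "inverse (norm (u j))" j] by (simp add: a_def[abs_def] divide_inverse mult.commute)
  obtain J where J: "\<forall>k. simple_function M (J k)" "\<forall>k x. \<forall>j\<le>k. - a (J k x) x \<le> - a j x"
    using measurable_argmin[of "\<lambda>j x. - a j x", OF a_meas] by (elim exE conjE)
  define m where "m N x = a (J N x) x" for N x
  have a_le: "a j x \<le> m N x" if "j \<le> N" for j N x using J(2) that unfolding m_def by (metis neg_le_iff_le)
  have mB: "m N \<in> L2 M \<and> L2_norm M (m N) \<le> B" for N
  proof -
    have JN: "simple_function M (J N)" using J(1) by blast
    \<comment> \<open>With this weight the test function has pointwise norm \<open>m N x\<close>,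
      while \<open>l\<close> maps it to the integral of its square; boundedness of \<open>l\<close>
      then gives norm at most \<open>B\<close>. At \<open>u j = 0\<close> all quotients are
      0.\<close>
    define \<phi> where "\<phi> j x = \<mu> j x / (norm (u j))\<^sup>2" for j x
    have \<phi>L: "\<phi> j \<in> L2 M" for j
      using L2_scale[OF \<mu>(1), of "inverse ((norm (u j))\<^sup>2)" j] by (simp add: \<phi>_def[abs_def] divide_inverse mult.commute)
    have \<phi>: "(\<lambda>x. indicator (J N -` {j} \<inter> space M) x * \<phi> j x) \<in> L2 M" for j
    proof (rule L2_dominated(1)[OF _ \<phi>L])
      have "J N -` {j} \<inter> space M \<in> sets M" using JN by (rule simple_functionD)
      then show "strongly_measurable M (\<lambda>x. indicator (J N -` {j} \<inter> space M) x * \<phi> j x)"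
        using \<phi>L[of j] unfolding strongly_measurable_iff_borel L2_real_iff
        by (intro borel_measurable_times borel_measurable_indicator) auto
    qed (auto simp: indicator_def)
    note app = L2_functional_apply_simple[OF l JN \<mu> \<phi>]
    have sq: "(norm (\<phi> (J N x) x *\<^sub>R u (J N x)))\<^sup>2 = (m N x)\<^sup>2" for x
      by (cases "norm (u (J N x)) = 0") (simp_all add: \<phi>_def m_def a_def power_divide field_simps power2_eq_square)
    have sq2: "\<mu> (J N x) x * \<phi> (J N x) x = (m N x)\<^sup>2" for x
      by (simp add: \<phi>_def m_def a_def power_divide power2_eq_square)
    have m_meas: "m N \<in> borel_measurable M"
    proof -
      have [measurable]: "J N \<in> measurable M (count_space UNIV)" by (rule measurable_simple_function[OF JN])
      have [measurable]: "a j \<in> borel_measurable M" for j using aL L2_real_iff by blast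
      show ?thesis unfolding m_def[abs_def] by (rule measurable_compose_countable) measurable
    qed
    have mL: "m N \<in> L2 M" using app(2) m_meas by (simp add: sq2 L2_real_iff)
    have "(L2_norm M (m N))\<^sup>2 = l (\<lambda>x. \<phi> (J N x) x *\<^sub>R u (J N x))" by (simp add: L2_norm_sq app(1) sq2)
    also have "\<dots> \<le> B * L2_norm M (\<lambda>x. \<phi> (J N x) x *\<^sub>R u (J N x))" using B(2)[OF app(3)] by simp
    also have "L2_norm M (\<lambda>x. \<phi> (J N x) x *\<^sub>R u (J N x)) = L2_norm M (m N)" unfolding L2_norm_def sq by simp
    finally have "L2_norm M (m N) * L2_norm M (m N) \<le> B * L2_norm M (m N)" by (simp add: power2_eq_square)
    then have "L2_norm M (m N) \<le> B" using B(1) L2_norm_nonneg[of "m N"]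
      by (cases "L2_norm M (m N) = 0") (auto dest: mult_right_le_imp_le)
    then show ?thesis using mL by simp
  qed
  \<comment> \<open>Compactness for families is applied to a constant family, so every
    \<open>h k\<close> is a weak limit of the same sequence.\<close>
  obtain r h where r: "strict_mono r" "\<And>k::nat. weak_L2_real (\<lambda>n. m (r n)) (h k)"
    using weak_L2_real_subsequences[of "\<lambda>k. m" "\<lambda>k. B"] mB by auto
  define \<Lambda> where "\<Lambda> = h 0"
  have w: "weak_L2_real (\<lambda>n. m (r n)) \<Lambda>" using r(2) by (simp add: \<Lambda>_def)
  have "AE x in M. a j x \<le> \<Lambda> x" for j
  proof -
    have c: "weak_L2_real (\<lambda>n. a j) (a j)" using aL by (simp add: weak_L2_real_def)
    have "AE x in M. 0 \<le> 1 * \<Lambda> x + (-1) * a j x"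
    proof (rule weak_L2_real_nonneg[OF weak_L2_real_combine[OF w c]])
      show "\<forall>\<^sub>F n in sequentially. AE x in M. 0 \<le> 1 * m (r n) x + (-1) * a j x"
        using eventually_ge_at_top[of j]
      proof eventually_elim
        case (elim n)
        then have "j \<le> r n" using seq_suble[OF r(1), of n] by simp
        then show ?case using a_le by simp
      qed
    qed
    then show ?thesis by eventually_elim simp
  qed
  then have "AE x in M. \<forall>j. a j x \<le> \<Lambda> x" by (simp add: AE_all_countable)
  moreover have "\<Lambda> \<in> L2 M" using w by (simp add: weak_L2_real_def)
  ultimately show ?thesis unfolding a_def by (intro exI[of _ \<Lambda>] conjI)
qed

text \<open>At almost every point the components \<open>\<mu>\<close> define a rationally linear
  functional of norm at most \<open>\<Lambda> x\<close> on the range of \<open>u\<close>, which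
  Hahn-Banach extends. By density some \<open>q k\<close> is close to it, and \<open>J\<close>
  selects a nearest index measurably. The L2 norm of the pointwise distance is then small, and
  Cauchy-Schwarz bounds the difference of the two functionals.\<close>

lemma L2_functional_approximation:
  fixes u :: "nat \<Rightarrow> 'b::real_normed_vector" and q :: "nat \<Rightarrow> 'b \<Rightarrow>\<^sub>L real"
  assumes l: "L2_functional M l" and u: "rational_subspace (range u)" "u 0 = 0" and q0: "q 0 = 0"
    and dense: "\<And>f e. 0 < e \<Longrightarrow> \<exists>k. \<forall>y\<in>closure (range u). \<bar>blinfun_apply f y - blinfun_apply (q k) y\<bar> \<le> e * norm y"
    and e: "0 < e"
  shows "\<exists>J. simple_function M J \<and>
    (\<forall>w\<in>L2 M. (AE x in M. w x \<in> closure (range u)) \<longrightarrow> \<bar>l w - simple_functional q J w\<bar> \<le> e * L2_norm M w)"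
proof -
  obtain \<mu> :: "nat \<Rightarrow> 'x \<Rightarrow> real" where "\<forall>j. \<mu> j \<in> L2 M"
    "\<forall>j. \<forall>\<phi>\<in>L2 M. l (\<lambda>x. \<phi> x *\<^sub>R u j) = (\<integral>x. \<mu> j x * \<phi> x \<partial>M)"
    "\<forall>i j k a b. u k = a *\<^sub>R u i + b *\<^sub>R u j \<longrightarrow> (AE x in M. \<mu> k x = a * \<mu> i x + b * \<mu> j x)"
    using L2_functional_components[OF l, of u] by (elim exE conjE)
  note \<mu> = this(1)[rule_format] this(2) this(3)[rule_format]
  obtain \<Lambda> where \<Lambda>: "\<Lambda> \<in> L2 M" "AE x in M. \<forall>j. \<bar>\<mu> j x\<bar> / norm (u j) \<le> \<Lambda> x"
    using L2_functional_dominated[where \<mu> = \<mu> and u = u, OF l \<mu>(1,2)] by (elim exE conjE)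
  have [measurable]: "\<mu> j \<in> borel_measurable M" for j using \<mu>(1) L2_real_iff by blast
  define \<rho> where "\<rho> k j x = \<bar>\<mu> j x - blinfun_apply (q k) (u j)\<bar> / norm (u j)" for k j x
  have [measurable]: "\<rho> k j \<in> borel_measurable M" for k j unfolding \<rho>_def[abs_def] by measurable
  \<comment> \<open>The distance, as functionals on the range of \<open>u\<close>, between
    \<open>q k\<close> and the one with values \<open>\<mu> j x\<close>. The supremum is known to be
    finite only almost everywhere; \<open>real_of_ereal\<close> sends an infinite one to 0.\<close>
  define d where "d k x = real_of_ereal (SUP j. ereal (\<rho> k j x))" for k x
  have d_meas: "d k \<in> borel_measurable M" for k unfolding d_def[abs_def] by measurable
  have "AE x in M. \<forall>a\<in>\<rat>. \<forall>b\<in>\<rat>. \<forall>i j k. u k = a *\<^sub>R u i + b *\<^sub>R u j \<longrightarrow> \<mu> k x = a * \<mu> i x + b * \<mu> j x"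
    unfolding AE_ball_countable[OF countable_rat] AE_all_countable
    by (intro ballI allI AE_impI \<mu>(3))
  with \<Lambda>(2) have good: "AE x in M. (\<forall>k j. \<rho> k j x \<le> d k x) \<and> (\<forall>k. 0 \<le> d k x) \<and> d 0 x \<le> \<Lambda> x \<and> (\<forall>e>0. \<exists>k. d k x < e)"
  proof eventually_elim
    case (elim x)
    then have \<Lambda>x: "\<bar>\<mu> j x\<bar> / norm (u j) \<le> \<Lambda> x" for j by blast
    have lin: "\<mu> k x = a * \<mu> i x + b * \<mu> j x" if "a \<in> \<rat>" "b \<in> \<rat>" "u k = a *\<^sub>R u i + b *\<^sub>R u j" for a b i j k
      using elim(2) that by blast
    have \<Lambda>0: "0 \<le> \<Lambda> x" using \<Lambda>x[of 0] u by simp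
    have \<mu>0: "\<mu> j x = 0" if "u j = 0" for j using lin[of 0 0 j 0 0] that by simp
    have \<mu>le: "\<bar>\<mu> j x\<bar> \<le> \<Lambda> x * norm (u j)" for j
      using \<Lambda>x[of j] \<mu>0[of j] by (cases "u j = 0") (auto simp: pos_divide_le_eq)
    have sup_le: "d k x \<le> c \<and> (\<forall>j. \<rho> k j x \<le> d k x)" if c: "\<And>j. \<rho> k j x \<le> c" for k c
    proof -
      have "(SUP j. ereal (\<rho> k j x)) \<le> ereal c" using c by (intro SUP_least) simp
      moreover have "ereal (\<rho> k j x) \<le> (SUP j. ereal (\<rho> k j x))" for j by (intro SUP_upper) simp
      ultimately show ?thesis unfolding d_def by (rule real_of_ereal_between)
    qed
    have \<rho>bd: "\<rho> k j x \<le> \<Lambda> x + norm (q k)" for k j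
    proof -
      have "\<bar>\<mu> j x - blinfun_apply (q k) (u j)\<bar> \<le> (\<Lambda> x + norm (q k)) * norm (u j)"
        using \<mu>le[of j] norm_blinfun[of "q k" "u j"] by (simp add: distrib_right)
      then show ?thesis using \<Lambda>0 by (cases "u j = 0") (auto simp: \<rho>_def pos_divide_le_eq)
    qed
    have 1: "\<rho> k j x \<le> d k x" for k j using sup_le[OF \<rho>bd] by blast
    have 2: "0 \<le> d k x" for k using 1[of k 0] u by (simp add: \<rho>_def)
    \<comment> \<open>This is where \<open>q 0 = 0\<close> matters: it provides a square-integrable
      majorant for the distances of the selected indices.\<close>
    have 3: "d 0 x \<le> \<Lambda> x" using sup_le[OF \<rho>bd, of 0] q0 by simp
    have 4: "\<exists>k. d k x < e" if "0 < e" for e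
    proof -
      \<comment> \<open>The graph of the candidate functional at this point, closed under rational
        combinations only.\<close>
      define G where "G = range (\<lambda>j. (u j, \<mu> j x))"
      have "rational_subspace G" unfolding rational_subspace_def
      proof (intro conjI ballI)
        show "0 \<in> G" unfolding G_def zero_prod_def by (rule range_eqI[of _ _ 0]) (simp add: u(2) \<mu>0)
        show "y + z \<in> G" if "y \<in> G" "z \<in> G" for y z
        proof -
          obtain i j where ij: "y = (u i, \<mu> i x)" "z = (u j, \<mu> j x)" using \<open>y \<in> G\<close> \<open>z \<in> G\<close> by (auto simp: G_def)
          have "u i + u j \<in> range u" by (intro rational_subspaceD(2)[OF u(1)]) auto
          then obtain k where "u k = 1 *\<^sub>R u i + 1 *\<^sub>R u j" by (metis imageE scaleR_one)
          then have "y + z = (u k, \<mu> k x)" using lin[of 1 1 k i j] ij by simp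
          then show ?thesis by (simp add: G_def)
        qed
        show "a *\<^sub>R y \<in> G" if "a \<in> \<rat>" "y \<in> G" for a y
        proof -
          obtain i where i: "y = (u i, \<mu> i x)" using \<open>y \<in> G\<close> by (auto simp: G_def)
          have "a *\<^sub>R u i \<in> range u" using that by (intro rational_subspaceD(3)[OF u(1)]) auto
          then obtain k where "u k = a *\<^sub>R u i + 0 *\<^sub>R u i" by auto
          then have "a *\<^sub>R y = (u k, \<mu> k x)" using lin[of a 0 k i i] i that by simp
          then show ?thesis by (simp add: G_def)
        qed
      qed
      moreover have "a \<le> \<Lambda> x * norm y" if "(y, a) \<in> G" for y a using that abs_le_D1[OF \<mu>le] by (auto simp: G_def)
      ultimately obtain f where f: "\<And>y a. (y, a) \<in> G \<Longrightarrow> blinfun_apply f y = a"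
        using hahn_banach_rational[OF _ _ \<Lambda>0, of G] by blast
      have fu: "blinfun_apply f (u j) = \<mu> j x" for j
        by (intro f) (auto simp: G_def)
      have "0 < e / 2" using \<open>0 < e\<close> by simp
      then obtain k where k: "\<forall>y\<in>closure (range u). \<bar>blinfun_apply f y - blinfun_apply (q k) y\<bar> \<le> e / 2 * norm y"
        using dense by blast
      have "\<rho> k j x \<le> e / 2" for j
      proof -
        have "u j \<in> closure (range u)" using closure_subset[of "range u"] by auto
        then have "\<bar>\<mu> j x - blinfun_apply (q k) (u j)\<bar> \<le> e / 2 * norm (u j)" using k fu by metis
        then show ?thesis using \<open>0 < e\<close> by (cases "u j = 0") (auto simp: \<rho>_def pos_divide_le_eq)
      qed
      then have "d k x \<le> e / 2" using sup_le by blast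
      then show ?thesis using \<open>0 < e\<close> by (intro exI[of _ k]) simp
    qed
    show ?case using 1 2 3 4 by blast
  qed
  have "AE x in M. \<forall>k. 0 \<le> d k x" "AE x in M. \<forall>e>0. \<exists>k. d k x < e"
    using good by (eventually_elim, blast)+
  from measurable_nearest_index[of d, OF d_meas this] obtain J where
    J: "\<forall>n. simple_function M (J n)" "\<forall>n x. d (J n x) x \<le> d 0 x" "AE x in M. (\<lambda>n. d (J n x) x) \<longlonglongrightarrow> 0"
    by (elim exE conjE)
  have dJ_meas: "(\<lambda>x. d (J n x) x) \<in> borel_measurable M" for n
  proof -
    have [measurable]: "J n \<in> measurable M (count_space UNIV)" using J(1) by (intro measurable_simple_function) blast
    note d_meas [measurable]
    show ?thesis by (rule measurable_compose_countable) measurable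
  qed
  have dJ_le: "AE x in M. norm (d (J n x) x) \<le> norm (\<Lambda> x)" for n
    using good
  proof eventually_elim
    case (elim x)
    have "d (J n x) x \<le> d 0 x" using J(2) by blast
    moreover have "0 \<le> d (J n x) x" "d 0 x \<le> \<Lambda> x" using elim by blast+
    ultimately show ?case by simp
  qed
  have dJ: "(\<lambda>x. d (J n x) x) \<in> L2 M" for n
    by (rule L2_dominated(1)[OF _ \<Lambda>(1) dJ_le]) (simp add: strongly_measurable_iff_borel dJ_meas)
  have "(\<lambda>n. L2_norm M (\<lambda>x. d (J n x) x - 0)) \<longlonglongrightarrow> 0"
    by (rule L2_dominated_LIMSEQ[OF L2_const dJ \<Lambda>(1) J(3)]) (use dJ_le in simp)
  from LIMSEQ_D[OF this e] obtain n where n: "L2_norm M (\<lambda>x. d (J n x) x) < e" by auto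
  have Jn: "simple_function M (J n)" using J(1) by blast
  note sf = simple_functional_L2[OF Jn, of q]
  have simple_case: "\<bar>l (\<lambda>x. u (I x)) - simple_functional q (J n) (\<lambda>x. u (I x))\<bar> \<le> e * L2_norm M (\<lambda>x. u (I x))"
    if I: "simple_function M I" for I
  proof -
    have uI: "(\<lambda>x. u (I x)) \<in> L2 M" by (intro L2_simple simple_function_compose1[OF I])
    have 1: "(\<lambda>x. indicator (I -` {j} \<inter> space M) x * 1 :: real) \<in> L2 M" for j
      using simple_function_level_indicator[OF I, of j] by simp
    have app: "l (\<lambda>x. u (I x)) = (\<integral>x. \<mu> (I x) x \<partial>M)" "integrable M (\<lambda>x. \<mu> (I x) x)"
      using L2_functional_apply_simple[OF l I \<mu>(1,2), of "\<lambda>j x. 1"] 1 by simp_all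
    have "\<bar>l (\<lambda>x. u (I x)) - simple_functional q (J n) (\<lambda>x. u (I x))\<bar>
        = \<bar>\<integral>x. \<mu> (I x) x - blinfun_apply (q (J n x)) (u (I x)) \<partial>M\<bar>"
      using app simple_functional_integral[OF Jn uI, of q] by simp
    also have "\<dots> \<le> (\<integral>x. d (J n x) x * norm (u (I x)) \<partial>M)"
    proof (rule integral_norm_bound_AE[where f = "\<lambda>x. \<mu> (I x) x - blinfun_apply (q (J n x)) (u (I x))", unfolded real_norm_def])
      show "integrable M (\<lambda>x. \<mu> (I x) x - blinfun_apply (q (J n x)) (u (I x)))"
        using app simple_functional_integral[OF Jn uI, of q] by simp
      show "integrable M (\<lambda>x. d (J n x) x * norm (u (I x)))"
        by (rule L2_mult_integrable[OF dJ L2D(4)[OF uI]])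
      \<comment> \<open>Where \<open>u j = 0\<close> the quotient \<open>\<rho>\<close> carries no
        information, so the vanishing of \<open>\<mu> j x\<close> is needed separately.\<close>
      have z: "AE x in M. \<forall>j. u j = 0 \<longrightarrow> \<mu> j x = 0"
        unfolding AE_all_countable
      proof
        fix j
        show "AE x in M. u j = 0 \<longrightarrow> \<mu> j x = 0"
        proof (cases "u j = 0")
          case True
          then have "AE x in M. \<mu> j x = 0 * \<mu> 0 x + 0 * \<mu> 0 x" using u by (intro \<mu>(3)) simp
          then show ?thesis by eventually_elim simp
        qed simp
      qed
      show "AE x in M. \<bar>\<mu> (I x) x - blinfun_apply (q (J n x)) (u (I x))\<bar> \<le> d (J n x) x * norm (u (I x))"
        using good z
      proof eventually_elim
        case (elim x)
        then have "\<rho> (J n x) (I x) x \<le> d (J n x) x" by blast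
        then show ?case using elim(2) by (cases "u (I x) = 0") (auto simp: \<rho>_def pos_divide_le_eq)
      qed
    qed
    also have "\<dots> \<le> L2_norm M (\<lambda>x. d (J n x) x) * L2_norm M (\<lambda>x. u (I x))"
      using abs_le_D1[OF Cauchy_Schwarz_L2[OF dJ L2D(4)[OF uI]]] by simp
    also have "\<dots> \<le> e * L2_norm M (\<lambda>x. u (I x))" using n by (intro mult_right_mono) auto
    finally show ?thesis .
  qed
  \<comment> \<open>A general \<open>w\<close> is an L2 limit of functions \<open>u (I k x)\<close>,
    and both functionals are continuous along it.\<close>
  have "\<bar>l w - simple_functional q (J n) w\<bar> \<le> e * L2_norm M w"
    if w: "w \<in> L2 M" "AE x in M. w x \<in> closure (range u)" for w
  proof -
    obtain I where I: "\<forall>k. simple_function M (I k)" "(\<lambda>k. L2_norm M (\<lambda>x. u (I k x) - w x)) \<longlonglongrightarrow> 0"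
      using L2_simple_approximation[OF w u(2)] by (elim exE conjE)
    have uI: "(\<lambda>x. u (I k x)) \<in> L2 M" for k by (rule L2_simple[OF simple_function_compose1[OF I(1)[rule_format]]])
    have "(\<lambda>k. \<bar>l (\<lambda>x. u (I k x)) - simple_functional q (J n) (\<lambda>x. u (I k x))\<bar>) \<longlonglongrightarrow> \<bar>l w - simple_functional q (J n) w\<bar>"
      by (intro tendsto_intros L2_functional_LIMSEQ[OF _ w(1) uI I(2)] l sf)
    moreover have "(\<lambda>k. e * (L2_norm M (\<lambda>x. u (I k x) - w x) + L2_norm M w)) \<longlonglongrightarrow> e * (0 + L2_norm M w)"
      by (intro tendsto_intros I)
    moreover have "\<bar>l (\<lambda>x. u (I k x)) - simple_functional q (J n) (\<lambda>x. u (I k x))\<bar>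
        \<le> e * (L2_norm M (\<lambda>x. u (I k x) - w x) + L2_norm M w)" for k
    proof (rule order_trans[OF simple_case[OF I(1)[rule_format]] mult_left_mono[OF L2_norm_triangle3[OF uI w(1)]]])
      show "0 \<le> e" using e by simp
    qed
    ultimately have "\<bar>l w - simple_functional q (J n) w\<bar> \<le> e * (0 + L2_norm M w)" by (intro LIMSEQ_le) auto
    then show ?thesis by simp
  qed
  then show ?thesis using Jn by blast
qed

end

section \<open>Extraction of weak limits\<close>

lemma enumeration_from_zero:
  assumes "countable Q" "0 \<in> Q"
  shows "\<exists>u :: nat \<Rightarrow> 'b::zero. range u = Q \<and> u 0 = 0"
proof (intro exI conjI)
  define u where "u n = (case n of 0 \<Rightarrow> 0 | Suc k \<Rightarrow> from_nat_into Q k)" for n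
  show "u 0 = 0" by (simp add: u_def)
  show "range u = Q"
  proof
    have "Q \<noteq> {}" using assms(2) by blast
    then have "u n \<in> Q" for n using assms(2) from_nat_into[of Q] by (cases n) (auto simp: u_def)
    then show "range u \<subseteq> Q" by blast
    show "Q \<subseteq> range u"
    proof
      fix y assume "y \<in> Q"
      then have "y = u (Suc (to_nat_on Q y))" using assms(1) by (simp add: u_def)
      then show "y \<in> range u" by (rule range_eqI)
    qed
  qed
qed

context complete_finite_measure
begin

text \<open>All the approximating simple functions together take countably many values; the closure
  of their rational span contains the limits.\<close>

lemma AE_separably_valued:
  fixes f :: "nat \<Rightarrow> 'x \<Rightarrow> 'b::real_normed_vector"
  assumes f: "\<And>n. strongly_measurable M (f n)"
  obtains u :: "nat \<Rightarrow> 'b" where "rational_subspace (range u)" "u 0 = 0" "\<And>n. AE x in M. f n x \<in> closure (range u)"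
proof -
  have "\<forall>n. \<exists>s. (\<forall>i::nat. simple_function M (s i)) \<and> (AE x in M. (\<lambda>i. s i x) \<longlonglongrightarrow> f n x)"
    using f by (simp add: strongly_measurable_def)
  then obtain s where s: "\<And>n i. simple_function M (s n i :: 'x \<Rightarrow> 'b)" "\<And>n. AE x in M. (\<lambda>i. s n i x) \<longlonglongrightarrow> f n x"
    by metis
  define U where "U = (\<Union>n. \<Union>i. s n i ` space M)"
  have "countable U" unfolding U_def using simple_functionD(1)[OF s(1)] by (intro countable_UN) (auto intro: countable_finite)
  then obtain Q where Q: "countable Q" "U \<subseteq> Q" "rational_subspace Q" using countable_rational_span by blast
  have Q0: "0 \<in> Q" by (rule rational_subspaceD(1)[OF Q(3)])
  obtain u :: "nat \<Rightarrow> 'b" where "range u = Q" "u 0 = 0" using enumeration_from_zero[OF Q(1) Q0] by blast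
  moreover have "AE x in M. f n x \<in> closure Q" for n
    using s(2)[of n] AE_space
  proof eventually_elim
    case (elim x)
    have "s n i x \<in> Q" for i using elim(2) Q(2) by (auto simp: U_def)
    then show ?case unfolding closure_sequential by (intro exI[of _ "\<lambda>i. s n i x"] conjI allI elim(1))
  qed
  ultimately show ?thesis using Q(3) that by metis
qed

text \<open>
  Along a subsequence the scalar functions \<open>q\<^sub>k \<circ> v\<^sub>n\<close> and \<open>\<parallel>v\<^sub>n\<parallel>\<close> converge weakly, to \<open>h\<^sub>k\<close> and \<open>H\<close>.
  At almost every point \<open>q\<^sub>k \<mapsto> h\<^sub>k x\<close> is a functional of norm at most \<open>H x\<close> on a dense part of the
  dual, hence is evaluation at a point of the reflexive space.
\<close>

lemma L2_weak_compact_scalar: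
  fixes vs :: "nat \<Rightarrow> 'x \<Rightarrow> 'b::real_normed_vector" and u :: "nat \<Rightarrow> 'b"
  assumes refl: "reflexive TYPE('b)" and vs: "\<And>n. vs n \<in> L2 M" and bdd: "\<And>n. L2_norm M (vs n) \<le> B"
    and u: "rational_subspace (range u)" "u 0 = 0" "\<And>n. AE x in M. vs n x \<in> closure (range u)"
    and q: "rational_subspace (range (q :: nat \<Rightarrow> 'b \<Rightarrow>\<^sub>L real))"
    and norming: "\<And>y e. y \<in> closure (range u) \<Longrightarrow> 0 < e \<Longrightarrow> \<exists>k. norm (q k) \<le> 1 \<and> norm y - e \<le> blinfun_apply (q k) y"
  shows "\<exists>r v. strict_mono r \<and> v \<in> L2 M \<and> (AE x in M. v x \<in> closure (range u)) \<and>
    (\<forall>k. weak_L2_real (\<lambda>n x. blinfun_apply (q k) (vs (r n) x)) (\<lambda>x. blinfun_apply (q k) (v x)))"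
proof -
  let ?Q = "range u"
  \<comment> \<open>Index 0 holds the norms and \<open>Suc k\<close> the functional
    \<open>q k\<close>, so that one subsequence serves both.\<close>
  define f where "f k n = (case k of 0 \<Rightarrow> (\<lambda>x. norm (vs n x)) | Suc k \<Rightarrow> (\<lambda>x. blinfun_apply (q k) (vs n x)))" for k n
  define C where "C k = (case k of 0 \<Rightarrow> B | Suc k \<Rightarrow> norm (q k) * B)" for k
  have fL: "f k n \<in> L2 M" for k n using L2D(4)[OF vs] L2_blinfun(1)[OF vs] by (cases k) (auto simp: f_def)
  have fB: "L2_norm M (f k n) \<le> C k" for k n
    using bdd[of n] order_trans[OF L2_blinfun(2)[OF vs] mult_left_mono[OF bdd norm_ge_zero]] by (cases k) (auto simp: f_def C_def)
  obtain r hh where r: "strict_mono r" and hh: "\<And>k::nat. weak_L2_real (\<lambda>n. f k (r n)) (hh k)"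
    using weak_L2_real_subsequences[of f C, OF fL fB] by metis
  define H where "H = hh 0"
  define h where "h k = hh (Suc k)" for k
  have H: "weak_L2_real (\<lambda>n x. norm (vs (r n) x)) H" using hh[of 0] by (simp add: f_def H_def)
  have h: "weak_L2_real (\<lambda>n x. blinfun_apply (q k) (vs (r n) x)) (h k)" for k using hh[of "Suc k"] by (simp add: f_def h_def)
  have HL: "H \<in> L2 M" and hL: "h k \<in> L2 M" for k using H h by (auto simp: weak_L2_real_def)
  have lin: "AE x in M. h k x = a * h i x + b * h j x" if k: "q k = a *\<^sub>R q i + b *\<^sub>R q j" for a b i j k
  proof -
    have eq: "a * blinfun_apply (q i) y + b * blinfun_apply (q j) y = blinfun_apply (q k) y" for y
      by (simp add: k blinfun.add_left blinfun.scaleR_left)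
    show ?thesis using weak_L2_real_unique[OF h weak_L2_real_combine[OF h h, of a i b j, unfolded eq]] .
  qed
  have lin': "AE x in M. \<forall>a\<in>\<rat>. \<forall>b\<in>\<rat>. \<forall>i j k. q k = a *\<^sub>R q i + b *\<^sub>R q j \<longrightarrow> h k x = a * h i x + b * h j x"
    unfolding AE_ball_countable[OF countable_rat] AE_all_countable
    by (intro ballI allI AE_impI lin)
  \<comment> \<open>The bound of \<open>q k\<close> on \<open>vs n\<close> by
    \<open>restricted_norm\<close> times the norm is linear in two weakly convergent scalar
    sequences, so it passes to their limits.\<close>
  have "AE x in M. h k x \<le> restricted_norm ?Q (q k) * H x" for k
  proof -
    have "AE x in M. 0 \<le> restricted_norm ?Q (q k) * H x + (-1) * h k x"
    proof (rule weak_L2_real_nonneg[OF weak_L2_real_combine[OF H h, of "restricted_norm ?Q (q k)" "-1" k]])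
      have "AE x in M. 0 \<le> restricted_norm ?Q (q k) * norm (vs (r n) x) + (-1) * blinfun_apply (q k) (vs (r n) x)" for n
        using u(3)[of "r n"] by eventually_elim (use abs_le_D1[OF restricted_norm_bound] in force)
      then show "\<forall>\<^sub>F n in sequentially. AE x in M. 0 \<le> restricted_norm ?Q (q k) * norm (vs (r n) x) + (-1) * blinfun_apply (q k) (vs (r n) x)"
        by simp
    qed
    then show ?thesis by eventually_elim simp
  qed
  then have bnd: "AE x in M. \<forall>k. h k x \<le> restricted_norm ?Q (q k) * H x" by (simp add: AE_all_countable)
  have H0: "AE x in M. 0 \<le> H x" by (rule weak_L2_real_nonneg[OF H]) simp
  define P where "P x y \<longleftrightarrow> y \<in> closure ?Q \<and> norm y \<le> H x \<and> (\<forall>k. blinfun_apply (q k) y = h k x)" for x y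
  define v where "v x = (SOME y. P x y)" for x
  have v: "AE x in M. P x (v x)"
    using lin' bnd H0
  proof eventually_elim
    case (elim x)
    have lin: "h k x = a * h i x + b * h j x" if "a \<in> \<rat>" "b \<in> \<rat>" "q k = a *\<^sub>R q i + b *\<^sub>R q j" for a b i j k
      using elim(1) that by blast
    \<comment> \<open>The enumeration \<open>q\<close> may repeat values. The linear relations force
      equal functionals to have equal \<open>h\<close>, which makes \<open>g\<close> well defined on
      its range.\<close>
    define g where "g p = h (SOME k. q k = p) x" for p
    have g: "g (q k) = h k x" for k
    proof -
      have "q (SOME j. q j = q k) = q k" by (rule someI[of _ k]) simp
      then have "q (SOME j. q j = q k) = 1 *\<^sub>R q k + 0 *\<^sub>R q k" by simp
      from lin[OF _ _ this] show ?thesis by (simp add: g_def)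
    qed
    have "\<exists>y\<in>closure ?Q. norm y \<le> H x \<and> (\<forall>p\<in>range q. blinfun_apply p y = g p)"
    proof (rule reflexive_interpolation[OF refl u(1) q])
      show "g (p + p') = g p + g p'" if "p \<in> range q" "p' \<in> range q" for p p'
      proof -
        obtain i j where ij: "p = q i" "p' = q j" using \<open>p \<in> range q\<close> \<open>p' \<in> range q\<close> by blast
        have "q i + q j \<in> range q" by (intro rational_subspaceD(2)[OF q]) auto
        then obtain k where k: "q k = 1 *\<^sub>R q i + 1 *\<^sub>R q j" by (metis imageE scaleR_one)
        then show ?thesis using lin[OF _ _ k] ij g[of k] g[of i] g[of j] by simp
      qed
      show "g (a *\<^sub>R p) = a * g p" if "p \<in> range q" "a \<in> \<rat>" for p a
      proof -
        obtain i where i: "p = q i" using \<open>p \<in> range q\<close> by blast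
        have "a *\<^sub>R q i \<in> range q" using that by (intro rational_subspaceD(3)[OF q]) auto
        then obtain k where k: "q k = a *\<^sub>R q i + 0 *\<^sub>R q i" by auto
        then show ?thesis using lin[OF _ _ k] i g[of k] g[of i] that by simp
      qed
      show "g p \<le> H x * restricted_norm ?Q p" if "p \<in> range q" for p
        using that elim(2) g by (auto simp: mult.commute)
    qed (rule elim(3))
    then have "\<exists>y. P x y" using g by (auto simp: P_def)
    then show ?case unfolding v_def by (rule someI_ex)
  qed
  have vQ: "AE x in M. v x \<in> closure ?Q" using v by eventually_elim (simp add: P_def)
  \<comment> \<open>\<open>v\<close> is a pointwise choice. On \<open>closure (range u)\<close> the
    norm is a supremum over the countably many \<open>q k\<close> of norm at most 1, and their
    values at \<open>v x\<close> are the measurable functions \<open>h k\<close>.\<close>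
  have meas: "(\<lambda>x. norm (v x - u j)) \<in> borel_measurable M" for j
  proof -
    define K where "K = {k. norm (q k) \<le> 1}"
    have [measurable]: "h k \<in> borel_measurable M" for k using hL L2_real_iff by blast
    define N where "N x = (SUP k\<in>K. ereal (h k x - blinfun_apply (q k) (u j)))" for x
    have m: "(\<lambda>x. real_of_ereal (N x)) \<in> borel_measurable M"
      unfolding N_def by (intro borel_measurable_real_of_ereal borel_measurable_SUP) auto
    have "AE x in M. real_of_ereal (N x) = norm (v x - u j)"
      using v
    proof eventually_elim
      case (elim x)
      have y: "v x - u j \<in> closure ?Q"
        using elim closure_subset[of ?Q]
        by (intro subspace_diff[OF subspace_closure_rational_subspace[OF u(1)]]) (auto simp: P_def)
      have N: "N x = (SUP k\<in>K. ereal (blinfun_apply (q k) (v x - u j)))"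
        using elim by (simp add: N_def P_def blinfun.diff_right)
      have "N x \<le> ereal (norm (v x - u j))" unfolding N
      proof (rule SUP_least)
        fix k assume "k \<in> K"
        then have "norm (q k) * norm (v x - u j) \<le> 1 * norm (v x - u j)" by (intro mult_right_mono) (auto simp: K_def)
        then show "ereal (blinfun_apply (q k) (v x - u j)) \<le> ereal (norm (v x - u j))"
          using norm_blinfun[of "q k" "v x - u j"] by simp
      qed
      moreover have "ereal (norm (v x - u j)) \<le> N x"
      proof (rule ereal_le_epsilon2)
        fix e :: real assume "0 < e"
        then obtain k where k: "norm (q k) \<le> 1" "norm (v x - u j) - e \<le> blinfun_apply (q k) (v x - u j)"
          using norming[OF y] by blast
        then have "ereal (norm (v x - u j) - e) \<le> N x"
          unfolding N by (intro SUP_upper2[of k]) (auto simp: K_def)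
        then show "ereal (norm (v x - u j)) \<le> N x + ereal e" by (cases "N x") auto
      qed
      ultimately have "N x = ereal (norm (v x - u j))" by (rule antisym)
      then show ?case by simp
    qed
    from measurable_AE_cong[OF m _ this] show ?thesis by simp
  qed
  obtain J where J: "\<forall>k. simple_function M (J k)" "AE x in M. (\<lambda>k. u (J k x)) \<longlonglongrightarrow> v x"
    using simple_approximation[where u = u, OF meas vQ u(2)] by (elim exE conjE)
  have "\<forall>k. simple_function M (\<lambda>x. u (J k x))" using J(1) simple_function_compose1 by blast
  then have sm: "strongly_measurable M v"
    unfolding strongly_measurable_def using J(2) by (intro exI[of _ "\<lambda>k x. u (J k x)"] conjI)
  have vL: "v \<in> L2 M"
    by (rule L2_dominated(1)[OF sm HL]) (use v in eventually_elim, auto simp: P_def)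
  have "weak_L2_real (\<lambda>n x. blinfun_apply (q k) (vs (r n) x)) (\<lambda>x. blinfun_apply (q k) (v x))" for k
    by (rule weak_L2_real_AE_cong[OF h[of k]]) (use v in eventually_elim, simp add: P_def)
  then show ?thesis using r vL vQ by blast
qed

text \<open>A three-epsilon argument: \<open>l\<close> is replaced by a simple functional up to a
  multiple of the norm, uniformly over functions with values in the closure of the range of
  \<open>u\<close>, and simple functionals converge by the scalar weak limits.\<close>

theorem L2_weak_sequentially_compact:
  fixes vs :: "nat \<Rightarrow> 'x \<Rightarrow> 'b::real_normed_vector"
  assumes refl: "reflexive TYPE('b)" and vs: "\<And>n. vs n \<in> L2 M" and bdd: "\<And>n. L2_norm M (vs n) \<le> B"
  shows "\<exists>r v. strict_mono r \<and> L2_weak_lim M (\<lambda>n. vs (r n)) v"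
proof -
  obtain u :: "nat \<Rightarrow> 'b" where u: "rational_subspace (range u)" "u 0 = 0" "\<And>n. AE x in M. vs n x \<in> closure (range u)"
    using AE_separably_valued[of vs, OF L2D(1)[OF vs]] by metis
  obtain F :: "('b \<Rightarrow>\<^sub>L real) set" where F: "countable F" "rational_subspace F"
    and F3: "\<And>f e. 0 < e \<Longrightarrow> \<exists>p\<in>F. \<forall>y\<in>closure (range u). \<bar>blinfun_apply f y - blinfun_apply p y\<bar> \<le> e * norm y"
    and F4: "\<And>y e. y \<in> closure (range u) \<Longrightarrow> 0 < e \<Longrightarrow> \<exists>p\<in>F. norm p \<le> 1 \<and> norm y - e \<le> blinfun_apply p y"
    using reflexive_separable_dual[OF refl u(1)] by (metis countable_image countableI_type)
  obtain q :: "nat \<Rightarrow> 'b \<Rightarrow>\<^sub>L real" where rq: "range q = F" and q0: "q 0 = 0"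
    using enumeration_from_zero[OF F(1) rational_subspaceD(1)[OF F(2)]] by blast
  have dense: "\<exists>k. \<forall>y\<in>closure (range u). \<bar>blinfun_apply f y - blinfun_apply (q k) y\<bar> \<le> e * norm y" if "0 < e" for f e
    using F3[OF that, of f] rq by (metis imageE)
  have norming: "\<exists>k. norm (q k) \<le> 1 \<and> norm y - e \<le> blinfun_apply (q k) y" if "y \<in> closure (range u)" "0 < e" for y e
    using F4[OF that] rq by (metis imageE)
  have q: "rational_subspace (range q)" using F(2) rq by simp
  have "\<exists>r v. strict_mono r \<and> v \<in> L2 M \<and> (AE x in M. v x \<in> closure (range u)) \<and>
    (\<forall>k. weak_L2_real (\<lambda>n x. blinfun_apply (q k) (vs (r n) x)) (\<lambda>x. blinfun_apply (q k) (v x)))"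
    by (rule L2_weak_compact_scalar[OF refl vs bdd u q]) (rule norming)
  then obtain r v where
    r: "strict_mono r" and v: "v \<in> L2 M" "AE x in M. v x \<in> closure (range u)"
    and weak: "\<forall>k. weak_L2_real (\<lambda>n x. blinfun_apply (q k) (vs (r n) x)) (\<lambda>x. blinfun_apply (q k) (v x))"
    by (elim exE conjE)
  have "(\<lambda>n. l (vs (r n))) \<longlonglongrightarrow> l v" if l: "L2_functional M l" for l :: "('x \<Rightarrow> 'b) \<Rightarrow> real"
  proof (rule LIMSEQ_I)
    fix e :: real assume e: "0 < e"
    \<comment> \<open>A common bound for the norms of all \<open>vs n\<close> and \<open>v\<close>,
      made positive by the added 1.\<close>
    define c where "c = \<bar>B\<bar> + L2_norm M v + 1"
    have c: "c > 0" "L2_norm M v \<le> c" "L2_norm M (vs n) \<le> c" for n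
      using bdd[of n] L2_norm_nonneg[of v] unfolding c_def by linarith+
    have "0 < e / (3 * c)" using e c by simp
    from L2_functional_approximation[OF l u(1,2) q0 dense this] obtain J where J: "simple_function M J"
      and app: "\<forall>w\<in>L2 M. (AE x in M. w x \<in> closure (range u)) \<longrightarrow> \<bar>l w - simple_functional q J w\<bar> \<le> e / (3 * c) * L2_norm M w"
      by blast
    have close: "\<bar>l w - simple_functional q J w\<bar> \<le> e / 3" if "w \<in> L2 M" "AE x in M. w x \<in> closure (range u)" "L2_norm M w \<le> c" for w
    proof -
      have "\<bar>l w - simple_functional q J w\<bar> \<le> e / (3 * c) * L2_norm M w" using app that by blast
      also have "\<dots> \<le> e / (3 * c) * c" using e c that by (intro mult_left_mono) auto
      finally show ?thesis using c by simp
    qed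
    have "(\<lambda>n. simple_functional q J (vs (r n))) \<longlonglongrightarrow> simple_functional q J v"
      using weak by (intro simple_functional_tendsto J vs v) blast
    from LIMSEQ_D[OF this, of "e / 3"] e obtain n0 where
      n0: "\<And>n. n \<ge> n0 \<Longrightarrow> \<bar>simple_functional q J (vs (r n)) - simple_functional q J v\<bar> < e / 3" by auto
    have "norm (l (vs (r n)) - l v) < e" if "n \<ge> n0" for n
      using n0[OF that] close[OF vs u(3) c(3), of "r n"] close[OF v c(2)] unfolding real_norm_def by linarith
    then show "\<exists>no. \<forall>n\<ge>no. norm (l (vs (r n)) - l v) < e" by blast
  qed
  then show ?thesis using r vs v unfolding L2_weak_lim_def by (intro exI[of _ r] exI[of _ v]) auto
qed

end

text \<open>Every functional is a multiple of the identity, so the representing point is the value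
  at \<open>id_blinfun\<close>.\<close>

lemma reflexive_real: "reflexive TYPE(real)"
  unfolding reflexive_def
proof
  fix \<Phi> :: "(real \<Rightarrow>\<^sub>L real) \<Rightarrow>\<^sub>L real"
  have "l = blinfun_apply l 1 *\<^sub>R id_blinfun" for l :: "real \<Rightarrow>\<^sub>L real"
  proof (rule blinfun_eqI)
    fix x
    have "blinfun_apply l (x *\<^sub>R 1) = x *\<^sub>R blinfun_apply l 1" by (rule blinfun.scaleR_right)
    then show "blinfun_apply l x = blinfun_apply (blinfun_apply l 1 *\<^sub>R id_blinfun) x"
      by (simp add: blinfun.scaleR_left mult.commute)
  qed
  from this[THEN arg_cong[where f = "blinfun_apply \<Phi>"]]
  have "blinfun_apply \<Phi> l = blinfun_apply l 1 *\<^sub>R blinfun_apply \<Phi> id_blinfun" for l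
    unfolding blinfun.scaleR_right .
  moreover have "blinfun_apply l (blinfun_apply \<Phi> id_blinfun) = blinfun_apply \<Phi> id_blinfun *\<^sub>R blinfun_apply l 1" for l :: "real \<Rightarrow>\<^sub>L real"
    using blinfun.scaleR_right[of l "blinfun_apply \<Phi> id_blinfun" 1] by simp
  ultimately have "blinfun_apply \<Phi> l = blinfun_apply l (blinfun_apply \<Phi> id_blinfun)" for l
    by (metis real_scaleR_def mult.commute)
  then show "\<exists>x. \<forall>l. blinfun_apply \<Phi> l = blinfun_apply l x" by blast
qed

section \<open>Composition with bi-Lipschitz maps\<close>

lemma measure_cbox_One:
  fixes x :: "'a::euclidean_space"
  assumes "0 \<le> r"
  shows "measure lebesgue (cbox (x - r *\<^sub>R One) (x + r *\<^sub>R One)) = (2 * r) ^ DIM('a)"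
proof -
  have "cbox (x - r *\<^sub>R One) (x + r *\<^sub>R One) \<noteq> {}"
    using assms by (simp add: box_ne_empty inner_diff_left inner_add_left)
  then show ?thesis by (simp add: content_cbox' inner_diff_left inner_add_left)
qed

text \<open>A continuous map that sends null sets to null sets preserves measurability; the
  Lipschitz bound gives both properties.\<close>

lemma Lipschitz_image_lebesgue:
  fixes f :: "'a::euclidean_space \<Rightarrow> 'a"
  assumes A: "A \<in> sets lebesgue" and lip: "\<And>x y. x \<in> A \<Longrightarrow> y \<in> A \<Longrightarrow> norm (f x - f y) \<le> B * norm (x - y)"
  shows "f ` A \<in> sets lebesgue"
proof (rule sets_lebesgue_continuous_image[OF A _ _ order_refl])
  show "continuous_on A f"
  proof -
    have "norm (f x - f y) \<le> \<bar>B\<bar> * norm (x - y)" if "x \<in> A" "y \<in> A" for x y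
      using lip[OF that] mult_right_mono[OF abs_ge_self[of B] norm_ge_zero[of "x - y"]] by linarith
    then have "\<bar>B\<bar>-lipschitz_on A f" by (intro lipschitz_onI) (auto simp: dist_norm)
    then show ?thesis by (rule lipschitz_on_continuous_on)
  qed
  show "negligible (f ` T)" if "negligible T" "T \<subseteq> A" for T
    by (rule negligible_locally_Lipschitz_image[OF order_refl that(1)])
       (use lip that(2) in \<open>intro exI[of _ UNIV] exI[of _ B], auto\<close>)
qed

text \<open>Cover \<open>A\<close> by almost disjoint dyadic cubes of total measure at most that of
  \<open>A\<close> plus \<open>e\<close>. A cube of side s is mapped into one of half-side
  \<open>B * (DIM('a) * s)\<close>, the Euclidean norm being bounded by the sum of coordinates; this
  gives the factor \<open>(2 * B * DIM('a)) ^ DIM('a)\<close>.\<close>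

lemma Lipschitz_image_measure_le:
  fixes f :: "'a::euclidean_space \<Rightarrow> 'a"
  assumes A: "A \<in> lmeasurable" "bounded A" and B: "0 \<le> B"
    and lip: "\<And>x y. x \<in> A \<Longrightarrow> y \<in> A \<Longrightarrow> norm (f x - f y) \<le> B * norm (x - y)"
  shows "f ` A \<in> lmeasurable" "measure lebesgue (f ` A) \<le> (2 * B * DIM('a)) ^ DIM('a) * measure lebesgue A"
proof -
  let ?C = "(2 * B * DIM('a)) ^ DIM('a)"
  have sets: "f ` A \<in> sets lebesgue" using A lip by (intro Lipschitz_image_lebesgue[of A f B]) auto
  have C0: "?C \<ge> 0" using B by simp
  obtain c where c: "\<And>x. x \<in> A \<Longrightarrow> norm x \<le> c" using A(2) by (auto simp: bounded_iff)
  \<comment> \<open>A cube, not just a box, so that the dyadic pieces have equal sides.\<close>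
  let ?a = "- c *\<^sub>R One :: 'a" and ?b = "c *\<^sub>R One :: 'a"
  have sub: "A \<subseteq> cbox ?a ?b"
  proof
    fix x assume x: "x \<in> A"
    have "- c \<le> x \<bullet> i \<and> x \<bullet> i \<le> c" if "i \<in> Basis" for i
      using c[OF x] Basis_le_norm[OF that, of x] by linarith
    then show "x \<in> cbox ?a ?b" by (simp add: mem_box)
  qed
  have main: "f ` A \<in> lmeasurable \<and> measure lebesgue (f ` A) \<le> ?C * (measure lebesgue A + e)" if e: "e > 0" for e
  proof (rule measurable_outer_intervals_bounded[OF A(1) sub e])
    fix \<D>
    assume D: "countable \<D>" "\<And>K. K \<in> \<D> \<Longrightarrow> K \<subseteq> cbox ?a ?b \<and> K \<noteq> {} \<and> (\<exists>c d. K = cbox c d)"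
      "pairwise (\<lambda>A B. interior A \<inter> interior B = {}) \<D>"
      "\<And>u v. cbox u v \<in> \<D> \<Longrightarrow> \<exists>n. \<forall>i\<in>Basis. v \<bullet> i - u \<bullet> i = (?b \<bullet> i - ?a \<bullet> i) / 2 ^ n"
      "A \<subseteq> \<Union>\<D>" "\<Union>\<D> \<in> lmeasurable" "measure lebesgue (\<Union>\<D>) \<le> measure lebesgue A + e"
    have "\<exists>G. G \<in> lmeasurable \<and> f ` (A \<inter> K) \<subseteq> G \<and> measure lebesgue G \<le> ?C * measure lebesgue K" if K: "K \<in> \<D>" for K
    proof (cases "A \<inter> K = {}")
      case True
      then show ?thesis using C0 by (intro exI[of _ "{}"]) auto
    next
      case False
      then obtain x0 where x0: "x0 \<in> A" "x0 \<in> K" by blast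
      obtain u v where uv: "K = cbox u v" using D(2)[OF K] by blast
      obtain n where n: "\<And>i. i \<in> Basis \<Longrightarrow> v \<bullet> i - u \<bullet> i = (?b \<bullet> i - ?a \<bullet> i) / 2 ^ n"
        using D(4) K uv by blast
      define s where "s = (c - - c) / 2 ^ n"
      have s: "v \<bullet> i - u \<bullet> i = s" if "i \<in> Basis" for i using n[OF that] that by (simp add: s_def)
      obtain i0 :: 'a where "i0 \<in> Basis" using nonempty_Basis by blast
      then have "u \<bullet> i0 \<le> x0 \<bullet> i0 \<and> x0 \<bullet> i0 \<le> v \<bullet> i0" using x0(2) uv by (auto simp: mem_box)
      then have s0: "s \<ge> 0" using s[OF \<open>i0 \<in> Basis\<close>] by linarith
      let ?r = "B * (DIM('a) * s)"
      have r0: "?r \<ge> 0" using B s0 by simp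
      let ?G = "cbox (f x0 - ?r *\<^sub>R One) (f x0 + ?r *\<^sub>R One)"
      have "f x \<in> ?G" if x: "x \<in> A" "x \<in> K" for x
      proof -
        have "norm (x - x0) \<le> (\<Sum>i\<in>Basis. \<bar>(x - x0) \<bullet> i\<bar>)" by (rule norm_le_l1)
        also have "\<dots> \<le> (\<Sum>i\<in>(Basis::'a set). s)"
        proof (rule sum_mono)
          fix i :: 'a assume i: "i \<in> Basis"
          have "u \<bullet> i \<le> x \<bullet> i" "x \<bullet> i \<le> v \<bullet> i" "u \<bullet> i \<le> x0 \<bullet> i" "x0 \<bullet> i \<le> v \<bullet> i"
            using x(2) x0(2) uv i by (auto simp: mem_box)
          then show "\<bar>(x - x0) \<bullet> i\<bar> \<le> s" using s[OF i] by (simp add: inner_diff_left)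
        qed
        finally have "norm (f x - f x0) \<le> ?r" using lip[OF x(1) x0(1)] B by (auto intro: order_trans mult_left_mono)
        then have "\<bar>(f x - f x0) \<bullet> i\<bar> \<le> ?r" if "i \<in> Basis" for i
          using Basis_le_norm[OF that, of "f x - f x0"] by linarith
        then have "f x0 \<bullet> i - ?r \<le> f x \<bullet> i \<and> f x \<bullet> i \<le> f x0 \<bullet> i + ?r" if "i \<in> Basis" for i
          using that by (fastforce simp: inner_diff_left abs_le_iff)
        then show ?thesis by (simp add: mem_box inner_diff_left inner_add_left)
      qed
      moreover have "measure lebesgue ?G = ?C * measure lebesgue K"
      proof -
        have "K \<noteq> {}" using x0 by blast
        then have "measure lebesgue K = s ^ DIM('a)" using s uv by (simp add: content_cbox')
        then show ?thesis unfolding measure_cbox_One[OF r0] by (simp add: power_mult_distrib)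
      qed
      ultimately show ?thesis by (intro exI[of _ ?G]) auto
    qed
    then have "\<exists>G. \<forall>K\<in>\<D>. G K \<in> lmeasurable \<and> f ` (A \<inter> K) \<subseteq> G K \<and> measure lebesgue (G K) \<le> ?C * measure lebesgue K"
      by (intro bchoice ballI)
    then obtain G where "\<forall>K\<in>\<D>. G K \<in> lmeasurable \<and> f ` (A \<inter> K) \<subseteq> G K \<and> measure lebesgue (G K) \<le> ?C * measure lebesgue K" ..
    then have G: "\<And>K. K \<in> \<D> \<Longrightarrow> G K \<in> lmeasurable" "\<And>K. K \<in> \<D> \<Longrightarrow> f ` (A \<inter> K) \<subseteq> G K"
      "\<And>K. K \<in> \<D> \<Longrightarrow> measure lebesgue (G K) \<le> ?C * measure lebesgue K" by blast+
    have fin: "measure lebesgue (\<Union>(G ` I)) \<le> ?C * (measure lebesgue A + e)" if I: "I \<subseteq> \<D>" "finite I" for I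
    proof -
      have neg: "pairwise (\<lambda>S T. negligible (S \<inter> T)) I"
      proof (rule pairwiseI)
        fix S T assume ST: "S \<in> I" "T \<in> I" "S \<noteq> T"
        have ST': "S \<in> \<D>" "T \<in> \<D>" using I(1) ST by auto
        from D(2)[OF ST'(1)] obtain a b where "S = cbox a b" by blast
        moreover from D(2)[OF ST'(2)] obtain a' b' where "T = cbox a' b'" by blast
        ultimately have ab: "S = cbox a b" "T = cbox a' b'" by simp_all
        have "interior S \<inter> interior T = {}" using pairwiseD[OF D(3) ST' ST(3)] .
        then show "negligible (S \<inter> T)" unfolding ab
          by (intro negligible_convex_interior[THEN iffD2] convex_Int convex_box) simp
      qed
      have cb: "S \<in> lmeasurable" if "S \<in> I" for S
      proof -
        have "S \<in> \<D>" using I(1) that by auto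
        from D(2)[OF this] obtain a b where "S = cbox a b" by blast
        then show ?thesis by simp
      qed
      have "measure lebesgue (\<Union>(G ` I)) \<le> (\<Sum>K\<in>I. measure lebesgue (G K))"
        using G(1) I by (intro measure_UNION_le) auto
      also have "\<dots> \<le> (\<Sum>K\<in>I. ?C * measure lebesgue K)" using G(3) I by (intro sum_mono) auto
      also have "\<dots> = ?C * measure lebesgue (\<Union>I)"
        using measure_negligible_finite_Union[OF I(2) cb neg] by (simp add: sum_distrib_left)
      also have "\<dots> \<le> ?C * measure lebesgue (\<Union>\<D>)"
        using I D(6) cb C0 by (intro mult_left_mono measure_mono_fmeasurable) auto
      also have "\<dots> \<le> ?C * (measure lebesgue A + e)" using D(7) C0 by (intro mult_left_mono)
      finally show ?thesis .
    qed
    have un: "(\<Union>K\<in>\<D>. G K) \<in> lmeasurable" "measure lebesgue (\<Union>K\<in>\<D>. G K) \<le> ?C * (measure lebesgue A + e)"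
      using fmeasurable_UN_bound[OF D(1) G(1) fin] measure_UN_bound[OF D(1) G(1) fin] by auto
    have im: "f ` A \<subseteq> (\<Union>K\<in>\<D>. G K)"
    proof
      fix y assume "y \<in> f ` A"
      then obtain x where x: "x \<in> A" "y = f x" by blast
      then obtain K where "K \<in> \<D>" "x \<in> K" using D(5) by blast
      then show "y \<in> (\<Union>K\<in>\<D>. G K)" using G(2) x by blast
    qed
    have "f ` A \<in> lmeasurable" by (rule fmeasurableI2[OF un(1) im sets])
    moreover have "measure lebesgue (f ` A) \<le> ?C * (measure lebesgue A + e)"
      using measure_mono_fmeasurable[OF im sets un(1)] un(2) by linarith
    ultimately show ?thesis ..
  qed
  show "f ` A \<in> lmeasurable" using main[of 1] by simp
  show "measure lebesgue (f ` A) \<le> ?C * measure lebesgue A"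
  proof (rule tendsto_lowerbound)
    show "((\<lambda>e. ?C * (measure lebesgue A + e)) \<longlongrightarrow> ?C * measure lebesgue A) (at_right 0)"
      by (auto intro!: tendsto_eq_intros)
    show "\<forall>\<^sub>F e in at_right 0. measure lebesgue (f ` A) \<le> ?C * (measure lebesgue A + e)"
      using main by (auto simp: eventually_at_right_field intro!: exI[of _ 1])
  qed simp
qed

text \<open>
  Only \<open>\<phi>\<close> has to be Lipschitz: it enlarges measures by at most the factor \<open>C\<close>, and this bounds
  composition with \<open>\<psi>\<close> on \<open>L\<^sup>2\<close>.
\<close>

locale lipschitz_inverse =
  fixes \<Omega> :: "'a::euclidean_space set" and \<psi> \<phi> :: "'a \<Rightarrow> 'a" and B :: real
  assumes \<Omega>: "\<Omega> \<in> sets lebesgue" "bounded \<Omega>" and B: "0 \<le> B"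
    and \<psi>: "\<And>x. x \<in> \<Omega> \<Longrightarrow> \<psi> x \<in> \<Omega>" and \<phi>: "\<And>x. x \<in> \<Omega> \<Longrightarrow> \<phi> x \<in> \<Omega>"
    and inv: "\<And>x. x \<in> \<Omega> \<Longrightarrow> \<psi> (\<phi> x) = x" "\<And>x. x \<in> \<Omega> \<Longrightarrow> \<phi> (\<psi> x) = x"
    and lip: "\<And>x y. x \<in> \<Omega> \<Longrightarrow> y \<in> \<Omega> \<Longrightarrow> norm (\<phi> x - \<phi> y) \<le> B * norm (x - y)"
begin

definition C :: real where "C = (2 * B * DIM('a)) ^ DIM('a)"

lemma C_nonneg: "0 \<le> C" using B by (simp add: C_def)

lemma \<Omega>_lmeasurable: "\<Omega> \<in> lmeasurable"
  using \<Omega> by (rule bounded_set_imp_lmeasurable[rotated])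

sublocale complete_finite_measure "lebesgue_on \<Omega>"
  by (rule complete_finite_measure_lebesgue_on[OF \<Omega>_lmeasurable])

lemma vimage_eq: "A \<subseteq> \<Omega> \<Longrightarrow> \<psi> -` A \<inter> \<Omega> = \<phi> ` A"
  using inv \<psi> \<phi> by (auto simp: image_iff subset_eq) metis

lemma measurable_\<psi>: "\<psi> \<in> measurable (lebesgue_on \<Omega>) (lebesgue_on \<Omega>)"
proof (rule measurableI)
  fix A assume "A \<in> sets (lebesgue_on \<Omega>)"
  then have A: "A \<in> sets lebesgue" "A \<subseteq> \<Omega>" using \<Omega>(1) by (auto simp: sets_restrict_space_iff)
  have "\<phi> ` A \<in> sets lebesgue" using A lip by (intro Lipschitz_image_lebesgue[of A \<phi> B]) auto
  then show "\<psi> -` A \<inter> space (lebesgue_on \<Omega>) \<in> sets (lebesgue_on \<Omega>)"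
    using vimage_eq[OF A(2)] A(2) \<phi> \<Omega>(1) by (auto simp: sets_restrict_space_iff)
qed (use \<psi> in auto)

lemma emeasure_vimage_le:
  assumes "A \<in> sets (lebesgue_on \<Omega>)"
  shows "emeasure (lebesgue_on \<Omega>) (\<psi> -` A \<inter> \<Omega>) \<le> ennreal C * emeasure (lebesgue_on \<Omega>) A"
proof -
  have A: "A \<in> sets lebesgue" "A \<subseteq> \<Omega>" using assms \<Omega>(1) by (auto simp: sets_restrict_space_iff)
  have bA: "bounded A" using A(2) \<Omega>(2) bounded_subset by blast
  have Al: "A \<in> lmeasurable" using A(1) bA by (rule bounded_set_imp_lmeasurable[rotated])
  have im: "\<phi> ` A \<in> lmeasurable" "measure lebesgue (\<phi> ` A) \<le> C * measure lebesgue A"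
    unfolding C_def using Al bA B lip A(2) by (intro Lipschitz_image_measure_le; auto)+
  have "\<phi> ` A \<subseteq> \<Omega>" using A(2) \<phi> by auto
  then show ?thesis
    using im A Al C_nonneg \<Omega>(1) vimage_eq[OF A(2)]
    by (simp add: emeasure_restrict_space emeasure_eq_measure2 ennreal_mult[symmetric])
qed

text \<open>The image of the measure under \<open>\<psi>\<close> is dominated by \<open>C\<close>
  times the measure itself.\<close>

lemma nn_integral_\<psi>_le:
  assumes h: "h \<in> borel_measurable (lebesgue_on \<Omega>)"
  shows "(\<integral>\<^sup>+x. h (\<psi> x) \<partial>lebesgue_on \<Omega>) \<le> ennreal C * (\<integral>\<^sup>+x. h x \<partial>lebesgue_on \<Omega>)"
proof -
  let ?M = "lebesgue_on \<Omega>"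
  have "emeasure (distr ?M ?M \<psi>) A \<le> emeasure (scale_measure (ennreal C) ?M) A" for A
  proof (cases "A \<in> sets ?M")
    case True
    then show ?thesis using emeasure_vimage_le[OF True] by (simp add: emeasure_distr[OF measurable_\<psi>])
  next
    case False
    then show ?thesis by (simp add: emeasure_notin_sets)
  qed
  then have "distr ?M ?M \<psi> \<le> scale_measure (ennreal C) ?M"
    by (auto simp: le_measure_iff le_fun_def space_scale_measure)
  then have "nn_integral (distr ?M ?M \<psi>) h \<le> nn_integral (scale_measure (ennreal C) ?M) h"
    by (intro nn_integral_mono_measure) auto
  then show ?thesis using h by (simp add: nn_integral_distr[OF measurable_\<psi>] nn_integral_scale_measure)
qed

text \<open>This makes composition with \<open>\<psi>\<close> independent of the
  representative.\<close>

lemma AE_\<psi>: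
  assumes "AE x in lebesgue_on \<Omega>. P x"
  shows "AE x in lebesgue_on \<Omega>. P (\<psi> x)"
proof -
  obtain N where N: "{x \<in> \<Omega>. \<not> P x} \<subseteq> N" "N \<in> null_sets (lebesgue_on \<Omega>)"
    using assms by (auto simp: eventually_ae_filter)
  have "emeasure (lebesgue_on \<Omega>) (\<psi> -` N \<inter> \<Omega>) = 0"
    using emeasure_vimage_le[OF null_setsD2[OF N(2)]] null_setsD1[OF N(2)] by simp
  moreover have "\<psi> -` N \<inter> \<Omega> \<in> sets (lebesgue_on \<Omega>)"
    using measurable_sets[OF measurable_\<psi>, of N] N(2) by auto
  ultimately have "\<psi> -` N \<inter> \<Omega> \<in> null_sets (lebesgue_on \<Omega>)" by auto
  then show ?thesis by (rule AE_I') (use N(1) \<psi> in auto)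
qed

lemma L2_compose:
  fixes f :: "'a \<Rightarrow> 'b::real_normed_vector"
  assumes f: "f \<in> L2 (lebesgue_on \<Omega>)"
  shows "(\<lambda>x. f (\<psi> x)) \<in> L2 (lebesgue_on \<Omega>)"
    "L2_norm (lebesgue_on \<Omega>) (\<lambda>x. f (\<psi> x)) \<le> sqrt C * L2_norm (lebesgue_on \<Omega>) f"
proof -
  let ?M = "lebesgue_on \<Omega>"
  obtain s where s: "\<And>i::nat. simple_function ?M (s i)" "AE x in ?M. (\<lambda>i. s i x) \<longlonglongrightarrow> f x"
    using L2D(1)[OF f] by (auto simp: strongly_measurable_def)
  have "simple_function ?M (\<lambda>x. s i (\<psi> x))" for i
    unfolding simple_function_def
  proof (intro conjI ballI)
    show "finite ((\<lambda>x. s i (\<psi> x)) ` space ?M)"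
      by (rule finite_subset[OF _ simple_functionD(1)[OF s(1)[of i]]]) (use \<psi> in auto)
    fix y
    have "(\<lambda>x. s i (\<psi> x)) -` {y} \<inter> space ?M = \<psi> -` (s i -` {y} \<inter> space ?M) \<inter> space ?M"
      using \<psi> by auto
    then show "(\<lambda>x. s i (\<psi> x)) -` {y} \<inter> space ?M \<in> sets ?M"
      using measurable_sets[OF measurable_\<psi> simple_functionD(2)[OF s(1)]] by simp
  qed
  then have sm: "strongly_measurable ?M (\<lambda>x. f (\<psi> x))"
    unfolding strongly_measurable_def using AE_\<psi>[OF s(2)] by (intro exI[of _ "\<lambda>i x. s i (\<psi> x)"] conjI allI)
  have [measurable]: "(\<lambda>x. norm (f x)) \<in> borel_measurable ?M" by (rule L2D(3)[OF f])
  have m: "(\<lambda>x. norm (f (\<psi> x))) \<in> borel_measurable ?M" by (rule borel_measurable_norm_strongly[OF sm])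
  have "(\<integral>\<^sup>+x. ennreal ((norm (f (\<psi> x)))\<^sup>2) \<partial>?M) \<le> ennreal C * (\<integral>\<^sup>+x. ennreal ((norm (f x))\<^sup>2) \<partial>?M)"
    by (rule nn_integral_\<psi>_le) measurable
  also have "\<dots> = ennreal C * ennreal ((L2_norm ?M f)\<^sup>2)"
    using L2D(2)[OF f] by (simp add: nn_integral_eq_integral L2_norm_sq)
  also have "\<dots> = ennreal (C * (L2_norm ?M f)\<^sup>2)" using C_nonneg by (simp add: ennreal_mult)
  finally have le: "(\<integral>\<^sup>+x. ennreal ((norm (f (\<psi> x)))\<^sup>2) \<partial>?M) \<le> ennreal (C * (L2_norm ?M f)\<^sup>2)" .
  have int: "integrable ?M (\<lambda>x. (norm (f (\<psi> x)))\<^sup>2)"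
    using m le by (intro integrableI_nonneg) (auto simp: less_top[symmetric] top_unique)
  then show "(\<lambda>x. f (\<psi> x)) \<in> L2 ?M" using sm by (simp add: L2_def)
  have "ennreal (\<integral>x. (norm (f (\<psi> x)))\<^sup>2 \<partial>?M) \<le> ennreal (C * (L2_norm ?M f)\<^sup>2)"
    using le int by (simp add: nn_integral_eq_integral)
  then have "(L2_norm ?M (\<lambda>x. f (\<psi> x)))\<^sup>2 \<le> C * (L2_norm ?M f)\<^sup>2" using C_nonneg by (simp add: L2_norm_sq)
  then have "sqrt ((L2_norm ?M (\<lambda>x. f (\<psi> x)))\<^sup>2) \<le> sqrt (C * (L2_norm ?M f)\<^sup>2)" by (rule real_sqrt_le_mono)
  then show "L2_norm ?M (\<lambda>x. f (\<psi> x)) \<le> sqrt C * L2_norm ?M f"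
    by (simp add: real_sqrt_mult)
qed

end

text \<open>Truncate \<open>T\<close> at level n, then truncate continuous functions that converge
  to \<open>T\<close> almost everywhere at the same level. The common bound makes dominated
  convergence applicable.\<close>

lemma L2_bounded_continuous_dense:
  fixes T :: "'a::euclidean_space \<Rightarrow> real"
  assumes \<Omega>: "\<Omega> \<in> lmeasurable" and T: "T \<in> L2 (lebesgue_on \<Omega>)" and e: "0 < e"
  shows "\<exists>S c. continuous_on UNIV S \<and> (\<forall>x. \<bar>S x\<bar> \<le> c) \<and> S \<in> L2 (lebesgue_on \<Omega>) \<and>
    L2_norm (lebesgue_on \<Omega>) (\<lambda>x. T x - S x) < e"
proof -
  interpret complete_finite_measure "lebesgue_on \<Omega>" by (rule complete_finite_measure_lebesgue_on[OF \<Omega>])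
  let ?M = "lebesgue_on \<Omega>"
  have \<Omega>s: "\<Omega> \<in> sets lebesgue" using \<Omega> by (simp add: fmeasurableD)
  have Tm: "T \<in> borel_measurable ?M" using T L2_real_iff by blast
  define clamp where "clamp n y = max (- real n) (min (real n) y)" for n y
  have cont: "continuous_on UNIV (clamp n)" for n unfolding clamp_def by (intro continuous_intros)
  have clamp_le: "\<bar>clamp n y\<bar> \<le> real n" "\<bar>clamp n y\<bar> \<le> \<bar>y\<bar>" "\<bar>clamp n y - y\<bar> \<le> \<bar>y\<bar>" for n y by (auto simp: clamp_def)
  have clampm: "clamp n \<in> borel_measurable borel" for n by (rule borel_measurable_continuous_onI[OF cont])
  have cL: "(\<lambda>x. clamp n (f x)) \<in> L2 ?M" if "f \<in> borel_measurable ?M" for n and f :: "'a \<Rightarrow> real"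
  proof (rule L2_bounded[of _ "real n"])
    show "strongly_measurable ?M (\<lambda>x. clamp n (f x))"
      using measurable_compose[OF that clampm] by (simp add: strongly_measurable_iff_borel)
  qed (simp add: clamp_le)
  have "(\<lambda>n. L2_norm ?M (\<lambda>x. clamp n (T x) - T x)) \<longlonglongrightarrow> 0"
  proof (rule L2_dominated_LIMSEQ[OF T cL[OF Tm] T])
    show "AE x in ?M. (\<lambda>n. clamp n (T x)) \<longlonglongrightarrow> T x"
    proof (intro AE_I2 tendsto_eventually)
      fix x
      obtain N :: nat where "\<bar>T x\<bar> \<le> real N" using real_arch_simple by blast
      then have "clamp n (T x) = T x" if "n \<ge> N" for n using that by (auto simp: clamp_def max_def min_def)
      then show "\<forall>\<^sub>F n in sequentially. clamp n (T x) = T x" by (auto simp: eventually_sequentially)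
    qed
  qed (simp add: clamp_le)
  from LIMSEQ_D[OF this, of "e/2"] e obtain n where n: "L2_norm ?M (\<lambda>x. clamp n (T x) - T x) < e / 2" by auto
  have "T measurable_on \<Omega>" using Tm \<Omega>s by (simp add: measurable_on_iff_borel_measurable)
  then obtain N g where N: "negligible N" and g: "\<And>k::nat. continuous_on UNIV (g k)"
    "\<And>x. x \<notin> N \<Longrightarrow> (\<lambda>k. g k x) \<longlonglongrightarrow> (if x \<in> \<Omega> then T x else 0)"
    unfolding measurable_on_def by blast
  have "AE x in ?M. x \<notin> N"
    using N \<Omega>s by (auto simp: AE_restrict_space_iff negligible_iff_null_sets intro!: AE_not_in[THEN eventually_mono])
  then have lim: "AE x in ?M. (\<lambda>k. g k x) \<longlonglongrightarrow> T x"
    using AE_space by eventually_elim (use g(2) in force)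
  have gm: "g k \<in> borel_measurable ?M" for k
    by (rule measurable_restrict_space1[OF measurable_completion]) (simp add: borel_measurable_continuous_onI g(1))
  have "(\<lambda>k. L2_norm ?M (\<lambda>x. clamp n (g k x) - clamp n (T x))) \<longlonglongrightarrow> 0"
  proof (rule L2_dominated_LIMSEQ[OF cL[OF Tm] cL[OF gm] L2_const[of "2 * real n"]])
    show "AE x in ?M. (\<lambda>k. clamp n (g k x)) \<longlonglongrightarrow> clamp n (T x)"
      using lim by eventually_elim (auto simp: clamp_def intro!: tendsto_intros)
    have "\<bar>clamp n a - clamp n b\<bar> \<le> 2 * real n" for a b using clamp_le(1)[of n a] clamp_le(1)[of n b] by linarith
    then show "AE x in ?M. norm (clamp n (g k x) - clamp n (T x)) \<le> norm (2 * real n)" for k by simp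
  qed
  from LIMSEQ_D[OF this, of "e/2"] e obtain k where k: "L2_norm ?M (\<lambda>x. clamp n (g k x) - clamp n (T x)) < e / 2" by auto
  show ?thesis
  proof (intro exI conjI allI)
    show "continuous_on UNIV (\<lambda>x. clamp n (g k x))"
      by (rule continuous_on_compose2[OF cont g(1)]) auto
    show "\<bar>clamp n (g k x)\<bar> \<le> real n" for x by (rule clamp_le)
    show "(\<lambda>x. clamp n (g k x)) \<in> L2 ?M" by (rule cL[OF gm])
    show "L2_norm ?M (\<lambda>x. T x - clamp n (g k x)) < e"
      using L2_norm_triangle4[OF cL[OF gm] cL[OF Tm] T, of n k n] n k L2_norm_minus_commute[of T "\<lambda>x. clamp n (g k x)"] by simp
  qed
qed

section \<open>Caratheodory differential equations with square-integrable velocity\<close>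

interpretation time: complete_finite_measure "lebesgue_on {0..1::real}"
  by (rule complete_finite_measure_lebesgue_on) simp

text \<open>Time reversal as a self-inverse Lipschitz map. The general constant evaluates to 2
  instead of the sharp 1; this suffices for bounds on reversed velocities.\<close>

interpretation reflection: lipschitz_inverse "{0..1::real}" "\<lambda>s. 1 - s" "\<lambda>s. 1 - s" 1
  by unfold_locales auto

lemma integral_reflect_unit:
  fixes f :: "real \<Rightarrow> 'a::euclidean_space"
  assumes "integrable (lebesgue_on {0..1}) f" "t \<in> {0..1}"
  shows "(\<integral>s. f (1 - s) \<partial>lebesgue_on {0..t}) = (\<integral>s. f s \<partial>lebesgue_on {1 - t..1})"
proof -
  have "(\<integral>s. f s \<partial>lebesgue_on {1 - t..1}) = (\<integral>s. (if s \<in> {1 - t..1} then f s else 0) \<partial>lebesgue)"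
    by (rule Lebesgue_Measure.integral_restrict_UNIV[symmetric]) simp
  also have "\<dots> = (\<integral>s. (if 1 + (-1) * s \<in> {1 - t..1} then f (1 + (-1) * s) else 0) \<partial>lebesgue)"
    by (subst lebesgue_integral_real_affine[of "-1" _ 1]) simp_all
  also have "\<dots> = (\<integral>s. (if s \<in> {0..t} then f (1 - s) else 0) \<partial>lebesgue)"
    by (intro Bochner_Integration.integral_cong) auto
  also have "\<dots> = (\<integral>s. f (1 - s) \<partial>lebesgue_on {0..t})"
    by (rule Lebesgue_Measure.integral_restrict_UNIV) simp
  finally show ?thesis ..
qed

lemma integral_exp_le:
  fixes \<mu> t :: real
  assumes "0 < \<mu>" "0 \<le> t"
  shows "(\<integral>s. exp (\<mu> * s) \<partial>lebesgue_on {0..t}) \<le> exp (\<mu> * t) / \<mu>"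
proof -
  have "((\<lambda>s. exp (\<mu> * s)) has_integral (exp (\<mu> * t) / \<mu> - exp (\<mu> * 0) / \<mu>)) {0..t}"
    using assms by (intro fundamental_theorem_of_calculus)
      (auto intro!: derivative_eq_intros simp flip: has_real_derivative_iff_has_vector_derivative)
  moreover have "integrable (lebesgue_on {0..t}) (\<lambda>s. exp (\<mu> * s))"
    by (intro continuous_imp_integrable_real continuous_intros)
  ultimately have "(\<integral>s. exp (\<mu> * s) \<partial>lebesgue_on {0..t}) = exp (\<mu> * t) / \<mu> - exp (\<mu> * 0) / \<mu>"
    by (simp add: lebesgue_integral_eq_integral integral_unique)
  then show ?thesis using assms by simp
qed

lemma continuous_L2:
  fixes u :: "real \<Rightarrow> 'a::euclidean_space"
  assumes "continuous_on {0..1} u"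
  shows "u \<in> L2 (lebesgue_on {0..1})"
proof -
  have "bounded (u ` {0..1})" by (intro compact_imp_bounded compact_continuous_image assms) simp
  then obtain c where c: "\<And>s. s \<in> {0..1} \<Longrightarrow> norm (u s) \<le> c" unfolding bounded_iff by blast
  have "u \<in> borel_measurable (lebesgue_on {0..1})"
    using continuous_imp_integrable_real[OF assms] by (rule borel_measurable_integrable)
  then show ?thesis
    by (intro time.L2_bounded[of u c]) (auto simp: time.strongly_measurable_iff_borel c intro!: AE_I2)
qed

text \<open>
  The weight \<open>exp (2 K\<^sup>2 s)\<close> makes integration against \<open>g\<close> a contraction; as \<open>g\<close> is
  square-integrable, an exponential of \<open>s\<close> can be used in place of one of \<open>\<integral>\<^sub>0\<^sup>s g\<close>.
\<close>

lemma integral_exp_weight_le: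
  assumes g: "g \<in> L2 (lebesgue_on {0..1})" and K: "L2_norm (lebesgue_on {0..1}) g \<le> K" "0 < K"
    and t: "t \<in> {0..1::real}"
  shows "(\<integral>s. g s * exp (2 * K\<^sup>2 * s) \<partial>lebesgue_on {0..t}) \<le> exp (2 * K\<^sup>2 * t) / 2"
proof -
  \<comment> \<open>The weight in the arithmetic-geometric mean inequality, chosen so that both
    resulting terms are at most \<open>exp (2 * K\<^sup>2 * t) / 4\<close>.\<close>
  define k where "k = exp (2 * K\<^sup>2 * t) / (2 * K\<^sup>2)"
  have k: "k > 0" using K by (simp add: k_def)
  have sub: "{0..t} \<subseteq> {0..1}" using t by auto
  have int1: "integrable (lebesgue_on {0..1}) (\<lambda>s. g s * exp (2 * K\<^sup>2 * s))"
    by (intro time.L2_mult_integrable g continuous_L2 continuous_intros)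
  have int2: "integrable (lebesgue_on {0..1}) (\<lambda>s. (g s)\<^sup>2)" using time.L2D(2)[OF g] by simp
  have int3: "integrable (lebesgue_on {0..1}) (\<lambda>s. exp (4 * K\<^sup>2 * s))"
    by (intro continuous_imp_integrable_real continuous_intros)
  note int = int1[THEN integrable_subinterval, OF sub] int2[THEN integrable_subinterval, OF sub]
    int3[THEN integrable_subinterval, OF sub]
  have am_gm: "g s * exp (2 * K\<^sup>2 * s) \<le> k / 2 * (g s)\<^sup>2 + 1 / (2 * k) * exp (4 * K\<^sup>2 * s)" for s
  proof -
    have e: "exp (4 * K\<^sup>2 * s) = (exp (2 * K\<^sup>2 * s))\<^sup>2" by (simp flip: exp_double)
    have "0 \<le> (k * g s - exp (2 * K\<^sup>2 * s))\<^sup>2 / (2 * k)" using k by simp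
    also have "\<dots> = k / 2 * (g s)\<^sup>2 + 1 / (2 * k) * exp (4 * K\<^sup>2 * s) - g s * exp (2 * K\<^sup>2 * s)"
      unfolding e using k by (simp add: field_simps power2_eq_square)
    finally show ?thesis by simp
  qed
  have "(\<integral>s. g s * exp (2 * K\<^sup>2 * s) \<partial>lebesgue_on {0..t})
      \<le> (\<integral>s. k / 2 * (g s)\<^sup>2 + 1 / (2 * k) * exp (4 * K\<^sup>2 * s) \<partial>lebesgue_on {0..t})"
    using int am_gm by (intro integral_mono) auto
  also have "\<dots> = k / 2 * (\<integral>s. (g s)\<^sup>2 \<partial>lebesgue_on {0..t}) + 1 / (2 * k) * (\<integral>s. exp (4 * K\<^sup>2 * s) \<partial>lebesgue_on {0..t})"
    using int by simp
  also have "\<dots> \<le> k / 2 * K\<^sup>2 + 1 / (2 * k) * (exp (4 * K\<^sup>2 * t) / (4 * K\<^sup>2))"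
  proof (intro add_mono mult_left_mono)
    have "(\<integral>s. (g s)\<^sup>2 \<partial>lebesgue_on {0..t}) \<le> (\<integral>s. (g s)\<^sup>2 \<partial>lebesgue_on {0..1})"
      using int2 sub by (intro integral_mono_lebesgue_on_AE) auto
    also have "\<dots> = (L2_norm (lebesgue_on {0..1}) g)\<^sup>2" by (simp add: time.L2_norm_sq)
    also have "\<dots> \<le> K\<^sup>2" using K by (intro power_mono) auto
    finally show "(\<integral>s. (g s)\<^sup>2 \<partial>lebesgue_on {0..t}) \<le> K\<^sup>2" .
    show "(\<integral>s. exp (4 * K\<^sup>2 * s) \<partial>lebesgue_on {0..t}) \<le> exp (4 * K\<^sup>2 * t) / (4 * K\<^sup>2)"
      using K t by (intro integral_exp_le) auto
  qed (use k in auto)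
  also have "\<dots> = exp (2 * K\<^sup>2 * t) / 2"
  proof -
    have "exp (4 * K\<^sup>2 * t) = (exp (2 * K\<^sup>2 * t))\<^sup>2" by (simp flip: exp_double)
    then show ?thesis using K by (simp add: k_def field_simps power2_eq_square)
  qed
  finally show ?thesis .
qed

text \<open>Let \<open>exp (- \<mu> * s) * u s\<close> attain its maximum m at \<open>t0\<close>.
  There the integral is at most half of \<open>m * exp (\<mu> * t0)\<close>, that is, half of
  \<open>u t0\<close>, and can be absorbed; this is the origin of the factor 2.\<close>

lemma Gronwall_L2:
  assumes g: "g \<in> L2 (lebesgue_on {0..1})" and K: "L2_norm (lebesgue_on {0..1}) g \<le> K" "0 < K"
    and g0: "\<And>s. 0 \<le> g s"
    and u: "continuous_on {0..1::real} u" and u0: "\<And>s. s \<in> {0..1} \<Longrightarrow> 0 \<le> u s" and A: "0 \<le> A"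
    and le: "\<And>t. t \<in> {0..1} \<Longrightarrow> u t \<le> A + (\<integral>s. g s * u s \<partial>lebesgue_on {0..t})"
    and t: "t \<in> {0..1}"
  shows "u t \<le> 2 * A * exp (2 * K\<^sup>2)"
proof -
  define \<mu> where "\<mu> = 2 * K\<^sup>2"
  have \<mu>: "\<mu> \<ge> 0" by (simp add: \<mu>_def)
  have "\<exists>x\<in>{0..1}. \<forall>y\<in>{0..1}. exp (- \<mu> * y) * u y \<le> exp (- \<mu> * x) * u x"
    by (intro continuous_attains_sup continuous_intros u) auto
  then obtain t0 where t0: "t0 \<in> {0..1}" "\<And>y. y \<in> {0..1} \<Longrightarrow> exp (- \<mu> * y) * u y \<le> exp (- \<mu> * t0) * u t0" by blast
  define m where "m = exp (- \<mu> * t0) * u t0"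
  have m0: "m \<ge> 0" using u0[OF t0(1)] by (simp add: m_def)
  have um: "u y \<le> m * exp (\<mu> * y)" if "y \<in> {0..1}" for y
    using t0(2)[OF that] unfolding m_def[symmetric] by (simp add: exp_minus field_simps)
  have ut0: "u t0 = m * exp (\<mu> * t0)" by (simp add: m_def exp_minus)
  have sub: "{0..t0} \<subseteq> {0..1}" using t0 by auto
  have i1: "integrable (lebesgue_on {0..t0}) (\<lambda>s. g s * u s)"
    by (rule integrable_subinterval[OF _ sub]) (intro time.L2_mult_integrable g continuous_L2 u)
  have "integrable (lebesgue_on {0..1}) (\<lambda>s. g s * (m * exp (\<mu> * s)))"
    by (intro time.L2_mult_integrable g continuous_L2 continuous_intros)
  then have i2: "integrable (lebesgue_on {0..t0}) (\<lambda>s. g s * (m * exp (\<mu> * s)))"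
    by (rule integrable_subinterval[OF _ sub])
  have "u t0 \<le> A + (\<integral>s. g s * u s \<partial>lebesgue_on {0..t0})" by (rule le[OF t0(1)])
  also have "\<dots> \<le> A + (\<integral>s. g s * (m * exp (\<mu> * s)) \<partial>lebesgue_on {0..t0})"
    using sub um g0 by (intro add_left_mono integral_mono[OF i1 i2] mult_left_mono) auto
  also have "(\<integral>s. g s * (m * exp (\<mu> * s)) \<partial>lebesgue_on {0..t0}) = m * (\<integral>s. g s * exp (\<mu> * s) \<partial>lebesgue_on {0..t0})"
    by (simp add: mult.left_commute)
  also have "A + \<dots> \<le> A + m * (exp (\<mu> * t0) / 2)"
    unfolding \<mu>_def by (intro add_left_mono mult_left_mono integral_exp_weight_le g K t0 m0)
  finally have "m * exp (\<mu> * t0) \<le> 2 * A" using ut0 by simp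
  moreover have "m * 1 \<le> m * exp (\<mu> * t0)" using t0 \<mu> m0 by (intro mult_left_mono) auto
  ultimately have "m \<le> 2 * A" by simp
  have "u t \<le> m * exp (\<mu> * t)" by (rule um[OF t])
  also have "\<dots> \<le> (2 * A) * exp (\<mu> * 1)" using \<open>m \<le> 2 * A\<close> A m0 \<mu> t by (intro mult_mono) (auto intro: mult_left_le)
  finally show ?thesis by (simp add: \<mu>_def)
qed

text \<open>\<open>w\<close> stands for the fields extended by zero to the whole space, and
  \<open>B\<close> for the constant of the embedding. Working globally separates existence of paths
  from the question whether they stay in the domain.\<close>

locale velocity_field =
  fixes w :: "'v::real_normed_vector \<Rightarrow> 'a::euclidean_space \<Rightarrow> 'a" and B :: real
  assumes B: "0 \<le> B"
    and w_add: "w (u + u') x = w u x + w u' x" and w_scale: "w (c *\<^sub>R u) x = c *\<^sub>R w u x"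
    and w_bound: "norm (w u x) \<le> B * norm u"
    and w_lip: "norm (w u x - w u y) \<le> B * norm u * norm (x - y)"
begin

lemma w_diff: "w (u - u') x = w u x - w u' x"
  using w_add[of u "(-1) *\<^sub>R u'" x] w_scale[of "-1" u' x] by simp

lemma w_minus: "w (- u) x = - w u x"
  using w_scale[of "-1" u x] by simp

lemma w_zero: "w 0 x = 0"
  using w_scale[of 0 0 x] by simp

lemma continuous_w: "continuous_on UNIV (w u)"
proof -
  have "(B * norm u)-lipschitz_on UNIV (w u)" using w_lip B by (intro lipschitz_onI) (auto simp: dist_norm)
  then show ?thesis by (rule lipschitz_on_continuous_on)
qed

text \<open>For simple velocities measurability is a finite sum over level sets; linearity and
  boundedness of \<open>w\<close> in the velocity carry it to the limit.\<close>

lemma field_L2: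
  assumes v: "v \<in> velocities" and c: "continuous_on {0..1} c"
  shows "(\<lambda>s. w (v s) (c s)) \<in> L2 (lebesgue_on {0..1})"
proof -
  let ?M = "lebesgue_on {0..1::real}"
  obtain s where s: "\<And>i::nat. simple_function ?M (s i)" "AE t in ?M. (\<lambda>i. s i t) \<longlonglongrightarrow> v t"
    using time.L2D(1)[OF v] by (auto simp: strongly_measurable_def)
  have wc: "(\<lambda>t. w y (c t)) \<in> borel_measurable ?M" for y
    using continuous_on_compose2[OF continuous_w c] by (intro borel_measurable_integrable continuous_imp_integrable_real) auto
  have meas: "(\<lambda>t. w (s i t) (c t)) \<in> borel_measurable ?M" for i
  proof -
    have "(\<lambda>t. \<Sum>y\<in>s i ` {0..1}. indicator (s i -` {y} \<inter> space ?M) t *\<^sub>R w y (c t)) \<in> borel_measurable ?M"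
      using simple_functionD(2)[OF s(1)[of i]] wc
      by (intro borel_measurable_sum borel_measurable_scaleR borel_measurable_indicator) auto
    moreover have "(\<Sum>y\<in>s i ` {0..1}. indicator (s i -` {y} \<inter> space ?M) t *\<^sub>R w y (c t)) = w (s i t) (c t)"
      if "t \<in> {0..1}" for t
    proof -
      have "(\<Sum>y\<in>s i ` {0..1}. indicator (s i -` {y} \<inter> space ?M) t *\<^sub>R w y (c t)) = (\<Sum>y\<in>s i ` {0..1}. if y = s i t then w y (c t) else 0)"
        using that by (intro sum.cong) (auto simp: indicator_def)
      then show ?thesis using that simple_functionD(1)[OF s(1)[of i]] by (simp add: sum.delta)
    qed
    ultimately show ?thesis by (subst (asm) measurable_lebesgue_cong) auto
  qed
  have "AE t in ?M. (\<lambda>i. w (s i t) (c t)) \<longlonglongrightarrow> w (v t) (c t)"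
    using s(2)
  proof eventually_elim
    case (elim t)
    have "(\<lambda>i. w (s i t) (c t) - w (v t) (c t)) \<longlonglongrightarrow> 0"
    proof (rule Lim_null_comparison)
      show "\<forall>\<^sub>F i in sequentially. norm (w (s i t) (c t) - w (v t) (c t)) \<le> B * norm (s i t - v t)"
        unfolding w_diff[symmetric] using w_bound by simp
      show "(\<lambda>i. B * norm (s i t - v t)) \<longlonglongrightarrow> 0"
        using tendsto_mult_right_zero[OF tendsto_norm_zero[OF LIM_zero[OF elim]]] .
    qed
    then show ?case by (rule LIM_zero_cancel)
  qed
  from time.borel_measurable_AE_LIMSEQ[OF meas this]
  have "strongly_measurable ?M (\<lambda>s. w (v s) (c s))" by (rule strongly_measurable_borel)
  moreover have "norm (w (v s) (c s)) \<le> norm (B *\<^sub>R v s)" for s using w_bound[of "v s" "c s"] B by simp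
  ultimately show ?thesis using time.L2_dominated(1)[OF _ time.L2_scale[OF v, of B]] by auto
qed

lemma field_integrable:
  assumes "v \<in> velocities" "continuous_on {0..1} c"
  shows "integrable (lebesgue_on {0..1}) (\<lambda>s. w (v s) (c s))"
    "t \<in> {0..1} \<Longrightarrow> integrable (lebesgue_on {0..t}) (\<lambda>s. w (v s) (c s))"
proof -
  have f: "(\<lambda>s. w (v s) (c s)) \<in> L2 (lebesgue_on {0..1})" by (rule field_L2[OF assms])
  show 1: "integrable (lebesgue_on {0..1}) (\<lambda>s. w (v s) (c s))"
    using time.L2_integrable[OF time.L2D(4)[OF f]] time.L2D(1)[OF f]
    by (simp add: time.strongly_measurable_iff_borel integrable_norm_iff)
  show "t \<in> {0..1} \<Longrightarrow> integrable (lebesgue_on {0..t}) (\<lambda>s. w (v s) (c s))"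
    by (rule integrable_subinterval[OF 1]) auto
qed

text \<open>The integral equation for the extended field: continuity of the path replaces both the
  integrability and the domain condition of \<open>is_trajectory\<close>.\<close>

definition solves :: "(real \<Rightarrow> 'v) \<Rightarrow> 'a \<Rightarrow> (real \<Rightarrow> 'a) \<Rightarrow> bool" where
  "solves v x c \<longleftrightarrow> continuous_on {0..1} c \<and> (\<forall>t\<in>{0..1}. c t = x + (\<integral>s. w (v s) (c s) \<partial>lebesgue_on {0..t}))"

lemma speed_L2:
  assumes "v \<in> velocities"
  shows "(\<lambda>s. B * norm (v s)) \<in> L2 (lebesgue_on {0..1})"
    "L2_norm (lebesgue_on {0..1}) (\<lambda>s. B * norm (v s)) = B * L2_norm (lebesgue_on {0..1}) v"
  using time.L2_scale[OF time.L2D(4)[OF assms], of B] time.L2_norm_scale[of B "\<lambda>s. norm (v s)"] B by auto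

lemma norm_integral_field_diff_le:
  assumes v: "v \<in> velocities" and c: "continuous_on {0..1} c" "continuous_on {0..1} c'" and t: "t \<in> {0..1}"
  shows "norm ((\<integral>s. w (v s) (c s) \<partial>lebesgue_on {0..t}) - (\<integral>s. w (v s) (c' s) \<partial>lebesgue_on {0..t}))
    \<le> (\<integral>s. (B * norm (v s)) * norm (c s - c' s) \<partial>lebesgue_on {0..t})"
proof -
  have sub: "{0..t} \<subseteq> {0..1}" using t by auto
  have i: "integrable (lebesgue_on {0..t}) (\<lambda>s. (B * norm (v s)) * norm (c s - c' s))"
    by (rule integrable_subinterval[OF _ sub])
       (intro time.L2_mult_integrable speed_L2 v continuous_L2 continuous_intros c)
  have "norm (\<integral>s. w (v s) (c s) - w (v s) (c' s) \<partial>lebesgue_on {0..t})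
      \<le> (\<integral>s. (B * norm (v s)) * norm (c s - c' s) \<partial>lebesgue_on {0..t})"
    using field_integrable(2)[OF v c(1) t] field_integrable(2)[OF v c(2) t] w_lip
    by (intro integral_norm_bound_AE i) auto
  then show ?thesis using field_integrable(2)[OF v c(1) t] field_integrable(2)[OF v c(2) t] by simp
qed

lemma solves_Lipschitz:
  assumes v: "v \<in> velocities" and K: "B * L2_norm (lebesgue_on {0..1}) v \<le> K" "0 < K"
    and c: "solves v x c" "solves v y c'" and t: "t \<in> {0..1}"
  shows "norm (c t - c' t) \<le> 2 * exp (2 * K\<^sup>2) * norm (x - y)"
proof -
  have cont: "continuous_on {0..1} c" "continuous_on {0..1} c'" using c by (auto simp: solves_def)
  have "norm (c t - c' t) \<le> 2 * norm (x - y) * exp (2 * K\<^sup>2)"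
  proof (rule Gronwall_L2[OF speed_L2(1)[OF v] _ K(2) _ _ _ _ _ t])
    show "L2_norm (lebesgue_on {0..1}) (\<lambda>s. B * norm (v s)) \<le> K" using K speed_L2(2)[OF v] by simp
    show "continuous_on {0..1} (\<lambda>s. norm (c s - c' s))" by (intro continuous_intros cont)
    show "norm (c t - c' t) \<le> norm (x - y) + (\<integral>s. (B * norm (v s)) * norm (c s - c' s) \<partial>lebesgue_on {0..t})"
      if t: "t \<in> {0..1}" for t
    proof -
      have "c t - c' t = (x - y) + ((\<integral>s. w (v s) (c s) \<partial>lebesgue_on {0..t}) - (\<integral>s. w (v s) (c' s) \<partial>lebesgue_on {0..t}))"
        using c t by (simp add: solves_def)
      then show ?thesis
        by (simp only:) (rule norm_triangle_le[OF add_left_mono[OF norm_integral_field_diff_le[OF v cont t]]])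
    qed
  qed (use B in auto)
  then show ?thesis by (simp add: mult_ac)
qed

lemma solves_unique:
  assumes v: "v \<in> velocities" and c: "solves v x c" "solves v x c'" and t: "t \<in> {0..1}"
  shows "c t = c' t"
proof -
  have "norm (c t - c' t) \<le> 2 * exp (2 * (B * L2_norm (lebesgue_on {0..1}) v + 1)\<^sup>2) * norm (x - x)"
    using B by (intro solves_Lipschitz[OF v _ _ c t]) (auto intro: add_nonneg_pos)
  then show ?thesis by simp
qed

text \<open>Picard iteration for the rescaled path \<open>exp (- \<mu> * s) *\<^sub>R c s\<close>.
  With \<open>\<mu> = 2 * K\<^sup>2\<close> the weighted integral estimate makes it a contraction
  with factor 1/2 on the whole interval at once.\<close>

lemma solves_exists:
  assumes v: "v \<in> velocities"
  shows "\<exists>c. solves v x c"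
proof -
  define K where "K = B * L2_norm (lebesgue_on {0..1}) v + 1"
  have K: "L2_norm (lebesgue_on {0..1}) (\<lambda>s. B * norm (v s)) \<le> K" "0 < K"
    using B speed_L2(2)[OF v] by (auto simp: K_def intro: add_nonneg_pos)
  define \<mu> where "\<mu> = 2 * K\<^sup>2"
  define e where "e b s = exp (\<mu> * s) *\<^sub>R apply_bcontfun b s" for b :: "real \<Rightarrow>\<^sub>C 'a" and s
  have e_cont: "continuous_on S (e b)" for S b
    unfolding e_def by (intro continuous_intros) auto
  define P where "P b t = exp (- \<mu> * t) *\<^sub>R (x + (\<integral>s. w (v s) (e b s) \<partial>lebesgue_on {0..t}))" for b t
  have P_cont: "continuous_on {0..1} (P b)" for b
    unfolding P_def by (intro continuous_intros indefinite_integral_continuous_real field_integrable v e_cont)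
  \<comment> \<open>Freezing time outside the unit interval turns a path into a bounded continuous
    function on the line, a point of a complete metric space.\<close>
  define clamp where "clamp t = max 0 (min 1 t)" for t :: real
  have clamp: "clamp t \<in> {0..1}" "t \<in> {0..1} \<Longrightarrow> clamp t = t" for t by (auto simp: clamp_def)
  have clamp_cont: "continuous_on UNIV clamp" unfolding clamp_def by (intro continuous_intros)
  have Pb: "(\<lambda>t. P b (clamp t)) \<in> bcontfun" for b
  proof -
    have "continuous_on UNIV (\<lambda>t. P b (clamp t))"
      by (rule continuous_on_compose2[OF P_cont clamp_cont]) (use clamp in auto)
    moreover have "bounded (P b ` {0..1})" by (intro compact_imp_bounded compact_continuous_image P_cont) simp
    then have "bounded (range (\<lambda>t. P b (clamp t)))" by (rule bounded_subset) (use clamp in auto)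
    ultimately show ?thesis by (simp add: bcontfun_def)
  qed
  define F where "F b = Bcontfun (\<lambda>t. P b (clamp t))" for b
  have F: "apply_bcontfun (F b) t = P b (clamp t)" for b t by (simp add: F_def Bcontfun_inverse[OF Pb])
  have "dist (F b) (F b') \<le> 1/2 * dist b b'" for b b'
  proof (rule dist_bound)
    fix t0
    define t where "t = clamp t0"
    have t: "t \<in> {0..1}" using clamp by (simp add: t_def)
    have sub: "{0..t} \<subseteq> {0..1}" using t by auto
    have i1: "integrable (lebesgue_on {0..t}) (\<lambda>s. (B * norm (v s)) * norm (e b s - e b' s))"
      by (rule integrable_subinterval[OF _ sub])
         (intro time.L2_mult_integrable speed_L2 v continuous_L2 continuous_intros e_cont)
    have i2: "integrable (lebesgue_on {0..t}) (\<lambda>s. (B * norm (v s)) * (dist b b' * exp (\<mu> * s)))"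
      by (rule integrable_subinterval[OF _ sub])
         (intro time.L2_mult_integrable speed_L2 v continuous_L2 continuous_intros)
    have eb: "norm (e b s - e b' s) \<le> dist b b' * exp (\<mu> * s)" for s
      using mult_right_mono[OF dist_bounded[of b s b'], of "exp (\<mu> * s)"]
      by (simp add: e_def dist_norm mult.commute flip: scaleR_diff_right)
    have "norm ((\<integral>s. w (v s) (e b s) \<partial>lebesgue_on {0..t}) - (\<integral>s. w (v s) (e b' s) \<partial>lebesgue_on {0..t}))
        \<le> (\<integral>s. (B * norm (v s)) * norm (e b s - e b' s) \<partial>lebesgue_on {0..t})"
      by (rule norm_integral_field_diff_le[OF v e_cont e_cont t])
    also have "\<dots> \<le> (\<integral>s. (B * norm (v s)) * (dist b b' * exp (\<mu> * s)) \<partial>lebesgue_on {0..t})"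
      using B eb by (intro integral_mono i1 i2 mult_left_mono) auto
    also have "\<dots> = dist b b' * (\<integral>s. (B * norm (v s)) * exp (\<mu> * s) \<partial>lebesgue_on {0..t})"
      by (simp add: mult.left_commute flip: Bochner_Integration.integral_mult_right_zero)
    also have "\<dots> \<le> dist b b' * (exp (\<mu> * t) / 2)"
      unfolding \<mu>_def by (intro mult_left_mono integral_exp_weight_le speed_L2 v K t) simp
    finally have main: "norm ((\<integral>s. w (v s) (e b s) \<partial>lebesgue_on {0..t}) - (\<integral>s. w (v s) (e b' s) \<partial>lebesgue_on {0..t}))
        \<le> dist b b' * (exp (\<mu> * t) / 2)" .
    have "dist (F b t0) (F b' t0) = exp (- \<mu> * t) * norm ((\<integral>s. w (v s) (e b s) \<partial>lebesgue_on {0..t}) - (\<integral>s. w (v s) (e b' s) \<partial>lebesgue_on {0..t}))"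
      by (simp add: F P_def t_def[symmetric] dist_norm flip: scaleR_diff_right)
    also have "\<dots> \<le> exp (- \<mu> * t) * (dist b b' * (exp (\<mu> * t) / 2))" by (intro mult_left_mono main) simp
    also have "\<dots> = 1/2 * dist b b'" by (simp add: exp_minus)
    finally show "dist (F b t0) (F b' t0) \<le> 1/2 * dist b b'" .
  qed
  then have "\<exists>!b. F b = b" by (intro banach_fix_type[of "1/2"]) auto
  then obtain b where b: "F b = b" by blast
  have "e b t = x + (\<integral>s. w (v s) (e b s) \<partial>lebesgue_on {0..t})" if "t \<in> {0..1}" for t
  proof -
    have "apply_bcontfun b t = P b t" using F[of b t] clamp(2)[OF that] b by simp
    then show ?thesis by (simp add: e_def[of b t] P_def exp_minus)
  qed
  then have "solves v x (e b)" using e_cont by (simp add: solves_def)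
  then show ?thesis by blast
qed

section \<open>Time reversal and stagnation points\<close>

definition sol :: "(real \<Rightarrow> 'v) \<Rightarrow> 'a \<Rightarrow> real \<Rightarrow> 'a" where
  "sol v x = (SOME c. solves v x c)"

lemma solves_sol: "v \<in> velocities \<Longrightarrow> solves v x (sol v x)"
  unfolding sol_def using solves_exists by (rule someI_ex)

lemma sol_eq: "v \<in> velocities \<Longrightarrow> solves v x c \<Longrightarrow> t \<in> {0..1} \<Longrightarrow> sol v x t = c t"
  using solves_unique solves_sol by blast

definition rev_vel :: "(real \<Rightarrow> 'v) \<Rightarrow> real \<Rightarrow> 'v" where
  "rev_vel v = (\<lambda>s. (-1) *\<^sub>R v (1 - s))"

lemma rev_vel_velocities:
  assumes "v \<in> velocities"
  shows "rev_vel v \<in> velocities" "L2_norm (lebesgue_on {0..1}) (rev_vel v) \<le> sqrt reflection.C * L2_norm (lebesgue_on {0..1}) v"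
  unfolding rev_vel_def time.L2_norm_scale
  using reflection.L2_compose[OF assms] time.L2_scale[of "\<lambda>s. v (1 - s)" "-1"] by auto

lemma rev_vel_rev_vel [simp]: "rev_vel (rev_vel v) = v"
  by (simp add: rev_vel_def)

lemma solves_reverse:
  assumes v: "v \<in> velocities" and c: "solves v x c"
  shows "solves (rev_vel v) (c 1) (\<lambda>s. c (1 - s))"
  unfolding solves_def
proof (intro conjI ballI)
  have cont: "continuous_on {0..1} c" using c by (simp add: solves_def)
  show "continuous_on {0..1} (\<lambda>s. c (1 - s))"
    by (rule continuous_on_compose2[OF cont]) (auto intro: continuous_intros)
  fix t :: real assume t: "t \<in> {0..1}"
  then have t': "1 - t \<in> {0..1}" by auto
  note int = field_integrable(1)[OF v cont]
  have "(\<integral>s. w (rev_vel v s) (c (1 - s)) \<partial>lebesgue_on {0..t}) = - (\<integral>s. w (v s) (c s) \<partial>lebesgue_on {1 - t..1})"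
    using integral_reflect_unit[OF int t] by (simp add: rev_vel_def w_minus)
  moreover have "(\<integral>s. w (v s) (c s) \<partial>lebesgue_on {0..1}) = (\<integral>s. w (v s) (c s) \<partial>lebesgue_on {0..1 - t}) + (\<integral>s. w (v s) (c s) \<partial>lebesgue_on {1 - t..1})"
    using t by (intro Equivalence_Measurable_On_Borel.integral_combine int) auto
  moreover have "c 1 = x + (\<integral>s. w (v s) (c s) \<partial>lebesgue_on {0..1})" "c (1 - t) = x + (\<integral>s. w (v s) (c s) \<partial>lebesgue_on {0..1 - t})"
    using c t' by (simp_all add: solves_def)
  ultimately show "c (1 - t) = c 1 + (\<integral>s. w (rev_vel v s) (c (1 - s)) \<partial>lebesgue_on {0..t})" by simp
qed

lemma sol_reverse:
  assumes "v \<in> velocities"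
  shows "sol (rev_vel v) (sol v x 1) 1 = x"
proof -
  have s: "solves v x (sol v x)" by (rule solves_sol[OF assms])
  have "sol (rev_vel v) (sol v x 1) 1 = sol v x (1 - 1)"
    by (rule sol_eq[OF rev_vel_velocities(1)[OF assms] solves_reverse[OF assms s]]) simp
  also have "\<dots> = x" using s by (simp add: solves_def integral_eq_zero_null_sets)
  finally show ?thesis .
qed

text \<open>
  A solution that meets a stagnation point is constant: freezing it from that time on gives a
  solution for a truncated velocity, whose time reversal starts at the stagnation point.
\<close>

lemma solves_stagnation:
  assumes v: "v \<in> velocities" and c: "solves v x c" and t1: "t1 \<in> {0..1}" and stag: "\<And>u. w u (c t1) = 0"
  shows "c t1 = x"
proof -
  define v' where "v' s = indicator {0..t1} s *\<^sub>R v s" for s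
  have cont: "continuous_on {0..1} c" using c by (simp add: solves_def)
  have v': "v' \<in> velocities"
  proof (rule time.L2_dominated(1)[OF _ v])
    have "simple_function (lebesgue_on {0..1}) (indicator {0..t1} :: real \<Rightarrow> real)"
      using t1 by (intro simple_function_indicator) (auto simp: sets_restrict_space_iff)
    from strongly_measurable_compose[OF strongly_measurable_simple[OF this] time.L2D(1)[OF v], of scaleR]
    show "strongly_measurable (lebesgue_on {0..1}) v'" by (simp add: v'_def[abs_def] tendsto_scaleR)
  qed (auto simp: v'_def indicator_def)
  have "solves v' x (\<lambda>s. c (min s t1))" unfolding solves_def
  proof (intro conjI ballI)
    show "continuous_on {0..1} (\<lambda>s. c (min s t1))"
      by (rule continuous_on_compose2[OF cont]) (use t1 in \<open>auto intro: continuous_intros\<close>)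
    fix t :: real assume t: "t \<in> {0..1}"
    define t2 where "t2 = min t t1"
    have t2: "t2 \<in> {0..1}" "{0..t2} = {0..t1} \<inter> {0..t}" using t t1 by (auto simp: t2_def)
    have "(\<integral>s. w (v' s) (c (min s t1)) \<partial>lebesgue_on {0..t}) = (\<integral>s. (if s \<in> {0..t1} then w (v s) (c s) else 0) \<partial>lebesgue_on {0..t})"
      using t by (intro Bochner_Integration.integral_cong) (auto simp: v'_def w_zero)
    also have "\<dots> = (\<integral>s. w (v s) (c s) \<partial>lebesgue_on {0..t2})"
      unfolding t2(2) by (rule Lebesgue_Measure.integral_restrict_Int) auto
    finally show "c (min t t1) = x + (\<integral>s. w (v' s) (c (min s t1)) \<partial>lebesgue_on {0..t})"
      using c t2(1) by (simp add: solves_def t2_def)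
  qed
  from solves_reverse[OF v' this]
  have 1: "solves (rev_vel v') (c t1) (\<lambda>s. c (min (1 - s) t1))" using t1 by (simp add: min_absorb2)
  \<comment> \<open>All fields vanish at \<open>c t1\<close>, so resting there also solves the
    equation. Uniqueness identifies the two curves, and reversed time 1 is original time 0.\<close>
  have 2: "solves (rev_vel v') (c t1) (\<lambda>s. c t1)" using stag by (simp add: solves_def)
  from solves_unique[OF rev_vel_velocities(1)[OF v'] 1 2, of 1]
  have "c (min (1 - 1) t1) = c t1" by simp
  moreover have "c 0 = x" using c by (simp add: solves_def integral_eq_zero_null_sets)
  ultimately show ?thesis using t1 by simp
qed

text \<open>Along the fixed limit path \<open>c\<close>, the integral of the field up to time t is a
  bounded functional of the velocity. The perturbations \<open>a n\<close> hence tend to 0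
  pointwise; being uniformly bounded they tend to 0 in L2, and Gronwall transfers this to the
  paths.\<close>

lemma solves_weak_continuity:
  assumes v: "L2_weak_lim (lebesgue_on {0..1}) vs v" and bdd: "\<And>n. L2_norm (lebesgue_on {0..1}) (vs n) \<le> R"
  shows "(\<lambda>n. sol (vs n) x 1) \<longlonglongrightarrow> sol v x 1"
proof -
  let ?M = "lebesgue_on {0..1::real}"
  have vL: "v \<in> velocities" and vsL: "vs n \<in> velocities" for n using v by (auto simp: L2_weak_lim_def)
  define c where "c = sol v x"
  define cn where "cn n = sol (vs n) x" for n
  have sc: "solves v x c" and scn: "solves (vs n) x (cn n)" for n
    using solves_sol vL vsL by (auto simp: c_def cn_def)
  have cont: "continuous_on {0..1} c" "continuous_on {0..1} (cn n)" for n using sc scn by (auto simp: solves_def)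
  define a where "a n t = (\<integral>s. w (vs n s) (c s) \<partial>lebesgue_on {0..t}) - (\<integral>s. w (v s) (c s) \<partial>lebesgue_on {0..t})" for n t
  have int: "integrable (lebesgue_on {0..t}) (\<lambda>s. w (u s) (c s))" if "u \<in> velocities" "t \<in> {0..1}" for u t
    using field_integrable(2)[OF that(1) cont(1) that(2)] .
  have le: "norm (\<integral>s. w (u s) (c s) \<partial>lebesgue_on {0..t}) \<le> (B * L2_norm ?M (\<lambda>s. 1::real)) * L2_norm ?M u"
    if u: "u \<in> velocities" and t: "t \<in> {0..1}" for u t
  proof -
    have i: "integrable ?M (\<lambda>s. B * norm (u s))" by (rule time.L2_integrable[OF speed_L2(1)[OF u]])
    have "norm (\<integral>s. w (u s) (c s) \<partial>lebesgue_on {0..t}) \<le> (\<integral>s. B * norm (u s) \<partial>lebesgue_on {0..t})"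
      using int[OF u t] t w_bound by (intro integral_norm_bound_AE integrable_subinterval[OF i]) auto
    also have "\<dots> \<le> (\<integral>s. B * norm (u s) \<partial>?M)"
      using i t B by (intro integral_mono_lebesgue_on_AE) auto
    also have "\<dots> \<le> L2_norm ?M (\<lambda>s. B * norm (u s)) * L2_norm ?M (\<lambda>s. 1::real)"
      using abs_le_D1[OF time.Cauchy_Schwarz_L2[OF speed_L2(1)[OF u] time.L2_const[of 1]]] by simp
    finally show ?thesis using speed_L2(2)[OF u] by (simp add: mult_ac)
  qed
  have a_lim: "(\<lambda>n. a n t) \<longlonglongrightarrow> 0" if t: "t \<in> {0..1}" for t
  proof -
    have "(\<lambda>n. (\<integral>s. w (vs n s) (c s) \<partial>lebesgue_on {0..t}) \<bullet> i) \<longlonglongrightarrow> (\<integral>s. w (v s) (c s) \<partial>lebesgue_on {0..t}) \<bullet> i"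
      if i: "i \<in> Basis" for i
    proof -
      have "L2_functional ?M (\<lambda>u. (\<integral>s. w (u s) (c s) \<partial>lebesgue_on {0..t}) \<bullet> i)" unfolding L2_functional_def
      proof (intro conjI ballI allI exI[of _ "B * L2_norm ?M (\<lambda>s. 1::real)"])
        fix f g :: "real \<Rightarrow> 'v" assume f: "f \<in> velocities"
        show "(\<integral>s. w (f s + g s) (c s) \<partial>lebesgue_on {0..t}) \<bullet> i = (\<integral>s. w (f s) (c s) \<partial>lebesgue_on {0..t}) \<bullet> i + (\<integral>s. w (g s) (c s) \<partial>lebesgue_on {0..t}) \<bullet> i"
          if "g \<in> velocities" using int[OF f t] int[OF that t] by (simp add: w_add inner_add_left)
        show "(\<integral>s. w (k *\<^sub>R f s) (c s) \<partial>lebesgue_on {0..t}) \<bullet> i = k * ((\<integral>s. w (f s) (c s) \<partial>lebesgue_on {0..t}) \<bullet> i)" for k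
          by (simp add: w_scale)
        show "\<bar>(\<integral>s. w (f s) (c s) \<partial>lebesgue_on {0..t}) \<bullet> i\<bar> \<le> B * L2_norm ?M (\<lambda>s. 1::real) * L2_norm ?M f"
          using order_trans[OF Basis_le_norm[OF i] le[OF f t]] .
      qed
      then show ?thesis using v unfolding L2_weak_lim_def by blast
    qed
    then have "(\<lambda>n. \<integral>s. w (vs n s) (c s) \<partial>lebesgue_on {0..t}) \<longlonglongrightarrow> (\<integral>s. w (v s) (c s) \<partial>lebesgue_on {0..t})"
      by (subst tendsto_componentwise_iff) blast
    then show ?thesis unfolding a_def by (rule LIM_zero)
  qed
  have a_cont: "continuous_on {0..1} (a n)" for n
    unfolding a_def by (intro continuous_intros indefinite_integral_continuous_real field_integrable(1) vL vsL cont)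
  have aL: "a n \<in> L2 ?M" for n by (rule continuous_L2[OF a_cont])
  define Q where "Q = (B * L2_norm ?M (\<lambda>s. 1::real)) * (R + L2_norm ?M v)"
  have a_bd: "norm (a n t) \<le> Q" if t: "t \<in> {0..1}" for n t
  proof -
    have "norm (a n t) \<le> (B * L2_norm ?M (\<lambda>s. 1::real)) * L2_norm ?M (vs n) + (B * L2_norm ?M (\<lambda>s. 1::real)) * L2_norm ?M v"
      unfolding a_def using norm_triangle_le_diff[OF add_mono[OF le[OF vsL t] le[OF vL t]]] .
    also have "\<dots> \<le> Q" unfolding Q_def distrib_left using B bdd by (intro add_right_mono mult_left_mono) auto
    finally show ?thesis .
  qed
  have "(\<lambda>n. L2_norm ?M (\<lambda>t. a n t - 0)) \<longlonglongrightarrow> 0"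
  proof (rule time.L2_dominated_LIMSEQ[OF time.L2_const aL time.L2_const[of Q]])
    show "AE t in ?M. (\<lambda>n. a n t) \<longlonglongrightarrow> 0" using a_lim by (intro AE_I2) simp
    show "AE t in ?M. norm (a n t - 0) \<le> norm Q" for n
      using a_bd[of _ n] by (intro AE_I2) (auto intro: order_trans[OF _ abs_ge_self])
  qed
  then have aL_lim: "(\<lambda>n. L2_norm ?M (a n)) \<longlonglongrightarrow> 0" by simp
  define K where "K = B * \<bar>R\<bar> + 1"
  have K: "0 < K" using B by (auto simp: K_def intro: add_nonneg_pos)
  have speed: "L2_norm ?M (\<lambda>s. B * norm (vs n s)) \<le> K" for n
    using speed_L2(2)[OF vsL[of n]] mult_left_mono[OF order_trans[OF bdd abs_ge_self] B, of n] by (simp add: K_def)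
  have bound: "norm (cn n 1 - c 1) \<le> norm (a n 1) + 2 * (K * L2_norm ?M (a n)) * exp (2 * K\<^sup>2)" for n
  proof -
    \<comment> \<open>Subtracting \<open>a n\<close> leaves the integral of one velocity
      \<open>vs n\<close> along two paths, which the Lipschitz bound controls by \<open>a n\<close>
      and \<open>d\<close> themselves.\<close>
    define d where "d t = cn n t - c t - a n t" for t
    have d_cont: "continuous_on {0..1} d" unfolding d_def by (intro continuous_intros cont a_cont)
    have "norm (d 1) \<le> 2 * (K * L2_norm ?M (a n)) * exp (2 * K\<^sup>2)"
    proof (rule Gronwall_L2[where u = "\<lambda>t. norm (d t)" and t = 1, OF speed_L2(1)[OF vsL] speed K])
      show "0 \<le> B * norm (vs n s)" for s using B by simp
      show "continuous_on {0..1} (\<lambda>t. norm (d t))" by (intro continuous_intros d_cont)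
      show "0 \<le> K * L2_norm ?M (a n)" using K by simp
      fix t :: real assume t: "t \<in> {0..1}"
      have sub: "{0..t} \<subseteq> {0..1}" using t by auto
      let ?g = "\<lambda>s. B * norm (vs n s)"
      have i: "integrable ?M (\<lambda>s. ?g s * norm (u s))" if "continuous_on {0..1} u" for u :: "real \<Rightarrow> 'a"
        using that by (intro time.L2_mult_integrable speed_L2 vsL continuous_L2 continuous_intros)
      have "continuous_on {0..1} (\<lambda>s. cn n s - c s)" by (intro continuous_intros cont)
      note ints = i[OF this, THEN integrable_subinterval, OF sub] i[OF d_cont, THEN integrable_subinterval, OF sub]
        i[OF a_cont[of n], THEN integrable_subinterval, OF sub]
      have "d t = (\<integral>s. w (vs n s) (cn n s) \<partial>lebesgue_on {0..t}) - (\<integral>s. w (vs n s) (c s) \<partial>lebesgue_on {0..t})"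
        using sc scn[of n] t by (simp add: d_def a_def solves_def)
      then have "norm (d t) \<le> (\<integral>s. ?g s * norm (cn n s - c s) \<partial>lebesgue_on {0..t})"
        using norm_integral_field_diff_le[OF vsL cont(2) cont(1) t] by simp
      also have "\<dots> \<le> (\<integral>s. ?g s * norm (a n s) + ?g s * norm (d s) \<partial>lebesgue_on {0..t})"
      proof (rule integral_mono)
        show "?g s * norm (cn n s - c s) \<le> ?g s * norm (a n s) + ?g s * norm (d s)" for s
          unfolding distrib_left[symmetric] using B norm_triangle_ineq[of "a n s" "d s"] by (intro mult_left_mono) (auto simp: d_def)
      qed (use ints in auto)
      also have "\<dots> = (\<integral>s. ?g s * norm (a n s) \<partial>lebesgue_on {0..t}) + (\<integral>s. ?g s * norm (d s) \<partial>lebesgue_on {0..t})"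
        using ints by simp
      also have "(\<integral>s. ?g s * norm (a n s) \<partial>lebesgue_on {0..t}) \<le> (\<integral>s. ?g s * norm (a n s) \<partial>?M)"
        using i[OF a_cont] sub B by (intro integral_mono_lebesgue_on_AE) auto
      also have "\<dots> \<le> L2_norm ?M ?g * L2_norm ?M (a n)"
        using abs_le_D1[OF time.Cauchy_Schwarz_L2[OF speed_L2(1)[OF vsL] time.L2D(4)[OF aL]]] by simp
      also have "\<dots> \<le> K * L2_norm ?M (a n)" by (intro mult_right_mono speed) simp
      finally show "norm (d t) \<le> K * L2_norm ?M (a n) + (\<integral>s. ?g s * norm (d s) \<partial>lebesgue_on {0..t})" by simp
    qed auto
    moreover have "norm (cn n 1 - c 1) \<le> norm (a n 1) + norm (d 1)"
      using norm_triangle_ineq[of "a n 1" "d 1"] by (simp add: d_def)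
    ultimately show ?thesis by linarith
  qed
  have lim: "(\<lambda>n. norm (a n 1) + 2 * (K * L2_norm ?M (a n)) * exp (2 * K\<^sup>2)) \<longlonglongrightarrow> 0 + 2 * (K * 0) * exp (2 * K\<^sup>2)"
    by (intro tendsto_intros aL_lim tendsto_norm_zero a_lim) simp
  have "(\<lambda>n. cn n 1 - c 1) \<longlonglongrightarrow> 0"
  proof (rule Lim_null_comparison[OF always_eventually])
    show "\<forall>n. norm (cn n 1 - c 1) \<le> norm (a n 1) + 2 * (K * L2_norm ?M (a n)) * exp (2 * K\<^sup>2)" using bound by blast
    show "(\<lambda>n. norm (a n 1) + 2 * (K * L2_norm ?M (a n)) * exp (2 * K\<^sup>2)) \<longlonglongrightarrow> 0" using lim by simp
  qed
  then show ?thesis unfolding cn_def c_def by (rule LIM_zero_cancel)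
qed

end

section \<open>Flows of admissible velocities\<close>

lemma holder_norm_le_imp:
  assumes le: "holder_norm \<alpha> \<Omega> f \<le> ennreal c" and x: "x \<in> \<Omega>" and c: "0 \<le> c"
  shows "norm (f x) \<le> c" "onorm (frechet_derivative f (at x)) \<le> c"
proof -
  have "ennreal (norm (f x)) \<le> (SUP x\<in>\<Omega>. ennreal (norm (f x)))" using x by (rule SUP_upper)
  also have "\<dots> \<le> holder_norm \<alpha> \<Omega> f" unfolding holder_norm_def by (simp add: add.assoc)
  also note le
  finally show "norm (f x) \<le> c" using c by simp
  have "ennreal (onorm (frechet_derivative f (at x))) \<le> (SUP x\<in>\<Omega>. ennreal (onorm (frechet_derivative f (at x))))"
    using x by (rule SUP_upper)
  also have "\<dots> \<le> holder_norm \<alpha> \<Omega> f" unfolding holder_norm_def by (simp add: add.assoc add_increasing)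
  also note le
  finally show "onorm (frechet_derivative f (at x)) \<le> c" using c by simp
qed

lemma Cc_infD:
  assumes "g \<in> Cc_inf \<Omega>"
  shows "g differentiable (at x)" "x \<notin> \<Omega> \<Longrightarrow> g x = 0" "x \<notin> \<Omega> \<Longrightarrow> frechet_derivative g (at x) = (\<lambda>h. 0)"
proof -
  have "Ck (Suc 0) g" using assms unfolding Cc_inf_def by blast
  then show "g differentiable (at x)" by simp
  have supp: "closure {x. g x \<noteq> 0} \<subseteq> \<Omega>" using assms by (simp add: Cc_inf_def)
  show "g x = 0" if "x \<notin> \<Omega>" using supp closure_subset[of "{x. g x \<noteq> 0}"] that by auto
  show "frechet_derivative g (at x) = (\<lambda>h. 0)" if "x \<notin> \<Omega>"
  proof -
    have "(g has_derivative (\<lambda>h. 0)) (at x)"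
    proof (rule has_derivative_transform_within_open[OF has_derivative_const])
      show "open (- closure {x. g x \<noteq> 0})" by (rule open_Compl[OF closed_closure])
      show "x \<in> - closure {x. g x \<noteq> 0}" using supp that by auto
      show "0 = g y" if "y \<in> - closure {x. g x \<noteq> 0}" for y
        using closure_subset[of "{x. g x \<noteq> 0}"] that by auto
    qed
    then show ?thesis by (rule frechet_derivative_at[symmetric])
  qed
qed

text \<open>
  A field in \<open>C\<^sub>0\<^bsup>1,\<alpha>\<^esup>\<close> extends by zero to a uniform limit of test functions with uniformly bounded
  derivatives on the whole space; this gives a global Lipschitz bound although \<open>\<Omega>\<close> need not be
  convex.
\<close>

lemma C0_holder_Lipschitz:
  fixes f :: "'a::euclidean_space \<Rightarrow> 'a"
  assumes f: "f \<in> C0_holder \<alpha> \<Omega>" and le: "holder_norm \<alpha> \<Omega> f \<le> ennreal c" and c: "0 \<le> c"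
  defines "F \<equiv> \<lambda>x. if x \<in> \<Omega> then f x else 0"
  shows "norm (F x - F y) \<le> c * norm (x - y)"
proof -
  have fd: "f differentiable (at x)" if "x \<in> \<Omega>" for x using f that by (simp add: C0_holder_def)
  \<comment> \<open>\<open>2 * e\<close> pays for replacing \<open>F\<close> by a test function at
    both endpoints, and \<open>c + e\<close> bounds the derivative of that test function everywhere,
    also where the segment leaves \<Omega>.\<close>
  have main: "norm (F x - F y) \<le> 2 * e + (c + e) * norm (x - y)" if e: "e > 0" for e
  proof -
    obtain g where g: "g \<in> Cc_inf \<Omega>" "holder_norm \<alpha> \<Omega> (\<lambda>x. f x - g x) < ennreal e"
      using f e unfolding C0_holder_def by blast
    have he: "holder_norm \<alpha> \<Omega> (\<lambda>x. f x - g x) \<le> ennreal e" using g(2) by simp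
    have close: "norm (F x - g x) \<le> e" for x
      using holder_norm_le_imp(1)[OF he, of x] Cc_infD(2)[OF g(1), of x] e by (auto simp: F_def)
    have deriv: "onorm (frechet_derivative g (at x)) \<le> c + e" for x
    proof (cases "x \<in> \<Omega>")
      case True
      let ?Df = "frechet_derivative f (at x)" and ?Dg = "frechet_derivative g (at x)"
      have Df: "(f has_derivative ?Df) (at x)" and Dg: "(g has_derivative ?Dg) (at x)"
        using fd[OF True] Cc_infD(1)[OF g(1)] by (simp_all add: frechet_derivative_works)
      have D: "frechet_derivative (\<lambda>x. f x - g x) (at x) = (\<lambda>h. ?Df h - ?Dg h)"
        using frechet_derivative_at[OF has_derivative_diff[OF Df Dg]] by simp
      have bl: "bounded_linear ?Df" "bounded_linear ?Dg" using Df Dg by (simp_all add: has_derivative_bounded_linear)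
      have "onorm ?Dg = onorm (\<lambda>h. ?Df h + - (?Df h - ?Dg h))" by simp
      also have "\<dots> \<le> onorm ?Df + onorm (\<lambda>h. - (?Df h - ?Dg h))"
        using bl by (intro onorm_triangle bounded_linear_minus bounded_linear_sub)
      also have "onorm (\<lambda>h. - (?Df h - ?Dg h)) = onorm (\<lambda>h. ?Df h - ?Dg h)" by (rule onorm_neg)
      also have "onorm ?Df + \<dots> \<le> c + e"
        using holder_norm_le_imp(2)[OF le True c] holder_norm_le_imp(2)[OF he True] e D by simp
      finally show ?thesis .
    next
      case False
      then show ?thesis using Cc_infD(3)[OF g(1) False] c e by (simp add: onorm_zero)
    qed
    have "norm (g x - g y) \<le> (c + e) * norm (x - y)"
    proof (rule differentiable_bound[of UNIV])
      show "(g has_derivative frechet_derivative g (at x)) (at x within UNIV)" for x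
        using Cc_infD(1)[OF g(1)] by (simp add: frechet_derivative_works)
    qed (use deriv in auto)
    moreover have "norm (F x - F y) \<le> norm (F x - g x) + norm (g x - g y) + norm (F y - g y)"
      using norm_triangle_ineq[of "F x - g x + (g x - g y)" "g y - F y"] norm_triangle_ineq[of "F x - g x" "g x - g y"]
      by (simp add: norm_minus_commute)
    ultimately show ?thesis using close[of x] close[of y] by linarith
  qed
  show ?thesis
  proof (rule tendsto_lowerbound)
    show "((\<lambda>e. 2 * e + (c + e) * norm (x - y)) \<longlongrightarrow> c * norm (x - y)) (at_right 0)"
      by (auto intro!: tendsto_eq_intros)
    show "\<forall>\<^sub>F e in at_right 0. norm (F x - F y) \<le> 2 * e + (c + e) * norm (x - y)"
      using main by (auto simp: eventually_at_right_field intro!: exI[of _ 1])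
  qed simp
qed

locale domain_velocity_field = velocity_field w B
  for w :: "'v::real_normed_vector \<Rightarrow> 'a::euclidean_space \<Rightarrow> 'a" and B :: real +
  fixes \<Omega> :: "'a set" and \<iota> :: "'v \<Rightarrow> 'a \<Rightarrow> 'a"
  assumes \<Omega>: "open \<Omega>" "bounded \<Omega>"
    and w_eq: "w u x = (if x \<in> \<Omega> then \<iota> u x else 0)"

lemma admissible_velocity_field:
  fixes \<iota> :: "'v::real_normed_vector \<Rightarrow> 'a::euclidean_space \<Rightarrow> 'a"
  assumes \<Omega>: "open \<Omega>" "bounded \<Omega>" and adm: "admissible \<Omega> \<iota>"
  shows "\<exists>B. domain_velocity_field (\<lambda>u x. if x \<in> \<Omega> then \<iota> u x else 0) B \<Omega> \<iota>"
proof -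
  obtain \<alpha> B where "\<forall>u. \<iota> u \<in> C0_holder \<alpha> \<Omega>" "\<forall>x\<in>\<Omega>. linear (\<lambda>u. \<iota> u x)"
    and "\<forall>u. holder_norm \<alpha> \<Omega> (\<iota> u) \<le> ennreal (B * norm u)"
    using adm unfolding admissible_def by (elim exE conjE)
  then have \<iota>: "\<And>u. \<iota> u \<in> C0_holder \<alpha> \<Omega>" "\<And>x. x \<in> \<Omega> \<Longrightarrow> linear (\<lambda>u. \<iota> u x)"
    and B: "\<And>u. holder_norm \<alpha> \<Omega> (\<iota> u) \<le> ennreal (B * norm u)" by simp_all
  \<comment> \<open>The embedding constant may be negative, in which case \<open>ennreal\<close>
    truncates to 0; the absolute value makes it usable as a real bound.\<close>
  have le: "holder_norm \<alpha> \<Omega> (\<iota> u) \<le> ennreal (\<bar>B\<bar> * norm u)" for u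
    by (rule order_trans[OF B]) (intro ennreal_leI mult_right_mono, auto)
  have nn: "0 \<le> \<bar>B\<bar> * norm u" for u :: 'v by simp
  have "domain_velocity_field (\<lambda>u x. if x \<in> \<Omega> then \<iota> u x else 0) \<bar>B\<bar> \<Omega> \<iota>"
  proof unfold_locales
    fix u u' :: 'v and x y :: 'a and c :: real
    show "(if x \<in> \<Omega> then \<iota> (u + u') x else 0) = (if x \<in> \<Omega> then \<iota> u x else 0) + (if x \<in> \<Omega> then \<iota> u' x else 0)"
      using linear_add[OF \<iota>(2)] by simp
    show "(if x \<in> \<Omega> then \<iota> (c *\<^sub>R u) x else 0) = c *\<^sub>R (if x \<in> \<Omega> then \<iota> u x else 0)"
      using linear_scale[OF \<iota>(2)] by simp
    show "norm (if x \<in> \<Omega> then \<iota> u x else 0) \<le> \<bar>B\<bar> * norm u"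
      using holder_norm_le_imp(1)[OF le _ nn, of x u] by auto
    show "norm ((if x \<in> \<Omega> then \<iota> u x else 0) - (if y \<in> \<Omega> then \<iota> u y else 0)) \<le> \<bar>B\<bar> * norm u * norm (x - y)"
      by (rule C0_holder_Lipschitz[OF \<iota>(1) le nn])
  qed (use \<Omega> in auto)
  then show ?thesis ..
qed

context domain_velocity_field
begin

text \<open>Outside \<Omega> every extended field vanishes, so an exit point would be a stagnation
  point and equal to the starting point.\<close>

lemma sol_in_domain:
  assumes v: "v \<in> velocities" and x: "x \<in> \<Omega>" and t: "t \<in> {0..1}"
  shows "sol v x t \<in> \<Omega>"
proof (rule ccontr)
  assume "sol v x t \<notin> \<Omega>"
  then have "\<And>u. w u (sol v x t) = 0" by (simp add: w_eq)
  from solves_stagnation[OF v solves_sol[OF v] t this] have "sol v x t = x" .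
  then show False using x \<open>sol v x t \<notin> \<Omega>\<close> by simp
qed

text \<open>The two fields agree on \<Omega>, and a trajectory is automatically continuous because
  it is an indefinite integral.\<close>

lemma trajectory_iff:
  assumes v: "v \<in> velocities" and x: "x \<in> \<Omega>"
  shows "is_trajectory \<Omega> \<iota> v x c \<longleftrightarrow> solves v x c \<and> (\<forall>t\<in>{0..1}. c t \<in> \<Omega>)"
proof
  assume tr: "is_trajectory \<Omega> \<iota> v x c"
  then have in\<Omega>: "c t \<in> \<Omega>" if "t \<in> {0..1}" for t using that unfolding is_trajectory_def by blast
  have eq: "(\<integral>s. \<iota> (v s) (c s) \<partial>lebesgue_on {0..t}) = (\<integral>s. w (v s) (c s) \<partial>lebesgue_on {0..t})" if "t \<in> {0..1}" for t
    using in\<Omega> that by (intro Bochner_Integration.integral_cong) (auto simp: w_eq)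
  have ct: "c t = x + (\<integral>s. w (v s) (c s) \<partial>lebesgue_on {0..t})" if "t \<in> {0..1}" for t
    using tr that eq[OF that] by (simp add: is_trajectory_def)
  have "integrable (lebesgue_on {0..1}) (\<lambda>s. \<iota> (v s) (c s))" using tr by (simp add: is_trajectory_def)
  then have "integrable (lebesgue_on {0..1}) (\<lambda>s. w (v s) (c s))"
    using in\<Omega> by (subst Bochner_Integration.integrable_cong[of _ _ _ "\<lambda>s. \<iota> (v s) (c s)"]) (auto simp: w_eq)
  then have "continuous_on {0..1} (\<lambda>t. x + (\<integral>s. w (v s) (c s) \<partial>lebesgue_on {0..t}))"
    by (intro continuous_intros indefinite_integral_continuous_real)
  then have "continuous_on {0..1} c" by (rule continuous_on_eq) (use ct in simp)
  then show "solves v x c \<and> (\<forall>t\<in>{0..1}. c t \<in> \<Omega>)" using ct in\<Omega> by (simp add: solves_def)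
next
  assume "solves v x c \<and> (\<forall>t\<in>{0..1}. c t \<in> \<Omega>)"
  then have s: "solves v x c" and in\<Omega>: "\<And>t. t \<in> {0..1} \<Longrightarrow> c t \<in> \<Omega>" by auto
  have cont: "continuous_on {0..1} c" using s by (simp add: solves_def)
  show "is_trajectory \<Omega> \<iota> v x c" unfolding is_trajectory_def
  proof (intro ballI conjI)
    fix t :: real assume t: "t \<in> {0..1}"
    show "c t \<in> \<Omega>" by (rule in\<Omega>[OF t])
    have weq: "w (v s) (c s) = \<iota> (v s) (c s)" if "s \<in> {0..t}" for s using in\<Omega>[of s] that t by (simp add: w_eq)
    show "integrable (lebesgue_on {0..t}) (\<lambda>s. \<iota> (v s) (c s))"
      using field_integrable(2)[OF v cont t] weq
      by (subst Bochner_Integration.integrable_cong[of _ _ _ "\<lambda>s. w (v s) (c s)"]) auto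
    have "(\<integral>s. w (v s) (c s) \<partial>lebesgue_on {0..t}) = (\<integral>s. \<iota> (v s) (c s) \<partial>lebesgue_on {0..t})"
      by (intro Bochner_Integration.integral_cong) (auto simp: weq)
    then show "c t = x + (\<integral>s. \<iota> (v s) (c s) \<partial>lebesgue_on {0..t})" using s t by (simp add: solves_def)
  qed
qed

lemma flow_eq_sol:
  assumes v: "v \<in> velocities" and x: "x \<in> \<Omega>" and t: "t \<in> {0..1}"
  shows "flow \<Omega> \<iota> v t x = sol v x t"
  unfolding flow_def
proof (rule the_equality)
  show "\<exists>c. is_trajectory \<Omega> \<iota> v x c \<and> c t = sol v x t"
    using trajectory_iff[OF v x] solves_sol[OF v] sol_in_domain[OF v x] by blast
  show "y = sol v x t" if "\<exists>c. is_trajectory \<Omega> \<iota> v x c \<and> c t = y" for y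
    using that trajectory_iff[OF v x] sol_eq[OF v _ t] by metis
qed

text \<open>Reversal applied to \<open>v\<close> gives injectivity of the flow; applied to
  \<open>rev_vel v\<close> it gives the preimage of \<open>x\<close>.\<close>

lemma inverse_flow:
  assumes v: "v \<in> velocities" and x: "x \<in> \<Omega>"
  shows "inv_into \<Omega> (flow \<Omega> \<iota> v 1) x = sol (rev_vel v) x 1"
proof (rule inv_into_f_eq)
  have one: "(1::real) \<in> {0..1}" by simp
  show "inj_on (flow \<Omega> \<iota> v 1) \<Omega>"
    by (rule inj_on_inverseI[of _ "\<lambda>y. sol (rev_vel v) y 1"]) (simp add: flow_eq_sol[OF v _ one] sol_reverse[OF v])
  show in\<Omega>: "sol (rev_vel v) x 1 \<in> \<Omega>" by (rule sol_in_domain[OF rev_vel_velocities(1)[OF v] x one])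
  show "flow \<Omega> \<iota> v 1 (sol (rev_vel v) x 1) = x"
    using sol_reverse[OF rev_vel_velocities(1)[OF v]] by (simp add: flow_eq_sol[OF v in\<Omega> one])
qed

lemma \<Omega>_lmeasurable: "\<Omega> \<in> lmeasurable"
  using \<Omega> by (simp add: bounded_set_imp_lmeasurable borel_open)

sublocale space: complete_finite_measure "lebesgue_on \<Omega>"
  by (rule complete_finite_measure_lebesgue_on[OF \<Omega>_lmeasurable])

text \<open>The constant of \<open>solves_Lipschitz\<close> with K = B |R| + 1; the added 1 ensures
  that K is positive.\<close>

definition flow_Lipschitz :: "real \<Rightarrow> real" where
  "flow_Lipschitz R = 2 * exp (2 * (B * \<bar>R\<bar> + 1)\<^sup>2)"

lemma lipschitz_inverse_flow:
  assumes v: "v \<in> velocities" and R: "L2_norm (lebesgue_on {0..1}) v \<le> R"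
  shows "lipschitz_inverse \<Omega> (\<lambda>x. sol (rev_vel v) x 1) (\<lambda>x. sol v x 1) (flow_Lipschitz R)"
proof
  note rv = rev_vel_velocities(1)[OF v]
  show "\<Omega> \<in> sets lebesgue" "bounded \<Omega>" using \<Omega> by (auto simp: borel_open)
  show "0 \<le> flow_Lipschitz R" by (simp add: flow_Lipschitz_def)
  show "sol (rev_vel v) x 1 \<in> \<Omega>" "sol v x 1 \<in> \<Omega>" if "x \<in> \<Omega>" for x
    using sol_in_domain[OF rv that] sol_in_domain[OF v that] by simp_all
  show "sol (rev_vel v) (sol v x 1) 1 = x" "sol v (sol (rev_vel v) x 1) 1 = x" for x
    using sol_reverse[OF v] sol_reverse[OF rv] by simp_all
  show "norm (sol v x 1 - sol v y 1) \<le> flow_Lipschitz R * norm (x - y)" for x y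
    unfolding flow_Lipschitz_def
  proof (rule solves_Lipschitz[OF v _ _ solves_sol[OF v] solves_sol[OF v]])
    show "B * L2_norm (lebesgue_on {0..1}) v \<le> B * \<bar>R\<bar> + 1"
      using mult_left_mono[OF order_trans[OF R abs_ge_self] B] by simp
    show "0 < B * \<bar>R\<bar> + 1" using B by (simp add: add_nonneg_pos)
  qed simp
qed

section \<open>Deformed templates\<close>

definition deformed :: "('a \<Rightarrow> real) \<Rightarrow> (real \<Rightarrow> 'v) \<Rightarrow> 'a \<Rightarrow> real" where
  "deformed T v = (\<lambda>x. T (inv_into \<Omega> (flow \<Omega> \<iota> v 1) x))"

lemma deformed_AE:
  "v \<in> velocities \<Longrightarrow> AE x in lebesgue_on \<Omega>. T (sol (rev_vel v) x 1) = deformed T v x"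
  by (rule AE_I2) (simp add: deformed_def inverse_flow)

text \<open>The square root of the measure distortion of a map with Lipschitz constant
  \<open>flow_Lipschitz R\<close>.\<close>

definition deformation_const :: "real \<Rightarrow> real" where
  "deformation_const R = sqrt ((2 * flow_Lipschitz R * DIM('a)) ^ DIM('a))"

lemma deformed_L2:
  assumes T: "T \<in> images \<Omega>" and v: "v \<in> velocities" and R: "L2_norm (lebesgue_on {0..1}) v \<le> R"
  shows "deformed T v \<in> images \<Omega>"
    "L2_norm (lebesgue_on \<Omega>) (deformed T v) \<le> deformation_const R * L2_norm (lebesgue_on \<Omega>) T"
proof -
  interpret lipschitz_inverse \<Omega> "\<lambda>x. sol (rev_vel v) x 1" "\<lambda>x. sol v x 1" "flow_Lipschitz R"
    by (rule lipschitz_inverse_flow[OF v R])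
  show "deformed T v \<in> images \<Omega>"
    by (rule space.L2_AE_cong(1)[OF L2_compose(1)[OF T] deformed_AE[OF v]])
  show "L2_norm (lebesgue_on \<Omega>) (deformed T v) \<le> deformation_const R * L2_norm (lebesgue_on \<Omega>) T"
    using L2_compose(2)[OF T] space.L2_AE_cong(2)[OF L2_compose(1)[OF T] deformed_AE[OF v]]
    by (simp add: C_def deformation_const_def)
qed

text \<open>Reversal is linear and bounded, so composing a continuous functional with it gives
  another one to test with.\<close>

lemma weak_lim_rev_vel:
  assumes "L2_weak_lim (lebesgue_on {0..1}) vs v"
  shows "L2_weak_lim (lebesgue_on {0..1}) (\<lambda>n. rev_vel (vs n)) (rev_vel v)"
  unfolding L2_weak_lim_def
proof (intro conjI allI impI)
  show "rev_vel (vs n) \<in> velocities" "rev_vel v \<in> velocities" for n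
    using assms rev_vel_velocities(1) by (auto simp: L2_weak_lim_def)
  fix l :: "(real \<Rightarrow> 'v) \<Rightarrow> real" assume l: "L2_functional (lebesgue_on {0..1}) l"
  obtain B' where B': "B' \<ge> 0" "\<And>f. f \<in> velocities \<Longrightarrow> \<bar>l f\<bar> \<le> B' * L2_norm (lebesgue_on {0..1}) f"
    using time.L2_functionalD(4)[OF l] by blast
  have "L2_functional (lebesgue_on {0..1}) (\<lambda>u. l (rev_vel u))" unfolding L2_functional_def
  proof (intro conjI ballI allI exI[of _ "B' * sqrt reflection.C"])
    fix f g :: "real \<Rightarrow> 'v" assume f: "f \<in> velocities"
    show "l (rev_vel (\<lambda>x. f x + g x)) = l (rev_vel f) + l (rev_vel g)" if "g \<in> velocities"
      using time.L2_functionalD(1)[OF l rev_vel_velocities(1)[OF f] rev_vel_velocities(1)[OF that]]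
      by (simp add: rev_vel_def)
    show "l (rev_vel (\<lambda>x. c *\<^sub>R f x)) = c * l (rev_vel f)" for c
      using time.L2_functionalD(2)[OF l rev_vel_velocities(1)[OF f], of c] by (simp add: rev_vel_def)
    show "\<bar>l (rev_vel f)\<bar> \<le> B' * sqrt reflection.C * L2_norm (lebesgue_on {0..1}) f"
      using order_trans[OF B'(2)[OF rev_vel_velocities(1)[OF f]] mult_left_mono[OF rev_vel_velocities(2)[OF f] B'(1)]]
      by (simp add: mult.assoc)
  qed
  then show "(\<lambda>n. l (rev_vel (vs n))) \<longlonglongrightarrow> l (rev_vel v)" using assms unfolding L2_weak_lim_def by blast
qed

text \<open>Deformations are bounded on L2 uniformly in n, so \<open>T\<close> may be replaced by a
  bounded continuous \<open>S\<close>. For \<open>S\<close>, pointwise convergence of the inverse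
  flows and dominated convergence suffice.\<close>

lemma deformed_tendsto:
  assumes T: "T \<in> images \<Omega>" and v: "L2_weak_lim (lebesgue_on {0..1}) vs v"
    and bdd: "\<And>n. L2_norm (lebesgue_on {0..1}) (vs n) \<le> R0"
  shows "(\<lambda>n. L2_norm (lebesgue_on \<Omega>) (\<lambda>x. deformed T (vs n) x - deformed T v x)) \<longlonglongrightarrow> 0"
proof (rule LIMSEQ_I)
  fix e :: real assume e: "0 < e"
  let ?M = "lebesgue_on \<Omega>"
  have vL: "v \<in> velocities" and vsL: "vs n \<in> velocities" for n using v by (auto simp: L2_weak_lim_def)
  define R where "R = max R0 (L2_norm (lebesgue_on {0..1}) v)"
  have R: "L2_norm (lebesgue_on {0..1}) v \<le> R" "L2_norm (lebesgue_on {0..1}) (vs n) \<le> R" for n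
    using bdd[of n] by (auto simp: R_def)
  have dL: "deformed f u \<in> images \<Omega>" if "f \<in> images \<Omega>" "u \<in> velocities" for f u
    using deformed_L2(1)[OF that order_refl] .
  define d where "d = deformation_const R"
  have d: "d \<ge> 0" by (auto simp: d_def deformation_const_def flow_Lipschitz_def)
  have "0 < e / (3 * (d + 1))" using e d by simp
  then obtain S c where S: "continuous_on UNIV S" "\<And>x. \<bar>S x\<bar> \<le> c" "S \<in> images \<Omega>"
    and TS: "L2_norm ?M (\<lambda>x. T x - S x) < e / (3 * (d + 1))"
    using L2_bounded_continuous_dense[OF \<Omega>_lmeasurable T] by blast
  have "(\<lambda>n. L2_norm ?M (\<lambda>x. deformed S (vs n) x - deformed S v x)) \<longlonglongrightarrow> 0"
  proof (rule space.L2_dominated_LIMSEQ[OF dL[OF S(3) vL] dL[OF S(3) vsL] space.L2_const[of "2 * c"]])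
    show "AE x in ?M. (\<lambda>n. deformed S (vs n) x) \<longlonglongrightarrow> deformed S v x"
    proof (rule AE_I2)
      fix x assume "x \<in> space ?M"
      then have x: "x \<in> \<Omega>" by simp
      have "L2_norm (lebesgue_on {0..1}) (rev_vel (vs n)) \<le> sqrt reflection.C * R" for n
        using order_trans[OF rev_vel_velocities(2)[OF vsL] mult_left_mono[OF R(2)]] reflection.C_nonneg by simp
      from solves_weak_continuity[OF weak_lim_rev_vel[OF v] this]
      have "(\<lambda>n. sol (rev_vel (vs n)) x 1) \<longlonglongrightarrow> sol (rev_vel v) x 1" .
      then have "(\<lambda>n. S (sol (rev_vel (vs n)) x 1)) \<longlonglongrightarrow> S (sol (rev_vel v) x 1)"
        by (rule continuous_on_tendsto_compose[OF S(1)]) auto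
      then show "(\<lambda>n. deformed S (vs n) x) \<longlonglongrightarrow> deformed S v x"
        by (simp add: deformed_def inverse_flow[OF vsL x] inverse_flow[OF vL x])
    qed
    have "\<bar>S a - S b\<bar> \<le> 2 * c" for a b using S(2)[of a] S(2)[of b] by linarith
    then show "AE x in ?M. norm (deformed S (vs n) x - deformed S v x) \<le> norm (2 * c)" for n
      by (intro AE_I2) (auto simp: deformed_def intro: order_trans[OF _ abs_ge_self])
  qed
  from LIMSEQ_D[OF this, of "e/3"] e obtain n0 where
    n0: "\<And>n. n \<ge> n0 \<Longrightarrow> L2_norm ?M (\<lambda>x. deformed S (vs n) x - deformed S v x) < e / 3" by auto
  have close: "L2_norm ?M (\<lambda>x. deformed T u x - deformed S u x) < e / 3"
    if u: "u \<in> velocities" "L2_norm (lebesgue_on {0..1}) u \<le> R" for u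
  proof -
    have "L2_norm ?M (\<lambda>x. deformed T u x - deformed S u x) \<le> d * L2_norm ?M (\<lambda>x. T x - S x)"
      using deformed_L2(2)[OF space.L2_diff(1)[OF T S(3)] u] by (simp add: deformed_def d_def)
    also have "\<dots> \<le> (d + 1) * L2_norm ?M (\<lambda>x. T x - S x)" by (simp add: mult_right_mono)
    also have "\<dots> < (d + 1) * (e / (3 * (d + 1)))" using TS d by (intro mult_strict_left_mono) auto
    also have "\<dots> = e / 3" using d by (simp add: field_simps)
    finally show ?thesis .
  qed
  have "L2_norm ?M (\<lambda>x. deformed T (vs n) x - deformed T v x) < e" if n: "n \<ge> n0" for n
  proof -
    have "L2_norm ?M (\<lambda>x. deformed T (vs n) x - deformed T v x)
        \<le> L2_norm ?M (\<lambda>x. deformed T (vs n) x - deformed S (vs n) x) + L2_norm ?M (\<lambda>x. deformed S (vs n) x - deformed T v x)"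
      by (intro space.L2_norm_triangle4 dL T S vsL vL)
    also have "L2_norm ?M (\<lambda>x. deformed S (vs n) x - deformed T v x)
        \<le> L2_norm ?M (\<lambda>x. deformed S (vs n) x - deformed S v x) + L2_norm ?M (\<lambda>x. deformed S v x - deformed T v x)"
      by (intro space.L2_norm_triangle4 dL T S vsL vL)
    also have "L2_norm ?M (\<lambda>x. deformed S v x - deformed T v x) = L2_norm ?M (\<lambda>x. deformed T v x - deformed S v x)"
      by (rule space.L2_norm_minus_commute)
    finally show ?thesis using close[OF vsL R(2), of n] close[OF vL R(1)] n0[OF n] by linarith
  qed
  then show "\<exists>no. \<forall>n\<ge>no. norm (L2_norm ?M (\<lambda>x. deformed T (vs n) x - deformed T v x) - 0) < e" by auto
qed

text \<open>The templates converge strongly and hence under every continuous functional; the weak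
  convergence of \<open>zs\<close> is then added.\<close>

lemma reconstruction_weak_lim:
  assumes T: "T \<in> images \<Omega>" and v: "L2_weak_lim (lebesgue_on {0..1}) vs v"
    and bdd: "\<And>n. L2_norm (lebesgue_on {0..1}) (vs n) \<le> R" and z: "L2_weak_lim (lebesgue_on \<Omega>) zs z"
  shows "L2_weak_lim (lebesgue_on \<Omega>) (\<lambda>n. reconstruction \<Omega> \<iota> T (vs n) (zs n)) (reconstruction \<Omega> \<iota> T v z)"
proof -
  have vL: "v \<in> velocities" and vsL: "vs n \<in> velocities" for n using v by (auto simp: L2_weak_lim_def)
  have zL: "z \<in> images \<Omega>" and zsL: "zs n \<in> images \<Omega>" for n using z by (auto simp: L2_weak_lim_def)
  have rec: "reconstruction \<Omega> \<iota> T u y = (\<lambda>x. deformed T u x + y x)" for u y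
    by (simp add: reconstruction_def deformed_def)
  have dL: "deformed T u \<in> images \<Omega>" if "u \<in> velocities" for u
    using deformed_L2(1)[OF T that order_refl] .
  show ?thesis unfolding L2_weak_lim_def rec
  proof (intro conjI allI impI)
    show "(\<lambda>x. deformed T (vs n) x + zs n x) \<in> images \<Omega>" "(\<lambda>x. deformed T v x + z x) \<in> images \<Omega>" for n
      by (intro space.L2_add dL vsL vL zsL zL)+
    fix l :: "('a \<Rightarrow> real) \<Rightarrow> real" assume l: "L2_functional (lebesgue_on \<Omega>) l"
    have "(\<lambda>n. l (deformed T (vs n)) + l (zs n)) \<longlonglongrightarrow> l (deformed T v) + l z"
      using z l
      by (intro tendsto_add space.L2_functional_LIMSEQ[OF l dL[OF vL] dL[OF vsL] deformed_tendsto[OF T v bdd]])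
         (auto simp: L2_weak_lim_def)
    then show "(\<lambda>n. l (\<lambda>x. deformed T (vs n) x + zs n x)) \<longlonglongrightarrow> l (\<lambda>x. deformed T v x + z x)"
      using space.L2_functionalD(1)[OF l dL[OF vsL] zsL] space.L2_functionalD(1)[OF l dL[OF vL] zL] by simp
  qed
qed

end

section \<open>Convergence of minimizers\<close>

lemma unbounded_subsequence:
  fixes a :: "nat \<Rightarrow> real"
  assumes "\<And>b. \<exists>n. b < a n"
  obtains r where "strict_mono r" "filterlim (\<lambda>n. a (r n)) at_top sequentially"
proof -
  have step: "\<exists>k>N. b < a k" for b N
  proof -
    \<comment> \<open>Exceeding all values up to \<open>N\<close> forces the index beyond
      \<open>N\<close>.\<close>
    obtain n where n: "max b (Max (a ` {..N})) < a n" using assms by blast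
    have "\<not> n \<le> N"
    proof
      assume "n \<le> N"
      then have "a n \<le> Max (a ` {..N})" by (intro Max_ge) auto
      then show False using le_less_trans[OF max.cobounded2 n] by linarith
    qed
    then show ?thesis using n by (intro exI[of _ n]) auto
  qed
  have "\<exists>r. \<forall>n. real n < a (r n) \<and> r n < r (Suc n)"
  proof (rule dependent_nat_choice)
    show "\<exists>k. real 0 < a k" using step[of 0 0] by auto
    show "\<exists>k. real (Suc n) < a k \<and> m < k" for m n using step[of m "real (Suc n)"] by auto
  qed
  then obtain r where r: "\<And>n. real n < a (r n)" "\<And>n. r n < r (Suc n)" by blast
  have "strict_mono r" using r(2) by (simp add: strict_mono_Suc_iff)
  moreover have "filterlim (\<lambda>n. a (r n)) at_top sequentially"
    by (rule filterlim_at_top_mono[OF filterlim_real_sequentially]) (intro always_eventually allI less_imp_le r(1))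
  ultimately show ?thesis using that by blast
qed

text \<open>Coercivity in (A5) speaks of norms that diverge, whereas an unbounded sequence only has
  a divergent subsequence; hence the quantification over \<open>r\<close>.\<close>

lemma bounded_above_if_coercive:
  fixes a b :: "nat \<Rightarrow> real"
  assumes coercive: "\<And>r. strict_mono r \<Longrightarrow> filterlim (\<lambda>n. a (r n)) at_top sequentially \<Longrightarrow>
      filterlim (\<lambda>n. b (r n)) at_top sequentially"
    and b: "\<And>n. b n \<le> B"
  shows "\<exists>A. \<forall>n. a n \<le> A"
proof (rule ccontr)
  assume "\<not> ?thesis"
  then have "\<And>c. \<exists>n. c < a n" by (meson not_le)
  then obtain r where r: "strict_mono r" "filterlim (\<lambda>n. a (r n)) at_top sequentially"
    by (rule unbounded_subsequence)
  from coercive[OF this] have "eventually (\<lambda>n. B + 1 \<le> b (r n)) sequentially"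
    unfolding filterlim_at_top by blast
  then obtain n where "B + 1 \<le> b (r n)" using eventually_happens'[OF trivial_limit_sequentially] by blast
  then show False using b[of "r n"] by simp
qed

lemma convergent_bounded_above:
  fixes a :: "nat \<Rightarrow> real"
  assumes "a \<longlonglongrightarrow> l"
  obtains A where "\<And>n. a n \<le> A"
proof -
  have "bounded (range a)" using assms by (rule convergent_imp_bounded)
  then obtain A where A: "\<And>n. norm (a n) \<le> A" by (auto simp: bounded_iff)
  have "a n \<le> A" for n using abs_le_D1[OF A[of n, unfolded real_norm_def]] .
  then show ?thesis using that by blast
qed

text \<open>Weak convergence of pairs is expressed as weak convergence of both components along one
  common subsequence. \<open>V_reflexive\<close> provides the weak sequential compactness of bounded
  sets of velocities.\<close>

theorem theorem3p4:
  fixes \<Omega> :: "'a::euclidean_space set"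
    and \<iota> :: "'v::banach \<Rightarrow> 'a \<Rightarrow> 'a"
    and T :: "'a \<Rightarrow> real"
    and K :: "('a \<Rightarrow> real) \<Rightarrow> 'y::banach"
    and D :: "'y \<Rightarrow> 'y \<Rightarrow> real"
    and E1 :: "(real \<Rightarrow> 'v) \<Rightarrow> real"
    and E2 :: "('a \<Rightarrow> real) \<Rightarrow> real"
    and g :: 'y
    and \<gamma>1 \<gamma>2 :: "real \<Rightarrow> real"
    and \<delta> :: "nat \<Rightarrow> real"
    and gs :: "nat \<Rightarrow> 'y"
    and vs :: "nat \<Rightarrow> real \<Rightarrow> 'v"
    and zs :: "nat \<Rightarrow> 'a \<Rightarrow> real"
  assumes domain: "open \<Omega>" "connected \<Omega>" "\<Omega> \<noteq> {}" "bounded \<Omega>"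
    and V_admissible: "admissible \<Omega> \<iota>"
    and V_reflexive: "reflexive TYPE('v)"
    and T: "T \<in> images \<Omega>"
    and K_welldef: "L2_respects (lebesgue_on \<Omega>) K"
    and D_nonneg: "\<And>f h. 0 \<le> D f h"
    and E1_welldef: "L2_respects (lebesgue_on {0..1}) E1"
    and E1_nonneg: "\<And>v. v \<in> velocities \<Longrightarrow> 0 \<le> E1 v"
    and E2_welldef: "L2_respects (lebesgue_on \<Omega>) E2"
    and E2_nonneg: "\<And>z. z \<in> images \<Omega> \<Longrightarrow> 0 \<le> E2 z"
    and A1_cont: "\<And>x \<epsilon>. x \<in> images \<Omega> \<Longrightarrow> 0 < \<epsilon> \<Longrightarrow>
        \<exists>\<eta>>0. \<forall>y\<in>images \<Omega>. L2_norm (lebesgue_on \<Omega>) (\<lambda>\<xi>. y \<xi> - x \<xi>) < \<eta> \<longrightarrow> dist (K y) (K x) < \<epsilon>"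
    and A1_weak: "\<And>xs x. L2_weak_lim (lebesgue_on \<Omega>) xs x \<Longrightarrow> weak_lim (\<lambda>n. K (xs n)) (K x)"
    and A2_lsc: "\<And>h. weakly_lsc (\<lambda>f. D f h)"
    and A2_cont: "\<And>f. continuous_on UNIV (D f)"
    and A3: "\<And>f h. D f h = 0 \<Longrightarrow> f = h"
    and A4: "\<exists>C>0. \<forall>f g' h. \<bar>D f h - D f g'\<bar> \<le> C * D g' h"
    and A5_E2: "\<And>h fn zn. (\<And>n. fn n \<in> images \<Omega>) \<Longrightarrow> (\<And>n. zn n \<in> images \<Omega>) \<Longrightarrow>
        bounded (range (\<lambda>n. L2_norm (lebesgue_on \<Omega>) (fn n))) \<Longrightarrow>
        filterlim (\<lambda>n. L2_norm (lebesgue_on \<Omega>) (zn n)) at_top sequentially \<Longrightarrow>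
        filterlim (\<lambda>n. D (K (\<lambda>x. fn n x + zn n x)) h + E2 (zn n)) at_top sequentially"
    and A5_E1: "\<And>vn. (\<And>n. vn n \<in> velocities) \<Longrightarrow>
        filterlim (\<lambda>n. L2_norm (lebesgue_on {0..1}) (vn n)) at_top sequentially \<Longrightarrow>
        filterlim (\<lambda>n. E1 (vn n)) at_top sequentially"
    and A6: "L2_weakly_lsc (lebesgue_on {0..1}) E1" "L2_weakly_lsc (lebesgue_on \<Omega>) E2"
    and exact: "\<exists>v\<in>velocities. \<exists>z\<in>images \<Omega>. K (reconstruction \<Omega> \<iota> T v z) = g"
    and \<gamma>_pos: "\<And>d. 0 < d \<Longrightarrow> 0 < \<gamma>1 d" "\<And>d. 0 < d \<Longrightarrow> 0 < \<gamma>2 d"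
    and \<gamma>_tendsto: "(\<gamma>1 \<longlongrightarrow> 0) (at_right 0)" "(\<gamma>2 \<longlongrightarrow> 0) (at_right 0)"
    and \<gamma>_rate: "((\<lambda>d. d / \<gamma>1 d) \<longlongrightarrow> 0) (at_right 0)"
    and \<gamma>_ratio: "\<exists>c>0. ((\<lambda>d. \<gamma>2 d / \<gamma>1 d) \<longlongrightarrow> c) (at_right 0)"
    and \<delta>: "\<And>n. 0 < \<delta> n" "\<delta> \<longlonglongrightarrow> 0"
    and gs: "\<And>n. D g (gs n) \<le> \<delta> n"
    and minimizer_mem: "\<And>n. vs n \<in> velocities" "\<And>n. zs n \<in> images \<Omega>"
    and minimizer: "\<And>n v z. v \<in> velocities \<Longrightarrow> z \<in> images \<Omega> \<Longrightarrow>
        D (K (reconstruction \<Omega> \<iota> T (vs n) (zs n))) (gs n)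
          + \<gamma>1 (\<delta> n) * E1 (vs n) + \<gamma>2 (\<delta> n) * E2 (zs n)
        \<le> D (K (reconstruction \<Omega> \<iota> T v z)) (gs n) + \<gamma>1 (\<delta> n) * E1 v + \<gamma>2 (\<delta> n) * E2 z"
  shows "\<exists>r vstar zstar. strict_mono r \<and>
      L2_weak_lim (lebesgue_on {0..1}) (\<lambda>n. vs (r n)) vstar \<and>
      L2_weak_lim (lebesgue_on \<Omega>) (\<lambda>n. zs (r n)) zstar \<and>
      K (reconstruction \<Omega> \<iota> T vstar zstar) = g"
proof -
  let ?MV = "lebesgue_on {0..1::real}" and ?M = "lebesgue_on \<Omega>" and ?R = "reconstruction \<Omega> \<iota> T"
  obtain B where "domain_velocity_field (\<lambda>u x. if x \<in> \<Omega> then \<iota> u x else 0) B \<Omega> \<iota>"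
    using admissible_velocity_field[OF domain(1,4) V_admissible] by blast
  then interpret domain_velocity_field "\<lambda>u x. if x \<in> \<Omega> then \<iota> u x else 0" B \<Omega> \<iota> .
  obtain v0 z0 where v0: "v0 \<in> velocities" and z0: "z0 \<in> images \<Omega>" and g: "K (?R v0 z0) = g"
    using exact by blast
  obtain c where c: "c > 0" and ratio: "((\<lambda>d. \<gamma>2 d / \<gamma>1 d) \<longlongrightarrow> c) (at_right 0)" using \<gamma>_ratio by blast
  obtain C where C: "C > 0" "\<And>f g' h. \<bar>D f h - D f g'\<bar> \<le> C * D g' h" using A4 by blast
  have "\<delta> n \<noteq> 0" for n using \<delta>(1)[of n] by simp
  then have \<delta>0: "filterlim \<delta> (at_right 0) sequentially"
    using \<delta> by (auto simp: filterlim_at)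
  define g1 g2 where "g1 n = \<gamma>1 (\<delta> n)" and "g2 n = \<gamma>2 (\<delta> n)" for n
  have pos: "g1 n > 0" "g2 n > 0" for n using \<gamma>_pos \<delta>(1) by (auto simp: g1_def g2_def)
  have lims: "g1 \<longlonglongrightarrow> 0" "g2 \<longlonglongrightarrow> 0" "(\<lambda>n. \<delta> n / g1 n) \<longlonglongrightarrow> 0" "(\<lambda>n. g2 n / g1 n) \<longlonglongrightarrow> c"
    unfolding g1_def[abs_def] g2_def[abs_def]
    using \<gamma>_tendsto[THEN filterlim_compose, OF \<delta>0] \<gamma>_rate[THEN filterlim_compose, OF \<delta>0]
      ratio[THEN filterlim_compose, OF \<delta>0] by simp_all
  define k where "k n = K (?R (vs n) (zs n))" for n
  define e1 e2 where "e1 = E1 v0" and "e2 = E2 z0"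
  have E1: "0 \<le> E1 (vs n)" and E2: "0 \<le> E2 (zs n)" for n using E1_nonneg E2_nonneg minimizer_mem by auto
  \<comment> \<open>The exact pair is the competitor; its data term is \<open>D g (gs n)\<close>, at
    most \<open>\<delta> n\<close>.\<close>
  have min: "D (k n) (gs n) + g1 n * E1 (vs n) + g2 n * E2 (zs n) \<le> \<delta> n + g1 n * e1 + g2 n * e2" for n
    using minimizer[OF v0 z0, of n] gs[of n] unfolding k_def g1_def g2_def e1_def e2_def g by linarith
  have nn: "0 \<le> g1 n * E1 (vs n)" "0 \<le> g2 n * E2 (zs n)" for n using pos[of n] E1[of n] E2[of n] by auto

  have Dk_le: "D (k n) g \<le> (1 + C) * \<delta> n + g1 n * e1 + g2 n * e2" for n
  proof -
    \<comment> \<open>(A4) is applied with the exact data first in the error term, matching the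
      order in which the noise level is measured.\<close>
    have "D (k n) g \<le> D (k n) (gs n) + C * D g (gs n)" using C(2)[of "k n" "gs n" g] by linarith
    also have "C * D g (gs n) \<le> C * \<delta> n" using gs[of n] C(1) by simp
    finally show ?thesis using min[of n] nn[of n] by (simp add: distrib_right)
  qed
  have "(\<lambda>n. (1 + C) * \<delta> n + g1 n * e1 + g2 n * e2) \<longlonglongrightarrow> (1 + C) * 0 + 0 * e1 + 0 * e2"
    by (intro tendsto_intros lims \<delta>(2))
  then have Dk_bound_lim: "(\<lambda>n. (1 + C) * \<delta> n + g1 n * e1 + g2 n * e2) \<longlonglongrightarrow> 0" by simp
  have Dk: "(\<lambda>n. D (k n) g) \<longlonglongrightarrow> 0"
    by (rule real_tendsto_sandwich[OF _ _ tendsto_const Dk_bound_lim]) (use D_nonneg Dk_le in auto)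

  \<comment> \<open>The right-hand side of the minimality inequality divided by
    \<open>g1 n\<close>.\<close>
  have "(\<lambda>n. \<delta> n / g1 n + e1 + g2 n / g1 n * e2) \<longlonglongrightarrow> 0 + e1 + c * e2" by (intro tendsto_intros lims)
  then obtain A1 where A1: "\<And>n. \<delta> n / g1 n + e1 + g2 n / g1 n * e2 \<le> A1" by (rule convergent_bounded_above) blast
  have E1_le: "E1 (vs n) \<le> A1" for n
  proof -
    have "g1 n * E1 (vs n) \<le> \<delta> n + g1 n * e1 + g2 n * e2" using min[of n] nn(2)[of n] D_nonneg[of "k n" "gs n"] by linarith
    then have "E1 (vs n) \<le> (\<delta> n + g1 n * e1 + g2 n * e2) / g1 n" using pos(1)[of n] by (simp add: pos_le_divide_eq mult.commute)
    also have "\<dots> = \<delta> n / g1 n + e1 + g2 n / g1 n * e2" using pos(1)[of n] by (simp add: add_divide_distrib)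
    finally show ?thesis using A1[of n] by linarith
  qed
  \<comment> \<open>The same division by \<open>g2 n\<close>, written through
    \<open>g2 n / g1 n\<close>, whose limit \<open>c\<close> is nonzero.\<close>
  have "(\<lambda>n. (\<delta> n / g1 n + e1) / (g2 n / g1 n) + e2) \<longlonglongrightarrow> (0 + e1) / c + e2"
    using c by (intro tendsto_intros lims) auto
  then obtain A2 where A2: "\<And>n. (\<delta> n / g1 n + e1) / (g2 n / g1 n) + e2 \<le> A2" by (rule convergent_bounded_above) blast
  have E2_le: "E2 (zs n) \<le> A2" for n
  proof -
    have "g2 n * E2 (zs n) \<le> \<delta> n + g1 n * e1 + g2 n * e2" using min[of n] nn(1)[of n] D_nonneg[of "k n" "gs n"] by linarith
    then have "E2 (zs n) \<le> (\<delta> n + g1 n * e1 + g2 n * e2) / g2 n" using pos(2)[of n] by (simp add: pos_le_divide_eq mult.commute)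
    also have "\<dots> = (\<delta> n / g1 n + e1) / (g2 n / g1 n) + e2" using pos[of n] by (simp add: field_simps)
    finally show ?thesis using A2[of n] by linarith
  qed
  obtain A3 where A3: "\<And>n. D (k n) g \<le> A3" using Dk by (rule convergent_bounded_above) blast

  have "\<exists>A. \<forall>n. L2_norm ?MV (vs n) \<le> A"
  proof (rule bounded_above_if_coercive[OF _ E1_le])
    show "filterlim (\<lambda>n. E1 (vs (r n))) at_top sequentially"
      if "filterlim (\<lambda>n. L2_norm ?MV (vs (r n))) at_top sequentially" for r
      by (rule A5_E1[OF minimizer_mem(1) that])
  qed
  then obtain R where R: "\<And>n. L2_norm ?MV (vs n) \<le> R" by blast
  note def_L2 = deformed_L2[OF T minimizer_mem(1) R]
  have rec: "?R (vs n) (zs n) = (\<lambda>x. deformed T (vs n) x + zs n x)" for n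
    by (simp add: reconstruction_def deformed_def)
  have "\<exists>A. \<forall>n. L2_norm ?M (zs n) \<le> A"
  proof (rule bounded_above_if_coercive)
    show "D (k n) g + E2 (zs n) \<le> A3 + A2" for n using A3[of n] E2_le[of n] by linarith
    fix r :: "nat \<Rightarrow> nat"
    assume r: "filterlim (\<lambda>n. L2_norm ?M (zs (r n))) at_top sequentially"
    have "bounded (range (\<lambda>n. L2_norm ?M (deformed T (vs (r n)))))"
      using def_L2(2) space.L2_norm_nonneg by (intro boundedI[of _ "deformation_const R * L2_norm ?M T"]) auto
    from A5_E2[OF def_L2(1) minimizer_mem(2) this r, of g]
    show "filterlim (\<lambda>n. D (k (r n)) g + E2 (zs (r n))) at_top sequentially"
      by (simp add: k_def rec)
  qed
  then obtain R' where R': "\<And>n. L2_norm ?M (zs n) \<le> R'" by blast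

  obtain r1 v where r1: "strict_mono r1" and v: "L2_weak_lim ?MV (\<lambda>n. vs (r1 n)) v"
    using time.L2_weak_sequentially_compact[where vs = vs, OF V_reflexive minimizer_mem(1) R] by (elim exE conjE)
  obtain r2 z where r2: "strict_mono r2" and z: "L2_weak_lim ?M (\<lambda>n. zs (r1 (r2 n))) z"
    using space.L2_weak_sequentially_compact[where vs = "\<lambda>n. zs (r1 n)", OF reflexive_real minimizer_mem(2) R']
    by (elim exE conjE)
  define r where "r n = r1 (r2 n)" for n
  have r: "strict_mono r" using strict_mono_o[OF r1 r2] by (simp add: r_def[abs_def] o_def)
  have v': "L2_weak_lim ?MV (\<lambda>n. vs (r n)) v"
    using v LIMSEQ_subseq_LIMSEQ[OF _ r2] unfolding L2_weak_lim_def r_def by (fastforce simp: o_def)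
  have z': "L2_weak_lim ?M (\<lambda>n. zs (r n)) z" using z by (simp add: r_def)
  have "weak_lim (\<lambda>n. k (r n)) (K (?R v z))"
    unfolding k_def by (rule A1_weak[OF reconstruction_weak_lim[OF T v' R z']])
  then have "ereal (D (K (?R v z)) g) \<le> liminf (\<lambda>n. ereal (D (k (r n)) g))"
    using A2_lsc[of g] unfolding weakly_lsc_def by blast
  moreover have "(\<lambda>n. ereal (D (k (r n)) g)) \<longlonglongrightarrow> ereal 0"
    using LIMSEQ_subseq_LIMSEQ[OF Dk r] by (simp add: o_def)
  then have "liminf (\<lambda>n. ereal (D (k (r n)) g)) = ereal 0"
    by (rule lim_imp_Liminf[OF trivial_limit_sequentially])
  ultimately have "D (K (?R v z)) g \<le> 0" by simp
  then have "K (?R v z) = g" using A3 D_nonneg[of "K (?R v z)" g] by (intro assms) simp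
  then show ?thesis using r v' z' by blast
qed

end
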